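(* Let $q=p^s$ be a power of a prime $p$, $n\ge1$, $k=\bar{\mathbb{F}}_p$, $G=GL_n$ over $k$ and $w=(1,2,\dots,n)\in S_n$. Let $Q'=\mathrm{Spec}(k[x_1,\dots,x_n]/(e_n^{q-1}-1))$, where $e_n=\det(x_i^{q^{j-1}})_{1\le i,j\le n}$. Then $Q'$ is isomorphic, as a variety over $k$, to the Deligne--Lusztig variety $\tilde X(\dot w)$.
   Context: $F:GL_n\to GL_n$ is the Frobenius map $(a_{ij})\mapsto(a_{ij}^q)$; $U^*\subset GL_n$ is the group of upper triangular unipotent matrices; $\dot w$ is the permutation matrix with entries $1$ in positions $(1,n)$ and $(i+1,i)$, $1\le i\le n-1$, and $0$ elsewhere; $\mathrm{ad}(\dot w)U^*=\dot wU^*\dot w^{-1}$. The Deligne--Lusztig variety is $$\tilde X(\dot w)=\{g\in G\mid g^{-1}F(g)\in\dot wU^*\}/(U^*\cap \mathrm{ad}(\dot w)U^* ),$$ the quotient being by right multiplication. *)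

theory Defs
  imports
    "HOL-Analysis.Abstract_Topology"
    "HOL-Library.Poly_Mapping"
    "HOL-Computational_Algebra.Polynomial"
    "HOL-Algebra.QuotRing"
    "Jordan_Normal_Form.Determinant"
begin

section \<open>Algebraic closures of prime fields\<close>

text \<open>In characteristic \<open>p\<close> the set \<open>\<int>\<close>, the range of \<^term>\<open>of_int\<close>, is the prime field.\<close>

definition alg_closure_of_prime_field :: "'k::alg_closed_field itself \<Rightarrow> nat \<Rightarrow> bool" where
  "alg_closure_of_prime_field _ p \<longleftrightarrow>
     CHAR('k) = p \<and>
     (\<forall>x::'k. \<exists>f. f \<noteq> 0 \<and> (\<forall>i. coeff f i \<in> \<int>) \<and> poly f x = 0)"


section \<open>Polynomials in a set of variables\<close>

text \<open>
  A polynomial is a finitely supported map from monomials to coefficients, and a monomial is a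
  finitely supported map from variables to exponents. \<open>poly_ring V\<close> is the ring of polynomials
  in which only variables from \<open>V\<close> occur.
\<close>

type_synonym ('v, 'k) mpoly = "('v \<Rightarrow>\<^sub>0 nat) \<Rightarrow>\<^sub>0 'k"

definition poly_ring :: "'v set \<Rightarrow> ('v, 'k::comm_ring_1) mpoly ring" where
  "poly_ring V =
     \<lparr>carrier = {f. \<forall>m\<in>Poly_Mapping.keys f. Poly_Mapping.keys m \<subseteq> V},
      Group.monoid.mult = (*), one = 1, zero = 0, add = (+)\<rparr>"

definition mvar :: "'v \<Rightarrow> ('v, 'k::comm_ring_1) mpoly" where
  "mvar i = Poly_Mapping.single (Poly_Mapping.single i 1) 1"

definition mconst :: "'k::comm_ring_1 \<Rightarrow> ('v, 'k) mpoly" where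
  "mconst c = Poly_Mapping.single 0 c"

definition mpoly_eval :: "('v \<Rightarrow> 'k::comm_ring_1) \<Rightarrow> ('v, 'k) mpoly \<Rightarrow> 'k" where
  "mpoly_eval a f =
     (\<Sum>m\<in>Poly_Mapping.keys f. Poly_Mapping.lookup f m *
        (\<Prod>v\<in>Poly_Mapping.keys m. a v ^ Poly_Mapping.lookup m v))"


section \<open>Ringed spaces over a field\<close>

text \<open>
  A space with a sheaf of \<open>k\<close>-algebras: \<open>sections X U\<close> is the ring of sections over the open
  set \<open>U\<close>, \<open>restr X U W\<close> the restriction from \<open>U\<close> to \<open>W \<subseteq> U\<close>, and \<open>scalar X U\<close> the structure map
  from \<open>k\<close> to the sections over \<open>U\<close>.
\<close>

record ('p, 's, 'k) ringed_space =
  space_top :: "'p topology"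
  sections :: "'p set \<Rightarrow> 's ring"
  restr :: "'p set \<Rightarrow> 'p set \<Rightarrow> 's \<Rightarrow> 's"
  scalar :: "'p set \<Rightarrow> 'k \<Rightarrow> 's"

text \<open>
  For locally ringed spaces, an isomorphism of ringed spaces induces isomorphisms of the stalks,
  which are automatically local. So for schemes over \<open>k\<close> the following is isomorphism of schemes
  over \<open>k\<close>.
\<close>

definition isomorphic_over ::
    "('p, 's, 'k) ringed_space \<Rightarrow> ('r, 't, 'k) ringed_space \<Rightarrow> bool" where
  "isomorphic_over X Y \<longleftrightarrow>
     (\<exists>f \<phi>. homeomorphic_map (space_top X) (space_top Y) f \<and>
       (let pre = (\<lambda>U. {x \<in> topspace (space_top X). f x \<in> U}) in
        (\<forall>U. openin (space_top Y) U \<longrightarrow>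
           \<phi> U \<in> ring_iso (sections Y U) (sections X (pre U)) \<and>
           (\<forall>c. \<phi> U (scalar Y U c) = scalar X (pre U) c)) \<and>
        (\<forall>U W. openin (space_top Y) U \<longrightarrow> openin (space_top Y) W \<longrightarrow> W \<subseteq> U \<longrightarrow>
           (\<forall>s\<in>carrier (sections Y U).
              \<phi> W (restr Y U W s) = restr X (pre U) (pre W) (\<phi> U s)))))"


section \<open>The spectrum of an algebra\<close>

text \<open>The class of the fraction \<open>a / f\<close> in the localization of \<open>A\<close> at the prime ideal \<open>P\<close>.\<close>

definition fraction :: "'a ring \<Rightarrow> 'a set \<Rightarrow> 'a \<Rightarrow> 'a \<Rightarrow> ('a \<times> 'a) set" where
  "fraction A P a f =
     {(b, g). b \<in> carrier A \<and> g \<in> carrier A - P \<and>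
        (\<exists>h\<in>carrier A - P. h \<otimes>\<^bsub>A\<^esub> (g \<otimes>\<^bsub>A\<^esub> a) = h \<otimes>\<^bsub>A\<^esub> (f \<otimes>\<^bsub>A\<^esub> b))}"

text \<open>
  The sum and the product are unions over all choices of representatives; every choice gives the
  same class.
\<close>

definition local_ring :: "'a ring \<Rightarrow> 'a set \<Rightarrow> ('a \<times> 'a) set ring" where
  "local_ring A P =
     \<lparr>carrier = {fraction A P a f | a f. a \<in> carrier A \<and> f \<in> carrier A - P},
      Group.monoid.mult = (\<lambda>x y. \<Union>(a, f)\<in>x. \<Union>(b, g)\<in>y. fraction A P (a \<otimes>\<^bsub>A\<^esub> b) (f \<otimes>\<^bsub>A\<^esub> g)),
      one = fraction A P \<one>\<^bsub>A\<^esub> \<one>\<^bsub>A\<^esub>,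
      zero = fraction A P \<zero>\<^bsub>A\<^esub> \<one>\<^bsub>A\<^esub>,
      add = (\<lambda>x y. \<Union>(a, f)\<in>x. \<Union>(b, g)\<in>y.
               fraction A P ((a \<otimes>\<^bsub>A\<^esub> g) \<oplus>\<^bsub>A\<^esub> (b \<otimes>\<^bsub>A\<^esub> f)) (f \<otimes>\<^bsub>A\<^esub> g))\<rparr>"

definition spec_topology :: "'a ring \<Rightarrow> 'a set topology" where
  "spec_topology A =
     topology (\<lambda>U. \<exists>S\<subseteq>carrier A. U = {P. primeideal P A \<and> \<not> S \<subseteq> P})"

lemma openin_spec_topology:
  "openin (spec_topology A) U \<longleftrightarrow> (\<exists>S\<subseteq>carrier A. U = {P. primeideal P A \<and> \<not> S \<subseteq> P})"
proof -
  define opn where "opn U \<longleftrightarrow> (\<exists>S\<subseteq>carrier A. U = {P. primeideal P A \<and> \<not> S \<subseteq> P})" for U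
  have "opn (U \<inter> W)" if U: "opn U" and W: "opn W" for U W
  proof -
    obtain S where S: "S \<subseteq> carrier A" "U = {P. primeideal P A \<and> \<not> S \<subseteq> P}"
      using U opn_def by auto
    obtain T where T: "T \<subseteq> carrier A" "W = {P. primeideal P A \<and> \<not> T \<subseteq> P}"
      using W opn_def by auto
    define R where "R = {x \<in> carrier A. \<exists>s\<in>S. \<exists>t\<in>T. x = s \<otimes>\<^bsub>A\<^esub> t}"
    have "\<not> R \<subseteq> P \<longleftrightarrow> \<not> S \<subseteq> P \<and> \<not> T \<subseteq> P" if P: "primeideal P A" for P
    proof -
      interpret primeideal P A by fact
      have "s \<otimes>\<^bsub>A\<^esub> t \<in> P \<longleftrightarrow> s \<in> P \<or> t \<in> P" "s \<otimes>\<^bsub>A\<^esub> t \<in> carrier A"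
        if "s \<in> S" "t \<in> T" for s t
      proof -
        have "s \<in> carrier A" "t \<in> carrier A"
          using that S(1) T(1) by auto
        then show "s \<otimes>\<^bsub>A\<^esub> t \<in> P \<longleftrightarrow> s \<in> P \<or> t \<in> P" "s \<otimes>\<^bsub>A\<^esub> t \<in> carrier A"
          using I_prime I_l_closed I_r_closed by auto
      qed
      then show ?thesis
        unfolding R_def by blast
    qed
    then have "U \<inter> W = {P. primeideal P A \<and> \<not> R \<subseteq> P}"
      unfolding S(2) T(2) by blast
    moreover have "R \<subseteq> carrier A"
      by (auto simp: R_def)
    ultimately show ?thesis
      unfolding opn_def by blast
  qed
  moreover have "opn (\<Union>K)" if K: "\<forall>U\<in>K. opn U" for K
  proof -
    have "\<exists>S. \<forall>U\<in>K. S U \<subseteq> carrier A \<and> U = {P. primeideal P A \<and> \<not> S U \<subseteq> P}"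
      using K unfolding opn_def by (rule bchoice)
    then obtain S where S: "\<forall>U\<in>K. S U \<subseteq> carrier A \<and> U = {P. primeideal P A \<and> \<not> S U \<subseteq> P}" ..
    have "(\<Union>U\<in>K. U) = (\<Union>U\<in>K. {P. primeideal P A \<and> \<not> S U \<subseteq> P})"
      using S by (intro SUP_cong refl) (drule (1) bspec, elim conjE)
    then have "\<Union>K = (\<Union>U\<in>K. {P. primeideal P A \<and> \<not> S U \<subseteq> P})"
      by simp
    also have "\<dots> = {P. primeideal P A \<and> \<not> (\<Union>U\<in>K. S U) \<subseteq> P}"
      by blast
    finally have "\<Union>K = {P. primeideal P A \<and> \<not> (\<Union>U\<in>K. S U) \<subseteq> P}" .
    moreover have "(\<Union>U\<in>K. S U) \<subseteq> carrier A"
      using S by (intro UN_least) simp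
    ultimately show ?thesis
      unfolding opn_def by (intro exI conjI)
  qed
  ultimately have "istopology opn"
    unfolding istopology_def by blast
  then show ?thesis
    unfolding spec_topology_def opn_def[abs_def] by simp
qed

definition spec_sections :: "'a ring \<Rightarrow> 'a set set \<Rightarrow> ('a set \<Rightarrow> ('a \<times> 'a) set) set" where
  "spec_sections A U =
     {s \<in> (\<Pi>\<^sub>E P\<in>U. carrier (local_ring A P)).
        \<forall>P\<in>U. \<exists>W a f. openin (spec_topology A) W \<and> P \<in> W \<and> W \<subseteq> U \<and>
          a \<in> carrier A \<and> f \<in> carrier A \<and> (\<forall>Q\<in>W. f \<notin> Q \<and> s Q = fraction A Q a f)}"

text \<open>The spectrum of a \<open>k\<close>-algebra \<open>A\<close> with structure map \<open>\<iota>\<close>.\<close>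

definition Spec ::
    "'a ring \<Rightarrow> ('k \<Rightarrow> 'a) \<Rightarrow> ('a set, 'a set \<Rightarrow> ('a \<times> 'a) set, 'k) ringed_space" where
  "Spec A \<iota> =
     \<lparr>space_top = spec_topology A,
      sections = (\<lambda>U.
        \<lparr>carrier = spec_sections A U,
         Group.monoid.mult = (\<lambda>s t. \<lambda>P\<in>U. s P \<otimes>\<^bsub>local_ring A P\<^esub> t P),
         one = (\<lambda>P\<in>U. \<one>\<^bsub>local_ring A P\<^esub>),
         zero = (\<lambda>P\<in>U. \<zero>\<^bsub>local_ring A P\<^esub>),
         add = (\<lambda>s t. \<lambda>P\<in>U. s P \<oplus>\<^bsub>local_ring A P\<^esub> t P)\<rparr>),
      restr = (\<lambda>U W s. restrict s W),
      scalar = (\<lambda>U c. \<lambda>P\<in>U. fraction A P (\<iota> c) \<one>\<^bsub>A\<^esub>)\<rparr>"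


section \<open>Spaces with functions\<close>

text \<open>
  Classical varieties over an algebraically closed field: a space with, for each open set \<open>U\<close>,
  the regular functions on \<open>U\<close> (taken to be \<open>undefined\<close> outside \<open>U\<close>).
\<close>

record ('p, 'k) function_space =
  fs_top :: "'p topology"
  regular :: "'p set \<Rightarrow> ('p \<Rightarrow> 'k) set"

text \<open>The Zariski topology and the regular functions on a set \<open>X\<close> of \<open>n \<times> n\<close> matrices.\<close>

definition mat_zariski :: "nat \<Rightarrow> 'k::field mat set \<Rightarrow> 'k mat topology" where
  "mat_zariski n X =
     topology (\<lambda>U. \<exists>S\<subseteq>carrier (poly_ring ({..<n} \<times> {..<n})).
       U = {g \<in> X. \<not> (\<forall>f\<in>S. mpoly_eval (($$) g) f = 0)})"

definition mat_variety :: "nat \<Rightarrow> 'k::field mat set \<Rightarrow> ('k mat, 'k) function_space" where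
  "mat_variety n X =
     \<lparr>fs_top = mat_zariski n X,
      regular = (\<lambda>U. {r \<in> extensional U.
        \<forall>g\<in>U. \<exists>W a f. openin (mat_zariski n X) W \<and> g \<in> W \<and> W \<subseteq> U \<and>
          a \<in> carrier (poly_ring ({..<n} \<times> {..<n})) \<and>
          f \<in> carrier (poly_ring ({..<n} \<times> {..<n})) \<and>
          (\<forall>h\<in>W. mpoly_eval (($$) h) f \<noteq> 0 \<and> r h = mpoly_eval (($$) h) a / mpoly_eval (($$) h) f)})\<rparr>"

text \<open>
  The quotient by the equivalence relation on the underlying set whose class map is \<open>\<pi>\<close>: it
  carries the quotient topology, and a function is regular iff its pullback along \<open>\<pi>\<close> is.
\<close>

definition fs_quotient_top :: "('p, 'k) function_space \<Rightarrow> ('p \<Rightarrow> 'r) \<Rightarrow> 'r topology" where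
  "fs_quotient_top X \<pi> =
     topology (\<lambda>U. U \<subseteq> \<pi> ` topspace (fs_top X) \<and>
       openin (fs_top X) {x \<in> topspace (fs_top X). \<pi> x \<in> U})"

lemma openin_fs_quotient_top:
  "openin (fs_quotient_top X \<pi>) U \<longleftrightarrow>
     U \<subseteq> \<pi> ` topspace (fs_top X) \<and> openin (fs_top X) {x \<in> topspace (fs_top X). \<pi> x \<in> U}"
proof -
  let ?opn = "\<lambda>U. U \<subseteq> \<pi> ` topspace (fs_top X) \<and>
    openin (fs_top X) {x \<in> topspace (fs_top X). \<pi> x \<in> U}"
  have "{x \<in> topspace (fs_top X). \<pi> x \<in> U \<inter> W} =
      {x \<in> topspace (fs_top X). \<pi> x \<in> U} \<inter> {x \<in> topspace (fs_top X). \<pi> x \<in> W}" for U W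
    by auto
  moreover have "{x \<in> topspace (fs_top X). \<pi> x \<in> \<Union>K} =
      (\<Union>U\<in>K. {x \<in> topspace (fs_top X). \<pi> x \<in> U})" for K
    by auto
  ultimately have "istopology ?opn"
    unfolding istopology_def by (auto simp: openin_Int intro!: openin_Union)
  then show ?thesis
    unfolding fs_quotient_top_def by simp
qed

definition fs_quotient :: "('p, 'k) function_space \<Rightarrow> ('p \<Rightarrow> 'r) \<Rightarrow> ('r, 'k) function_space" where
  "fs_quotient X \<pi> =
     \<lparr>fs_top = fs_quotient_top X \<pi>,
      regular = (\<lambda>U. {r \<in> extensional U.
        (\<lambda>x\<in>{x \<in> topspace (fs_top X). \<pi> x \<in> U}. r (\<pi> x))
          \<in> regular X {x \<in> topspace (fs_top X). \<pi> x \<in> U}})\<rparr>"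

subsection \<open>The associated scheme\<close>

text \<open>
  The fully faithful functor from classical varieties to schemes over \<open>k\<close>. The points are the
  nonempty irreducible closed subsets, the open sets are those of the form
  \<open>{Z. Z \<inter> U \<noteq> {}}\<close> for \<open>U\<close> open, and the structure sheaf is the direct image of the sheaf of
  regular functions along the map sending a point to its closure.
\<close>

definition irreducible_closed :: "'p topology \<Rightarrow> 'p set \<Rightarrow> bool" where
  "irreducible_closed T Z \<longleftrightarrow> closedin T Z \<and> Z \<noteq> {} \<and>
     (\<forall>A B. closedin T A \<longrightarrow> closedin T B \<longrightarrow> Z \<subseteq> A \<union> B \<longrightarrow> Z \<subseteq> A \<or> Z \<subseteq> B)"

definition scheme_top :: "'p topology \<Rightarrow> 'p set topology" where
  "scheme_top T =
     topology (\<lambda>W. \<exists>U. openin T U \<and> W = {Z. irreducible_closed T Z \<and> Z \<inter> U \<noteq> {}})"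

lemma openin_scheme_top:
  "openin (scheme_top T) W \<longleftrightarrow>
     (\<exists>U. openin T U \<and> W = {Z. irreducible_closed T Z \<and> Z \<inter> U \<noteq> {}})"
proof -
  define opn where "opn W \<longleftrightarrow>
    (\<exists>U. openin T U \<and> W = {Z. irreducible_closed T Z \<and> Z \<inter> U \<noteq> {}})" for W
  have "opn (W \<inter> W')" if W: "opn W" and W': "opn W'" for W W'
  proof -
    obtain U where U: "openin T U" "W = {Z. irreducible_closed T Z \<and> Z \<inter> U \<noteq> {}}"
      using W opn_def by auto
    obtain U' where U': "openin T U'" "W' = {Z. irreducible_closed T Z \<and> Z \<inter> U' \<noteq> {}}"
      using W' opn_def by auto
    have "Z \<inter> (U \<inter> U') \<noteq> {}"
      if Z: "irreducible_closed T Z" and "Z \<inter> U \<noteq> {}" "Z \<inter> U' \<noteq> {}" for Z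
    proof
      assume "Z \<inter> (U \<inter> U') = {}"
      moreover have "Z \<subseteq> topspace T"
        using Z closedin_subset unfolding irreducible_closed_def by blast
      ultimately have "Z \<subseteq> (topspace T - U) \<union> (topspace T - U')"
        by blast
      then have "Z \<subseteq> topspace T - U \<or> Z \<subseteq> topspace T - U'"
        using Z U(1) U'(1) unfolding irreducible_closed_def by blast
      then show False
        using that by blast
    qed
    then have "W \<inter> W' = {Z. irreducible_closed T Z \<and> Z \<inter> (U \<inter> U') \<noteq> {}}"
      unfolding U(2) U'(2) by blast
    then show ?thesis
      unfolding opn_def using U(1) U'(1) openin_Int by blast
  qed
  moreover have "opn (\<Union>K)" if K: "\<forall>W\<in>K. opn W" for K
  proof -
    have "\<exists>U. \<forall>W\<in>K. openin T (U W) \<and> W = {Z. irreducible_closed T Z \<and> Z \<inter> U W \<noteq> {}}"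
      using K unfolding opn_def by (rule bchoice)
    then obtain U where
      U: "\<forall>W\<in>K. openin T (U W) \<and> W = {Z. irreducible_closed T Z \<and> Z \<inter> U W \<noteq> {}}" ..
    have "(\<Union>W\<in>K. W) = (\<Union>W\<in>K. {Z. irreducible_closed T Z \<and> Z \<inter> U W \<noteq> {}})"
      using U by (intro SUP_cong refl) (drule (1) bspec, elim conjE)
    then have "\<Union>K = (\<Union>W\<in>K. {Z. irreducible_closed T Z \<and> Z \<inter> U W \<noteq> {}})"
      by simp
    also have "\<dots> = {Z. irreducible_closed T Z \<and> Z \<inter> (\<Union>W\<in>K. U W) \<noteq> {}}"
      by blast
    finally have "\<Union>K = {Z. irreducible_closed T Z \<and> Z \<inter> (\<Union>W\<in>K. U W) \<noteq> {}}" .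
    moreover have "openin T (\<Union>W\<in>K. U W)"
      using U by (intro openin_Union) auto
    ultimately show ?thesis
      unfolding opn_def by (intro exI conjI)
  qed
  ultimately have "istopology opn"
    unfolding istopology_def by blast
  then show ?thesis
    unfolding scheme_top_def opn_def[abs_def] by simp
qed

definition closure_preimage :: "'p topology \<Rightarrow> 'p set set \<Rightarrow> 'p set" where
  "closure_preimage T W = {x \<in> topspace T. T closure_of {x} \<in> W}"

definition scheme_of ::
    "('p, 'k::field) function_space \<Rightarrow> ('p set, 'p \<Rightarrow> 'k, 'k) ringed_space" where
  "scheme_of X =
     \<lparr>space_top = scheme_top (fs_top X),
      sections = (\<lambda>W. let U = closure_preimage (fs_top X) W in
        \<lparr>carrier = regular X U,
         Group.monoid.mult = (\<lambda>r s. \<lambda>x\<in>U. r x * s x),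
         one = (\<lambda>x\<in>U. 1),
         zero = (\<lambda>x\<in>U. 0),
         add = (\<lambda>r s. \<lambda>x\<in>U. r x + s x)\<rparr>),
      restr = (\<lambda>W W' r. restrict r (closure_preimage (fs_top X) W')),
      scalar = (\<lambda>W c. \<lambda>x\<in>closure_preimage (fs_top X) W. c)\<rparr>"


section \<open>The Deligne--Lusztig variety\<close>

text \<open>Rows and columns of matrices are numbered from \<open>0\<close>.\<close>

definition GL :: "nat \<Rightarrow> 'k::field mat monoid" where
  "GL n = units_of (ring_mat TYPE('k) n ())"

definition Frob :: "nat \<Rightarrow> 'k::field mat \<Rightarrow> 'k mat" where
  "Frob q g = map_mat (\<lambda>a. a ^ q) g"

definition unipotent_upper :: "nat \<Rightarrow> 'k::field mat set" where
  "unipotent_upper n =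
     {u \<in> carrier_mat n n. upper_triangular u \<and> (\<forall>i<n. u $$ (i, i) = 1)}"

definition wdot :: "nat \<Rightarrow> 'k::field mat" where
  "wdot n = mat n n (\<lambda>(i, j). if (i = 0 \<and> j = n - 1) \<or> i = j + 1 then 1 else 0)"

definition ad_unipotent_upper :: "nat \<Rightarrow> 'k::field mat set" where
  "ad_unipotent_upper n =
     (\<lambda>u. wdot n \<otimes>\<^bsub>GL n\<^esub> u \<otimes>\<^bsub>GL n\<^esub> inv\<^bsub>GL n\<^esub> wdot n) ` unipotent_upper n"

definition DL_cover :: "nat \<Rightarrow> nat \<Rightarrow> 'k::field mat set" where
  "DL_cover q n =
     {g \<in> carrier (GL n).
        inv\<^bsub>GL n\<^esub> g \<otimes>\<^bsub>GL n\<^esub> Frob q g \<in> wdot n <#\<^bsub>GL n\<^esub> unipotent_upper n}"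

definition DL_variety :: "nat \<Rightarrow> nat \<Rightarrow> ('k::field mat set, 'k) function_space" where
  "DL_variety q n =
     fs_quotient (mat_variety n (DL_cover q n))
       (\<lambda>g. g <#\<^bsub>GL n\<^esub> (unipotent_upper n \<inter> ad_unipotent_upper n))"


section \<open>The affine scheme \<open>Q'\<close>\<close>

text \<open>With indices starting at \<open>0\<close>, the entries of the matrix are the \<open>x\<^sub>i ^ (q ^ j)\<close>.\<close>

definition moore_det :: "nat \<Rightarrow> nat \<Rightarrow> (nat, 'k::field) mpoly" where
  "moore_det q n = det (mat n n (\<lambda>(i, j). mvar i ^ (q ^ j)))"

definition Q'_ideal :: "nat \<Rightarrow> nat \<Rightarrow> (nat, 'k::field) mpoly set" where
  "Q'_ideal q n = PIdl\<^bsub>poly_ring {..<n}\<^esub> (moore_det q n ^ (q - 1) - 1)"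

definition Q' ::
    "nat \<Rightarrow> nat \<Rightarrow>
      ((nat, 'k::field) mpoly set set,
       (nat, 'k) mpoly set set \<Rightarrow> ((nat, 'k) mpoly set \<times> (nat, 'k) mpoly set) set,
       'k) ringed_space" where
  "Q' q n = Spec (poly_ring {..<n} Quot Q'_ideal q n)
                 (\<lambda>c. Q'_ideal q n +>\<^bsub>poly_ring {..<n}\<^esub> mconst c)"

end

theory Submission
  imports Defs
begin

text \<open>
  The first column \<open>x\<close> of \<open>g\<close> determines its class: the relation \<open>F(g) = g \<cdot> wdot n \<cdot> u\<close> with \<open>u\<close>
  unipotent forces \<open>g = M(x) v\<close>, where \<open>M(x)\<close> has the columns \<open>x, F(x), \<dots>, F\<^bsup>n-1\<^esup>(x)\<close> and \<open>v\<close> lies in the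
  group that is divided out. Taking determinants, such a \<open>g\<close> exists iff \<open>e\<^sub>n(x)\<^bsup>q-1\<^esup> = det (wdot n)\<close>, and
  rescaling \<open>x\<close> turns the right hand side into \<open>1\<close>. As both \<open>g \<mapsto> x\<close> and \<open>x \<mapsto> M(x)\<close> are polynomial, the
  Deligne--Lusztig variety is the zero set of \<open>h = e\<^sub>n\<^bsup>q-1\<^esup> - 1\<close> as a space with functions.

  By the Nullstellensatz it remains to see that the ideal of \<open>h\<close> is radical. The Euler derivation maps
  \<open>h\<close> to \<open>-(h + 1)\<close>, which is a unit modulo \<open>h\<close>. Hence if \<open>h\<close> divides a \<open>p\<close>-th power \<open>f\<^sup>p\<close>, then so does \<open>h\<^sup>p\<close>;
  the quotient is killed by all partial derivatives, so it is a \<open>p\<close>-th power and \<open>h\<close> divides \<open>f\<close>.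
\<close>

section \<open>The spectrum of a coordinate ring\<close>

locale coordinate_ring = cring A for A :: "'a ring" (structure) +
  fixes X :: "('r, 'k::field) function_space"
    and Y :: "'r set"
    and ev :: "'a \<Rightarrow> 'r \<Rightarrow> 'k"
    and \<iota> :: "'k \<Rightarrow> 'a"
  assumes ev_mult: "\<lbrakk>y \<in> Y; a \<in> carrier A; b \<in> carrier A\<rbrakk> \<Longrightarrow> ev (a \<otimes> b) y = ev a y * ev b y"
    and ev_add: "\<lbrakk>y \<in> Y; a \<in> carrier A; b \<in> carrier A\<rbrakk> \<Longrightarrow> ev (a \<oplus> b) y = ev a y + ev b y"
    and scalar_closed: "\<iota> c \<in> carrier A"
    and ev_scalar: "y \<in> Y \<Longrightarrow> ev (\<iota> c) y = c"
    and ev_inj: "\<lbrakk>a \<in> carrier A; b \<in> carrier A; \<And>y. y \<in> Y \<Longrightarrow> ev a y = ev b y\<rbrakk> \<Longrightarrow> a = b"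
    and nullstellensatz:
      "\<lbrakk>primeideal P A; a \<in> carrier A; a \<notin> P\<rbrakk> \<Longrightarrow> \<exists>y\<in>Y. (\<forall>p\<in>P. ev p y = 0) \<and> ev a y \<noteq> 0"
    and openin_X:
      "openin (fs_top X) U \<longleftrightarrow> (\<exists>S\<subseteq>carrier A. U = {y \<in> Y. \<not> (\<forall>f\<in>S. ev f y = 0)})"
    and regular_X:
      "openin (fs_top X) U \<Longrightarrow> r \<in> regular X U \<longleftrightarrow> r \<in> extensional U \<and>
        (\<forall>y\<in>U. \<exists>W a f. openin (fs_top X) W \<and> y \<in> W \<and> W \<subseteq> U \<and> a \<in> carrier A \<and> f \<in> carrier A \<and>
          (\<forall>z\<in>W. ev f z \<noteq> 0 \<and> r z = ev a z / ev f z))"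
begin

abbreviation "T \<equiv> fs_top X"

definition zeros :: "'a set \<Rightarrow> 'r set" where
  "zeros P = {y \<in> Y. \<forall>p\<in>P. ev p y = 0}"

definition nonzeros :: "'a set \<Rightarrow> 'r set" where
  "nonzeros S = {y \<in> Y. \<exists>f\<in>S. ev f y \<noteq> 0}"

definition vanishing :: "'r set \<Rightarrow> 'a set" where
  "vanishing Z = {a \<in> carrier A. \<forall>y\<in>Z. ev a y = 0}"

lemma openin_iff: "openin T U \<longleftrightarrow> (\<exists>S\<subseteq>carrier A. U = nonzeros S)"
  unfolding openin_X nonzeros_def by simp

lemma ev_one: "y \<in> Y \<Longrightarrow> ev \<one> y = 1"
  using ev_mult[of y \<one> "\<iota> 1"] ev_scalar[of y 1] scalar_closed[of 1] by simp

lemma ev_zero: "y \<in> Y \<Longrightarrow> ev \<zero> y = 0"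
  using ev_add[of y \<zero> \<zero>] by (metis add_cancel_right_right l_zero zero_closed)

lemma openin_subset_points: "openin T U \<Longrightarrow> U \<subseteq> Y"
  unfolding openin_iff nonzeros_def by auto

lemma openin_nonzeros: "S \<subseteq> carrier A \<Longrightarrow> openin T (nonzeros S)"
  using openin_iff by blast

lemma topspace_X: "topspace T = Y"
proof -
  have "nonzeros {\<one>} = Y"
    by (auto simp: nonzeros_def ev_one)
  then have "openin T Y"
    using openin_nonzeros[of "{\<one>}"] by simp
  then show ?thesis
    by (meson openin_subset openin_subset_points openin_topspace subset_antisym)
qed

lemma meets_nonzeros_iff:
  assumes "primeideal P A" "S \<subseteq> carrier A"
  shows "zeros P \<inter> nonzeros S \<noteq> {} \<longleftrightarrow> \<not> S \<subseteq> P"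
proof
  assume "zeros P \<inter> nonzeros S \<noteq> {}"
  then show "\<not> S \<subseteq> P"
    unfolding zeros_def nonzeros_def by blast
next
  assume "\<not> S \<subseteq> P"
  then obtain s where "s \<in> S" "s \<notin> P" by blast
  with nullstellensatz[OF assms(1), of s] assms(2)
  show "zeros P \<inter> nonzeros S \<noteq> {}"
    unfolding zeros_def nonzeros_def by blast
qed

lemma open_meets_iff:
  assumes "primeideal P A" "openin T U"
  shows "zeros P \<inter> U \<noteq> {} \<longleftrightarrow> (\<exists>s\<in>carrier A - P. nonzeros {s} \<subseteq> U)"
proof -
  obtain S where S: "S \<subseteq> carrier A" "U = nonzeros S"
    using assms(2) openin_iff by auto
  show ?thesis
  proof
    assume "zeros P \<inter> U \<noteq> {}"
    then obtain s where "s \<in> S" "s \<notin> P"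
      using meets_nonzeros_iff[OF assms(1) S(1)] S(2) by blast
    then show "\<exists>s\<in>carrier A - P. nonzeros {s} \<subseteq> U"
      using S unfolding nonzeros_def by blast
  next
    assume "\<exists>s\<in>carrier A - P. nonzeros {s} \<subseteq> U"
    then obtain s where s: "s \<in> carrier A" "s \<notin> P" "nonzeros {s} \<subseteq> U"
      by auto
    then have "zeros P \<inter> nonzeros {s} \<noteq> {}"
      using meets_nonzeros_iff[OF assms(1), of "{s}"] by simp
    then show "zeros P \<inter> U \<noteq> {}"
      using s(3) by blast
  qed
qed

lemma prime_mult_notin:
  assumes "primeideal P A" "a \<in> carrier A - P" "b \<in> carrier A - P"
  shows "a \<otimes> b \<in> carrier A - P"
  using primeideal.I_prime[OF assms(1), of a b] assms(2,3) by auto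

lemma zeros_irreducible:
  assumes P: "primeideal P A" and U: "openin T U" "zeros P \<inter> U \<noteq> {}"
    and V: "openin T V" "zeros P \<inter> V \<noteq> {}"
  shows "zeros P \<inter> (U \<inter> V) \<noteq> {}"
proof -
  obtain s where s: "s \<in> carrier A - P" "nonzeros {s} \<subseteq> U"
    using open_meets_iff[OF P U(1)] U(2) by auto
  obtain t where t: "t \<in> carrier A - P" "nonzeros {t} \<subseteq> V"
    using open_meets_iff[OF P V(1)] V(2) by auto
  have "nonzeros {s \<otimes> t} \<subseteq> U \<inter> V"
    using s t ev_mult unfolding nonzeros_def by auto
  moreover have "openin T (U \<inter> V)"
    using U V by blast
  ultimately show ?thesis
    using open_meets_iff[OF P] prime_mult_notin[OF P s(1) t(1)] by metis
qed

lemma closedin_zeros: "S \<subseteq> carrier A \<Longrightarrow> closedin T (zeros S)"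
proof -
  assume S: "S \<subseteq> carrier A"
  have "Y - zeros S = nonzeros S"
    unfolding zeros_def nonzeros_def by auto
  then show ?thesis
    unfolding closedin_def topspace_X using openin_nonzeros[OF S] by (auto simp: zeros_def)
qed

lemma primeideal_subset: "primeideal P A \<Longrightarrow> P \<subseteq> carrier A"
  by (simp add: additive_subgroup.a_subset ideal.axioms(1) primeideal.axioms(1))

lemma one_notin_prime: "primeideal P A \<Longrightarrow> \<one> \<notin> P"
  by (metis ideal.one_imp_carrier primeideal.I_notcarr primeideal.axioms(1))

lemma irreducible_closed_zeros:
  assumes P: "primeideal P A"
  shows "irreducible_closed T (zeros P)"
  unfolding irreducible_closed_def
proof (intro conjI allI impI)
  show "closedin T (zeros P)"
    using closedin_zeros primeideal_subset[OF P] by blast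
  show "zeros P \<noteq> {}"
    using meets_nonzeros_iff[OF P, of "{\<one>}"] one_notin_prime[OF P] by auto
  fix B C assume BC: "closedin T B" "closedin T C" "zeros P \<subseteq> B \<union> C"
  show "zeros P \<subseteq> B \<or> zeros P \<subseteq> C"
  proof (rule ccontr)
    assume neg: "\<not> ?thesis"
    have "zeros P \<subseteq> topspace T"
      unfolding topspace_X zeros_def by auto
    with neg have "zeros P \<inter> (topspace T - B) \<noteq> {}" "zeros P \<inter> (topspace T - C) \<noteq> {}"
      by blast+
    then have "zeros P \<inter> ((topspace T - B) \<inter> (topspace T - C)) \<noteq> {}"
      using zeros_irreducible[OF P] BC(1,2) by (metis closedin_def)
    with BC(3) show False by blast
  qed
qed

lemma ideal_vanishing: "Z \<subseteq> Y \<Longrightarrow> ideal (vanishing Z) A"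
proof -
  assume Z: "Z \<subseteq> Y"
  then have Zm: "y \<in> Z \<Longrightarrow> y \<in> Y" for y by blast
  have neg: "ev (\<ominus> a) y = 0" if "a \<in> vanishing Z" "y \<in> Z" for a y
    using that ev_add[of y a "\<ominus> a"] ev_zero[of y] Z unfolding vanishing_def
    by (auto simp: r_neg)
  show ?thesis
  proof (rule idealI[OF ring_axioms])
    show "subgroup (vanishing Z) (add_monoid A)"
    proof (rule subgroup.intro)
      fix a assume a: "a \<in> vanishing Z"
      then have "\<ominus> a \<in> vanishing Z"
        using neg by (auto simp: vanishing_def)
      then show "inv\<^bsub>add_monoid A\<^esub> a \<in> vanishing Z"
        unfolding a_inv_def .
    qed (auto simp: Zm vanishing_def ev_zero ev_add)
  qed (auto simp: Zm vanishing_def ev_mult)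
qed

lemma closed_eq_zeros_vanishing:
  assumes "closedin T Z"
  shows "zeros (vanishing Z) = Z"
proof -
  have ZY: "Z \<subseteq> Y"
    using assms closedin_subset topspace_X by metis
  obtain S where S: "S \<subseteq> carrier A" "Y - Z = nonzeros S"
    using assms openin_iff unfolding closedin_def topspace_X by auto
  have "S \<subseteq> vanishing Z"
    using S ZY unfolding vanishing_def nonzeros_def by blast
  then show ?thesis
    using S ZY unfolding zeros_def vanishing_def nonzeros_def by blast
qed

lemma primeideal_vanishing:
  assumes Z: "irreducible_closed T Z"
  shows "primeideal (vanishing Z) A"
proof (rule primeidealI)
  have cl: "closedin T Z" and ZY: "Z \<subseteq> Y"
    using Z closedin_subset topspace_X unfolding irreducible_closed_def by metis+
  show "ideal (vanishing Z) A"
    by (rule ideal_vanishing[OF ZY])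
  show "cring A" ..
  obtain y where "y \<in> Z"
    using Z unfolding irreducible_closed_def by blast
  then have "\<one> \<notin> vanishing Z"
    using ZY ev_one[of y] unfolding vanishing_def by force
  then show "carrier A \<noteq> vanishing Z"
    by blast
  fix a b assume ab: "a \<in> carrier A" "b \<in> carrier A" "a \<otimes> b \<in> vanishing Z"
  have "Z \<subseteq> zeros {a} \<union> zeros {b}"
    using ab ZY ev_mult unfolding zeros_def vanishing_def by fastforce
  then have "Z \<subseteq> zeros {a} \<or> Z \<subseteq> zeros {b}"
    using Z closedin_zeros ab(1,2) unfolding irreducible_closed_def
    by (metis empty_subsetI insert_subset)
  then show "a \<in> vanishing Z \<or> b \<in> vanishing Z"
    using ab unfolding zeros_def vanishing_def by blast
qed

lemma vanishing_zeros:
  assumes P: "primeideal P A"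
  shows "vanishing (zeros P) = P"
  using nullstellensatz[OF P] primeideal_subset[OF P]
  unfolding vanishing_def zeros_def by blast

lemma primeideal_vanishing_point: "y \<in> Y \<Longrightarrow> primeideal (vanishing {y}) A"
proof (rule primeidealI)
  assume y: "y \<in> Y"
  then show "ideal (vanishing {y}) A" by (intro ideal_vanishing) auto
  show "cring A" ..
  have "\<one> \<notin> vanishing {y}"
    using y ev_one[of y] unfolding vanishing_def by auto
  then show "carrier A \<noteq> vanishing {y}"
    by blast
  show "a \<in> vanishing {y} \<or> b \<in> vanishing {y}"
    if "a \<in> carrier A" "b \<in> carrier A" "a \<otimes> b \<in> vanishing {y}" for a b
    using that y ev_mult unfolding vanishing_def by auto
qed

lemma zeros_vanishing_point_meets:
  assumes "y \<in> Y" "openin T U"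
  shows "zeros (vanishing {y}) \<inter> U \<noteq> {} \<longleftrightarrow> y \<in> U"
proof
  assume "y \<in> U"
  then show "zeros (vanishing {y}) \<inter> U \<noteq> {}"
    using assms(1) unfolding zeros_def vanishing_def by auto
next
  assume "zeros (vanishing {y}) \<inter> U \<noteq> {}"
  then obtain s where "s \<in> carrier A - vanishing {y}" "nonzeros {s} \<subseteq> U"
    using open_meets_iff[OF primeideal_vanishing_point[OF assms(1)] assms(2)] by auto
  then show "y \<in> U"
    using assms(1) unfolding vanishing_def nonzeros_def by auto
qed

lemma closure_of_point:
  assumes "y \<in> Y"
  shows "T closure_of {y} = zeros (vanishing {y})"
proof (rule closure_of_unique)
  show "{y} \<subseteq> zeros (vanishing {y})"
    using assms unfolding zeros_def vanishing_def by auto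
  show "closedin T (zeros (vanishing {y}))"
    by (rule closedin_zeros) (auto simp: vanishing_def)
  fix C assume C: "{y} \<subseteq> C" "closedin T C"
  have "vanishing C \<subseteq> vanishing {y}"
    using C unfolding vanishing_def by auto
  then have "zeros (vanishing {y}) \<subseteq> zeros (vanishing C)"
    unfolding zeros_def by auto
  then show "zeros (vanishing {y}) \<subseteq> C"
    using closed_eq_zeros_vanishing[OF C(2)] by simp
qed

definition scheme_open :: "'r set \<Rightarrow> 'r set set" where
  "scheme_open U = {Z. irreducible_closed T Z \<and> Z \<inter> U \<noteq> {}}"

definition spec_open :: "'r set \<Rightarrow> 'a set set" where
  "spec_open U = {P. primeideal P A \<and> zeros P \<inter> U \<noteq> {}}"

lemma closure_preimage_scheme_open:
  assumes "openin T U"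
  shows "closure_preimage T (scheme_open U) = U"
proof -
  have "T closure_of {y} \<in> scheme_open U \<longleftrightarrow> y \<in> U" if y: "y \<in> Y" for y
    using zeros_vanishing_point_meets[OF y assms] y
      irreducible_closed_zeros[OF primeideal_vanishing_point[OF y]]
    unfolding scheme_open_def by (simp add: closure_of_point)
  then show ?thesis
    using openin_subset_points[OF assms] unfolding closure_preimage_def topspace_X by blast
qed

lemma openin_scheme_top_iff: "openin (scheme_top T) W \<longleftrightarrow> (\<exists>U. openin T U \<and> W = scheme_open U)"
  unfolding openin_scheme_top scheme_open_def ..

lemma spec_open_nonzeros:
  "S \<subseteq> carrier A \<Longrightarrow> spec_open (nonzeros S) = {P. primeideal P A \<and> \<not> S \<subseteq> P}"
  unfolding spec_open_def using meets_nonzeros_iff by blast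

lemma openin_spec_iff: "openin (spec_topology A) W \<longleftrightarrow> (\<exists>U. openin T U \<and> W = spec_open U)"
  unfolding openin_spec_topology openin_iff using spec_open_nonzeros by (metis (no_types, lifting))

lemma topspace_spec: "topspace (spec_topology A) = {P. primeideal P A}"
proof (rule antisym)
  show "topspace (spec_topology A) \<subseteq> {P. primeideal P A}"
    using openin_topspace[of "spec_topology A"] unfolding openin_spec_iff spec_open_def by auto
  have "openin (spec_topology A) {P. primeideal P A \<and> \<not> {\<one>} \<subseteq> P}"
    unfolding openin_spec_topology by (rule exI[of _ "{\<one>}"]) simp
  moreover have "{P. primeideal P A \<and> \<not> {\<one>} \<subseteq> P} = {P. primeideal P A}"
    using one_notin_prime by auto
  ultimately show "{P. primeideal P A} \<subseteq> topspace (spec_topology A)"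
    by (metis openin_subset)
qed

lemma topspace_scheme: "topspace (scheme_top T) = {Z. irreducible_closed T Z}"
proof (rule antisym)
  show "topspace (scheme_top T) \<subseteq> {Z. irreducible_closed T Z}"
    using openin_topspace[of "scheme_top T"] unfolding openin_scheme_top by auto
  have "openin (scheme_top T) {Z. irreducible_closed T Z \<and> Z \<inter> topspace T \<noteq> {}}"
    unfolding openin_scheme_top by blast
  moreover have "{Z. irreducible_closed T Z \<and> Z \<inter> topspace T \<noteq> {}} = {Z. irreducible_closed T Z}"
    using closedin_subset unfolding irreducible_closed_def by blast
  ultimately show "{Z. irreducible_closed T Z} \<subseteq> topspace (scheme_top T)"
    by (metis openin_subset)
qed

lemma spec_open_eq_preimage:
  "spec_open U = {P \<in> topspace (spec_topology A). zeros P \<in> scheme_open U}"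
  unfolding topspace_spec spec_open_def scheme_open_def using irreducible_closed_zeros by auto

lemma inj_on_zeros: "inj_on zeros {P. primeideal P A}"
  by (rule inj_on_inverseI[where g = vanishing]) (auto simp: vanishing_zeros)

lemma zeros_image_spec_open: "zeros ` spec_open U = scheme_open U"
proof (rule antisym)
  show "zeros ` spec_open U \<subseteq> scheme_open U"
    unfolding spec_open_eq_preimage by auto
  show "scheme_open U \<subseteq> zeros ` spec_open U"
  proof
    fix Z assume Z: "Z \<in> scheme_open U"
    then have "zeros (vanishing Z) = Z" "primeideal (vanishing Z) A"
      using closed_eq_zeros_vanishing primeideal_vanishing
      unfolding scheme_open_def irreducible_closed_def by auto
    then have "vanishing Z \<in> spec_open U"
      using Z unfolding spec_open_def scheme_open_def by auto
    then show "Z \<in> zeros ` spec_open U"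
      using \<open>zeros (vanishing Z) = Z\<close> by (metis imageI)
  qed
qed

lemma spec_open_UNIV: "spec_open UNIV = {P. primeideal P A}"
    "scheme_open UNIV = {Z. irreducible_closed T Z}"
  using irreducible_closed_zeros
  unfolding spec_open_def scheme_open_def irreducible_closed_def by auto

lemma homeomorphic_zeros: "homeomorphic_map (spec_topology A) (scheme_top T) zeros"
proof (rule bijective_open_imp_homeomorphic_map)
  show "continuous_map (spec_topology A) (scheme_top T) zeros"
    unfolding continuous_map
  proof (intro conjI allI impI)
    show "zeros ` topspace (spec_topology A) \<subseteq> topspace (scheme_top T)"
      unfolding topspace_spec topspace_scheme using irreducible_closed_zeros by auto
    fix W assume "openin (scheme_top T) W"
    then show "openin (spec_topology A) {x \<in> topspace (spec_topology A). zeros x \<in> W}"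
      unfolding openin_scheme_top_iff openin_spec_iff using spec_open_eq_preimage by auto
  qed
  show "open_map (spec_topology A) (scheme_top T) zeros"
    unfolding open_map_def openin_spec_iff openin_scheme_top_iff
    using zeros_image_spec_open by blast
  show "zeros ` topspace (spec_topology A) = topspace (scheme_top T)"
    using zeros_image_spec_open[of UNIV] unfolding topspace_spec topspace_scheme spec_open_UNIV .
  show "inj_on zeros (topspace (spec_topology A))"
    unfolding topspace_spec by (rule inj_on_zeros)
qed

definition represents :: "'r set \<Rightarrow> ('r \<Rightarrow> 'k) \<Rightarrow> 'a \<Rightarrow> 'a \<Rightarrow> bool" where
  "represents W r a f \<longleftrightarrow> openin T W \<and> a \<in> carrier A \<and> f \<in> carrier A \<and>
     (\<forall>z\<in>W. ev f z \<noteq> 0 \<and> r z = ev a z / ev f z)"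

text \<open>By \<open>germ_eq_fraction\<close> below, the set of all representations of \<open>r\<close> near the generic point of
  \<open>zeros P\<close> is itself a class of fractions, so no representative has to be chosen.\<close>

definition germ :: "'r set \<Rightarrow> ('r \<Rightarrow> 'k) \<Rightarrow> 'a set \<Rightarrow> ('a \<times> 'a) set" where
  "germ U r P = {(a, f). \<exists>W\<subseteq>U. W \<inter> zeros P \<noteq> {} \<and> represents W r a f}"

lemma germI: "W \<subseteq> U \<Longrightarrow> W \<inter> zeros P \<noteq> {} \<Longrightarrow> represents W r a f \<Longrightarrow> (a, f) \<in> germ U r P"
  unfolding germ_def by auto

lemma germ_denominator:
  assumes "primeideal P A" "(a, f) \<in> germ U r P"
  shows "a \<in> carrier A" "f \<in> carrier A - P"
  using assms unfolding germ_def represents_def zeros_def by auto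

lemma germ_eq_fraction:
  assumes P: "primeideal P A" and af: "(a, f) \<in> germ U r P"
  shows "germ U r P = fraction A P a f"
proof -
  obtain W where W: "W \<subseteq> U" "W \<inter> zeros P \<noteq> {}" "represents W r a f"
    using af unfolding germ_def by auto
  note [simp] = germ_denominator[OF P af] germ_denominator(2)[OF P af, THEN DiffD1]
  have oW: "openin T W"
    using W(3) unfolding represents_def by auto
  have WY: "\<And>y. y \<in> W \<Longrightarrow> y \<in> Y"
    using openin_subset_points[OF oW] by auto
  show ?thesis
  proof (intro equalityI subsetI)
    fix bg assume bg: "bg \<in> germ U r P"
    obtain b g where [simp]: "bg = (b, g)" by (cases bg)
    have bgc: "b \<in> carrier A" "g \<in> carrier A - P" "g \<in> carrier A"
      using germ_denominator[OF P] bg by auto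
    obtain W' where W': "W' \<subseteq> U" "W' \<inter> zeros P \<noteq> {}" "represents W' r b g"
      using bg unfolding germ_def by auto
    have oW': "openin T W'"
      using W'(3) unfolding represents_def by auto
    have "zeros P \<inter> (W \<inter> W') \<noteq> {}"
      using zeros_irreducible[OF P oW _ oW'] W(2) W'(2) by (simp add: Int_commute)
    then obtain h where h: "h \<in> carrier A - P" "nonzeros {h} \<subseteq> W \<inter> W'"
      using open_meets_iff[OF P openin_Int[OF oW oW']] by auto
    have "h \<otimes> (g \<otimes> a) = h \<otimes> (f \<otimes> b)"
    proof (rule ev_inj)
      fix y assume y: "y \<in> Y"
      show "ev (h \<otimes> (g \<otimes> a)) y = ev (h \<otimes> (f \<otimes> b)) y"
      proof (cases "ev h y = 0")
        case True
        then show ?thesis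
          using y h(1) bgc by (simp add: ev_mult)
      next
        case False
        then have "y \<in> W" "y \<in> W'"
          using h y unfolding nonzeros_def by auto
        then have "r y = ev a y / ev f y" "ev f y \<noteq> 0" "r y = ev b y / ev g y" "ev g y \<noteq> 0"
          using W(3) W'(3) unfolding represents_def by auto
        then have "ev g y * ev a y = ev f y * ev b y"
          by (simp add: field_simps)
        then show ?thesis
          using y h(1) bgc by (simp add: ev_mult)
      qed
    qed (use h bgc in auto)
    then show "bg \<in> fraction A P a f"
      unfolding fraction_def using bgc h(1) by auto
  next
    fix bg assume bg: "bg \<in> fraction A P a f"
    obtain b g where [simp]: "bg = (b, g)" by (cases bg)
    obtain h where h: "h \<in> carrier A - P" "h \<otimes> (g \<otimes> a) = h \<otimes> (f \<otimes> b)"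
      and bgc: "b \<in> carrier A" "g \<in> carrier A - P"
      using bg unfolding fraction_def by auto
    define V where "V = nonzeros {h \<otimes> g}"
    have hg: "h \<otimes> g \<in> carrier A - P"
      using prime_mult_notin[OF P h(1) bgc(2)] .
    have oV: "openin T V"
      unfolding V_def using hg by (intro openin_nonzeros) auto
    have mV: "zeros P \<inter> V \<noteq> {}"
      unfolding V_def using meets_nonzeros_iff[OF P, of "{h \<otimes> g}"] hg by auto
    have "(W \<inter> V) \<inter> zeros P \<noteq> {}"
      using zeros_irreducible[OF P oW _ oV mV] W(2) by (simp add: Int_commute)
    moreover have "represents (W \<inter> V) r b g"
      unfolding represents_def
    proof (intro conjI ballI)
      fix z assume z: "z \<in> W \<inter> V"
      have zY: "z \<in> Y" using z WY by auto
      have hg0: "ev h z \<noteq> 0" "ev g z \<noteq> 0"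
        using z h bgc zY unfolding V_def nonzeros_def by (auto simp: ev_mult)
      show "ev g z \<noteq> 0" by fact
      have "ev g z * ev a z = ev f z * ev b z"
        using arg_cong[OF h(2), of "\<lambda>t. ev t z"] zY h(1) bgc hg0 by (simp add: ev_mult)
      moreover have "r z = ev a z / ev f z" "ev f z \<noteq> 0"
        using z W(3) unfolding represents_def by auto
      ultimately show "r z = ev b z / ev g z"
        using hg0 by (simp add: frac_eq_eq mult.commute)
    qed (use oW oV bgc in auto)
    ultimately show "bg \<in> germ U r P"
      using W(1) by (auto intro!: germI[of "W \<inter> V"])
  qed
qed

lemma regular_locally_represented:
  assumes "openin T U" "r \<in> regular X U" "P \<in> spec_open U"
  shows "\<exists>W a f. W \<subseteq> U \<and> W \<inter> zeros P \<noteq> {} \<and> represents W r a f"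
proof -
  obtain y where y: "y \<in> U" "y \<in> zeros P"
    using assms(3) unfolding spec_open_def by auto
  then show ?thesis
    using assms(1,2) unfolding regular_X[OF assms(1)] represents_def by blast
qed

lemma germ_nonempty:
  assumes "openin T U" "r \<in> regular X U" "P \<in> spec_open U"
  shows "\<exists>a f. (a, f) \<in> germ U r P"
  using regular_locally_represented[OF assms] unfolding germ_def by blast

definition spec_section :: "'r set \<Rightarrow> ('r \<Rightarrow> 'k) \<Rightarrow> 'a set \<Rightarrow> ('a \<times> 'a) set" where
  "spec_section U r = (\<lambda>P\<in>spec_open U. germ U r P)"

lemma germ_cong: "(\<And>z. z \<in> U \<Longrightarrow> r z = s z) \<Longrightarrow> germ U r P = germ U s P"
proof -
  assume eq: "\<And>z. z \<in> U \<Longrightarrow> r z = s z"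
  have "represents W r a f \<longleftrightarrow> represents W s a f" if "W \<subseteq> U" for W a f
    using that eq unfolding represents_def by (metis subsetD)
  then show ?thesis
    unfolding germ_def by blast
qed

lemma germ_mono:
  assumes P: "primeideal P A" and UV: "V \<subseteq> U" "openin T V" "zeros P \<inter> V \<noteq> {}"
  shows "germ V r P = germ U r P"
proof -
  have "(W \<inter> V) \<inter> zeros P \<noteq> {} \<and> represents (W \<inter> V) r a f"
    if "W \<inter> zeros P \<noteq> {}" "represents W r a f" for W a f
    using that UV zeros_irreducible[OF P _ _ UV(2,3), of W] unfolding represents_def
    by (auto simp: Int_commute Int_assoc Int_left_commute)
  note restr = this
  show ?thesis
  proof (rule equalityI; rule subrelI)
    fix a f assume "(a, f) \<in> germ V r P"
    then obtain W where "W \<subseteq> V" "W \<inter> zeros P \<noteq> {}" "represents W r a f"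
      unfolding germ_def by auto
    then show "(a, f) \<in> germ U r P"
      using UV(1) by (intro germI[of W]) auto
  next
    fix a f assume "(a, f) \<in> germ U r P"
    then obtain W where "W \<inter> zeros P \<noteq> {}" "represents W r a f"
      unfolding germ_def by auto
    from restr[OF this] show "(a, f) \<in> germ V r P"
      by (intro germI[of "W \<inter> V"]) auto
  qed
qed

lemma germ_ops:
  assumes P: "primeideal P A" and af: "(a, f) \<in> germ U r P" and bg: "(b, g) \<in> germ U s P"
  shows "(a \<otimes> b, f \<otimes> g) \<in> germ U (\<lambda>x\<in>U. r x * s x) P"
    and "((a \<otimes> g) \<oplus> (b \<otimes> f), f \<otimes> g) \<in> germ U (\<lambda>x\<in>U. r x + s x) P"
proof -
  obtain W where W: "W \<subseteq> U" "W \<inter> zeros P \<noteq> {}" "represents W r a f"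
    using af unfolding germ_def by auto
  obtain V where V: "V \<subseteq> U" "V \<inter> zeros P \<noteq> {}" "represents V s b g"
    using bg unfolding germ_def by auto
  have o: "openin T W" "openin T V"
    using W V unfolding represents_def by auto
  have car: "a \<in> carrier A" "f \<in> carrier A" "b \<in> carrier A" "g \<in> carrier A"
    using W V unfolding represents_def by auto
  have ne: "(W \<inter> V) \<inter> zeros P \<noteq> {}"
    using zeros_irreducible[OF P o(1) _ o(2)] W V by (simp add: Int_commute)
  have WY: "z \<in> Y" if "z \<in> W" for z
    using that openin_subset_points[OF o(1)] by auto
  have "represents (W \<inter> V) (\<lambda>x\<in>U. r x * s x) (a \<otimes> b) (f \<otimes> g)"
    using W V o car WY unfolding represents_def by (auto simp: ev_mult subset_iff)
  then show "(a \<otimes> b, f \<otimes> g) \<in> germ U (\<lambda>x\<in>U. r x * s x) P"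
    using ne W(1) by (intro germI[of "W \<inter> V"]) auto
  have "represents (W \<inter> V) (\<lambda>x\<in>U. r x + s x) ((a \<otimes> g) \<oplus> (b \<otimes> f)) (f \<otimes> g)"
    using W V o car WY unfolding represents_def
    by (auto simp: ev_mult ev_add subset_iff add_frac_eq)
  then show "((a \<otimes> g) \<oplus> (b \<otimes> f), f \<otimes> g) \<in> germ U (\<lambda>x\<in>U. r x + s x) P"
    using ne W(1) by (intro germI[of "W \<inter> V"]) auto
qed

lemma germ_const:
  assumes "openin T U" "P \<in> spec_open U"
  shows "germ U (\<lambda>x\<in>U. c) P = fraction A P (\<iota> c) \<one>"
proof (rule germ_eq_fraction)
  show "primeideal P A"
    using assms unfolding spec_open_def by auto
  have "z \<in> U \<Longrightarrow> z \<in> Y" for z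
    using openin_subset_points[OF assms(1)] by auto
  then have "represents U (\<lambda>x\<in>U. c) (\<iota> c) \<one>"
    unfolding represents_def using assms by (auto simp: scalar_closed ev_scalar ev_one)
  then show "(\<iota> c, \<one>) \<in> germ U (\<lambda>x\<in>U. c) P"
    unfolding germ_def using assms unfolding spec_open_def by auto
qed

lemma scalar_one: "\<iota> 1 = \<one>"
  by (rule ev_inj) (auto simp: scalar_closed ev_scalar ev_one)

lemma spec_section_in_sections:
  assumes U: "openin T U" and r: "r \<in> regular X U"
  shows "spec_section U r \<in> spec_sections A (spec_open U)"
  unfolding spec_sections_def
proof (intro CollectI conjI ballI)
  have *: "\<exists>a f. germ U r P = fraction A P a f \<and> a \<in> carrier A \<and> f \<in> carrier A \<and> f \<notin> P"
    if P: "P \<in> spec_open U" for P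
  proof -
    obtain a f where "(a, f) \<in> germ U r P"
      using germ_nonempty[OF U r P] by auto
    moreover have "primeideal P A"
      using P unfolding spec_open_def by auto
    ultimately show ?thesis
      using germ_eq_fraction germ_denominator by (metis DiffD1 DiffD2)
  qed
  show "spec_section U r \<in> (\<Pi>\<^sub>E P\<in>spec_open U. carrier (local_ring A P))"
    unfolding spec_section_def local_ring_def using * by auto
  fix P assume P: "P \<in> spec_open U"
  obtain W a f where W: "W \<subseteq> U" "W \<inter> zeros P \<noteq> {}" "represents W r a f"
    using regular_locally_represented[OF U r P] by auto
  have "openin (spec_topology A) (spec_open W)"
    unfolding openin_spec_iff using W unfolding represents_def by auto
  moreover have "P \<in> spec_open W"
    using P W unfolding spec_open_def by auto
  moreover have sub: "spec_open W \<subseteq> spec_open U"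
    using W unfolding spec_open_def by auto
  moreover have "f \<notin> Q \<and> spec_section U r Q = fraction A Q a f" if Q: "Q \<in> spec_open W" for Q
  proof -
    have "(a, f) \<in> germ U r Q" and Q': "primeideal Q A"
      using Q W unfolding germ_def spec_open_def by auto
    then show ?thesis
      using germ_eq_fraction[OF Q', of a f] germ_denominator[OF Q', of a f] sub Q
      unfolding spec_section_def by auto
  qed
  moreover have "a \<in> carrier A" "f \<in> carrier A"
    using W unfolding represents_def by auto
  ultimately show "\<exists>W a f. openin (spec_topology A) W \<and> P \<in> W \<and> W \<subseteq> spec_open U \<and>
      a \<in> carrier A \<and> f \<in> carrier A \<and> (\<forall>Q\<in>W. f \<notin> Q \<and> spec_section U r Q = fraction A Q a f)"
    by blast
qed

lemma vanishing_point_in_spec_open: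
  "y \<in> U \<Longrightarrow> openin T U \<Longrightarrow> vanishing {y} \<in> spec_open U"
  using primeideal_vanishing_point zeros_vanishing_point_meets openin_subset_points
  unfolding spec_open_def by blast

lemma germ_point:
  assumes "y \<in> Y" "(a, f) \<in> germ U r (vanishing {y})"
  shows "r y = ev a y / ev f y"
proof -
  obtain W where W: "W \<inter> zeros (vanishing {y}) \<noteq> {}" "represents W r a f"
    using assms unfolding germ_def by auto
  then have "y \<in> W"
    using zeros_vanishing_point_meets[OF assms(1), of W] unfolding represents_def
    by (auto simp: Int_commute)
  then show ?thesis
    using W unfolding represents_def by auto
qed

lemma spec_section_inj:
  assumes U: "openin T U" and r: "r \<in> regular X U" and s: "s \<in> regular X U"
    and eq: "spec_section U r = spec_section U s"
  shows "r = s"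
proof (rule extensionalityI)
  show "r \<in> extensional U" "s \<in> extensional U"
    using r s unfolding regular_X[OF U] by auto
  fix y assume y: "y \<in> U"
  then have P: "vanishing {y} \<in> spec_open U" and yY: "y \<in> Y"
    using vanishing_point_in_spec_open U openin_subset_points by auto
  have "germ U r (vanishing {y}) = germ U s (vanishing {y})"
    using fun_cong[OF eq, of "vanishing {y}"] P unfolding spec_section_def by simp
  moreover obtain a f where "(a, f) \<in> germ U r (vanishing {y})"
    using germ_nonempty[OF U r P] by auto
  ultimately show "r y = s y"
    using germ_point[OF yY] by metis
qed

lemma fraction_refl:
  assumes "primeideal P A" "a \<in> carrier A" "f \<in> carrier A - P"
  shows "(a, f) \<in> fraction A P a f"
  unfolding fraction_def using assms one_notin_prime[OF assms(1)] by auto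

lemma fraction_point:
  assumes y: "y \<in> Y" and bg: "(b, g) \<in> fraction A (vanishing {y}) a f"
    and af: "a \<in> carrier A" "f \<in> carrier A" "ev f y \<noteq> 0"
  shows "ev b y / ev g y = ev a y / ev f y"
proof -
  obtain h where h: "h \<in> carrier A - vanishing {y}" "h \<otimes> (g \<otimes> a) = h \<otimes> (f \<otimes> b)"
    and bgc: "b \<in> carrier A" "g \<in> carrier A - vanishing {y}"
    using bg unfolding fraction_def by auto
  have "ev h y \<noteq> 0" "ev g y \<noteq> 0"
    using h bgc unfolding vanishing_def by auto
  have "ev g y * ev a y = ev f y * ev b y"
    using arg_cong[OF h(2), of "\<lambda>t. ev t y"] y h(1) bgc af \<open>ev h y \<noteq> 0\<close>
    by (simp add: ev_mult)
  then show ?thesis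
    using af \<open>ev g y \<noteq> 0\<close> by (simp add: field_simps)
qed

lemma spec_section_surj:
  assumes U: "openin T U" and s: "s \<in> spec_sections A (spec_open U)"
  shows "\<exists>r\<in>regular X U. spec_section U r = s"
proof -
  define r where "r = (\<lambda>y\<in>U. let (a, f) = (SOME af. af \<in> s (vanishing {y})) in ev a y / ev f y)"
  have UY: "y \<in> Y" if "y \<in> U" for y
    using that openin_subset_points[OF U] by auto
  have val: "r y = ev a y / ev f y"
    if y: "y \<in> U" and sy: "s (vanishing {y}) = fraction A (vanishing {y}) a f"
      and af: "a \<in> carrier A" "f \<in> carrier A" "f \<notin> vanishing {y}" for y a f
  proof -
    obtain b g where bg: "(SOME af. af \<in> s (vanishing {y})) = (b, g)"
      by (cases "SOME af. af \<in> s (vanishing {y})")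
    have "(a, f) \<in> s (vanishing {y})"
      using sy fraction_refl[OF primeideal_vanishing_point[OF UY[OF y]]] af by auto
    then have "(b, g) \<in> s (vanishing {y})"
      using bg by (metis someI)
    then show ?thesis
      using fraction_point[OF UY[OF y], of b g a f] sy af y bg unfolding r_def
      by (auto simp: vanishing_def)
  qed
  have loc: "\<exists>W a f. W \<subseteq> U \<and> P \<in> spec_open W \<and> represents W r a f \<and>
      s P = fraction A P a f" if P: "P \<in> spec_open U" for P
  proof -
    obtain W' a f where W': "openin (spec_topology A) W'" "P \<in> W'" "W' \<subseteq> spec_open U"
      and af: "a \<in> carrier A" "f \<in> carrier A" and fr: "\<forall>Q\<in>W'. f \<notin> Q \<and> s Q = fraction A Q a f"
      using s P unfolding spec_sections_def by blast
    obtain W where W: "openin T W" "W' = spec_open W"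
      using W'(1) openin_spec_iff by auto
    have "y \<in> U \<and> ev f y \<noteq> 0 \<and> r y = ev a y / ev f y" if y: "y \<in> W" for y
    proof -
      have yY: "y \<in> Y"
        using y openin_subset_points[OF W(1)] by auto
      have "vanishing {y} \<in> W'"
        using vanishing_point_in_spec_open[OF y W(1)] W(2) by simp
      moreover from this have "y \<in> U"
        using W'(3) zeros_vanishing_point_meets[OF yY U] unfolding spec_open_def by blast
      moreover from calculation have "f \<notin> vanishing {y}"
        using fr by blast
      ultimately show ?thesis
        using fr val[of y a f] af by (simp add: vanishing_def)
    qed
    then have "W \<subseteq> U" "represents W r a f"
      using W(1) af unfolding represents_def by auto
    moreover have "P \<in> spec_open W" "s P = fraction A P a f"
      using W(2) W'(2) fr by auto
    ultimately show ?thesis by blast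
  qed
  have r: "r \<in> regular X U"
    unfolding regular_X[OF U]
  proof (intro conjI ballI)
    show "r \<in> extensional U"
      unfolding r_def by simp
    fix y assume y: "y \<in> U"
    obtain W a f where W: "W \<subseteq> U" "vanishing {y} \<in> spec_open W" "represents W r a f"
      using loc[OF vanishing_point_in_spec_open[OF y U]] by blast
    then have "y \<in> W"
      using zeros_vanishing_point_meets[OF UY[OF y]] unfolding spec_open_def represents_def by blast
    then show "\<exists>W a f. openin T W \<and> y \<in> W \<and> W \<subseteq> U \<and> a \<in> carrier A \<and> f \<in> carrier A \<and>
          (\<forall>z\<in>W. ev f z \<noteq> 0 \<and> r z = ev a z / ev f z)"
      using W unfolding represents_def by blast
  qed
  have "spec_section U r = s"
  proof (rule extensionalityI)
    show "spec_section U r \<in> extensional (spec_open U)" "s \<in> extensional (spec_open U)"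
      using s unfolding spec_section_def spec_sections_def PiE_def by auto
    fix P assume P: "P \<in> spec_open U"
    then obtain W a f where W: "W \<subseteq> U" "P \<in> spec_open W" "represents W r a f"
        "s P = fraction A P a f"
      using loc by blast
    have "(a, f) \<in> germ U r P"
      unfolding germ_def using W unfolding spec_open_def by blast
    then show "spec_section U r P = s P"
      using germ_eq_fraction[of P a f U r] P W(4) unfolding spec_section_def spec_open_def by simp
  qed
  with r show ?thesis by blast
qed

lemma UN_germ_const:
  assumes "\<And>a f b g. (a, f) \<in> G \<Longrightarrow> (b, g) \<in> H \<Longrightarrow> c a f b g = K" "(a0, f0) \<in> G" "(b0, g0) \<in> H"
  shows "(\<Union>(a, f)\<in>G. \<Union>(b, g)\<in>H. c a f b g) = K"
  using assms by fastforce

lemma spec_section_ring_iso: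
  assumes U: "openin T U"
  shows "spec_section U \<in> ring_iso
    (sections (scheme_of X) (scheme_open U)) (sections (Spec A \<iota>) (spec_open U))"
proof -
  have prime: "primeideal P A" if "P \<in> spec_open U" for P
    using that unfolding spec_open_def by auto
  have mult: "spec_section U (\<lambda>x\<in>U. r x * s x) =
      (\<lambda>P\<in>spec_open U. spec_section U r P \<otimes>\<^bsub>local_ring A P\<^esub> spec_section U s P)"
    and add: "spec_section U (\<lambda>x\<in>U. r x + s x) =
      (\<lambda>P\<in>spec_open U. spec_section U r P \<oplus>\<^bsub>local_ring A P\<^esub> spec_section U s P)"
    if r: "r \<in> regular X U" and s: "s \<in> regular X U" for r s
  proof -
    have "germ U (\<lambda>x\<in>U. r x * s x) P = germ U r P \<otimes>\<^bsub>local_ring A P\<^esub> germ U s P \<and>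
        germ U (\<lambda>x\<in>U. r x + s x) P = germ U r P \<oplus>\<^bsub>local_ring A P\<^esub> germ U s P"
      if P: "P \<in> spec_open U" for P
    proof -
      obtain a0 f0 b0 g0 where ne: "(a0, f0) \<in> germ U r P" "(b0, g0) \<in> germ U s P"
        using germ_nonempty[OF U r P] germ_nonempty[OF U s P] by auto
      note eq = germ_eq_fraction[OF prime[OF P] germ_ops(1)[OF prime[OF P]], symmetric]
        germ_eq_fraction[OF prime[OF P] germ_ops(2)[OF prime[OF P]], symmetric]
      show ?thesis
        unfolding local_ring_def monoid.simps ring.simps
        by (intro conjI; rule UN_germ_const[OF _ ne, symmetric]; rule eq)
    qed
    then show "spec_section U (\<lambda>x\<in>U. r x * s x) =
        (\<lambda>P\<in>spec_open U. spec_section U r P \<otimes>\<^bsub>local_ring A P\<^esub> spec_section U s P)"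
      "spec_section U (\<lambda>x\<in>U. r x + s x) =
        (\<lambda>P\<in>spec_open U. spec_section U r P \<oplus>\<^bsub>local_ring A P\<^esub> spec_section U s P)"
      unfolding spec_section_def by (auto intro!: restrict_ext)
  qed
  have one: "spec_section U (\<lambda>x\<in>U. 1) = (\<lambda>P\<in>spec_open U. \<one>\<^bsub>local_ring A P\<^esub>)"
    using germ_const[OF U, of _ 1] unfolding spec_section_def local_ring_def scalar_one
    by (auto intro!: restrict_ext)
  have "bij_betw (spec_section U) (regular X U) (spec_sections A (spec_open U))"
    unfolding bij_betw_def
  proof
    show "inj_on (spec_section U) (regular X U)"
      using spec_section_inj[OF U] by (rule inj_onI)
    show "spec_section U ` regular X U = spec_sections A (spec_open U)"
      using spec_section_in_sections[OF U] spec_section_surj[OF U] by blast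
  qed
  then show ?thesis
    unfolding ring_iso_def Ring.ring_hom_def scheme_of_def Spec_def Let_def
    using mult add one spec_section_in_sections[OF U]
    by (auto simp: closure_preimage_scheme_open[OF U])
qed

lemma scheme_open_mono_iff:
  assumes "openin T U" "openin T V"
  shows "scheme_open V \<subseteq> scheme_open U \<longleftrightarrow> V \<subseteq> U"
proof
  assume "scheme_open V \<subseteq> scheme_open U"
  then have "closure_preimage T (scheme_open V) \<subseteq> closure_preimage T (scheme_open U)"
    unfolding closure_preimage_def by auto
  then show "V \<subseteq> U"
    using assms by (simp add: closure_preimage_scheme_open)
qed (auto simp: scheme_open_def)

theorem Spec_isomorphic: "isomorphic_over (Spec A \<iota>) (scheme_of X)"
proof -
  define \<phi> where "\<phi> W = spec_section (closure_preimage T W)" for W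
  let ?pre = "\<lambda>W. {P \<in> topspace (space_top (Spec A \<iota>)). zeros P \<in> W}"
  have pre: "?pre (scheme_open U) = spec_open U" for U
    unfolding Spec_def spec_open_eq_preimage by simp
  have \<phi>: "\<phi> (scheme_open U) = spec_section U" if "openin T U" for U
    unfolding \<phi>_def using closure_preimage_scheme_open[OF that] by simp
  have iso: "\<phi> W \<in> ring_iso (sections (scheme_of X) W) (sections (Spec A \<iota>) (?pre W)) \<and>
      (\<forall>c. \<phi> W (scalar (scheme_of X) W c) = scalar (Spec A \<iota>) (?pre W) c)"
    if W: "openin (space_top (scheme_of X)) W" for W
  proof -
    obtain U where U: "openin T U" "W = scheme_open U"
      using W openin_scheme_top_iff unfolding scheme_of_def by auto
    have "spec_section U (scalar (scheme_of X) (scheme_open U) c) =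
        scalar (Spec A \<iota>) (spec_open U) c" for c
      using germ_const[OF U(1), of _ c]
      unfolding scheme_of_def Spec_def spec_section_def
      by (auto simp: closure_preimage_scheme_open[OF U(1)] intro!: restrict_ext)
    then show ?thesis
      unfolding U(2) pre \<phi>[OF U(1)] using spec_section_ring_iso[OF U(1)] by simp
  qed
  have res: "\<phi> W' (restr (scheme_of X) W W' s) = restr (Spec A \<iota>) (?pre W) (?pre W') (\<phi> W s)"
    if W: "openin (space_top (scheme_of X)) W" and W': "openin (space_top (scheme_of X)) W'"
      and sub: "W' \<subseteq> W" for W W' s
  proof -
    obtain U where U: "openin T U" "W = scheme_open U"
      using W openin_scheme_top_iff unfolding scheme_of_def by auto
    obtain V where V: "openin T V" "W' = scheme_open V"
      using W' openin_scheme_top_iff unfolding scheme_of_def by auto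
    have VU: "V \<subseteq> U"
      using sub scheme_open_mono_iff[OF U(1) V(1)] unfolding U(2) V(2) by simp
    then have sV: "spec_open V \<subseteq> spec_open U"
      unfolding spec_open_def by auto
    have "spec_section V (restrict s V) = restrict (spec_section U s) (spec_open V)"
    proof (rule extensionalityI)
      show "spec_section V (restrict s V) \<in> extensional (spec_open V)"
        "restrict (spec_section U s) (spec_open V) \<in> extensional (spec_open V)"
        unfolding spec_section_def by auto
      fix P assume P: "P \<in> spec_open V"
      then have "germ V (restrict s V) P = germ U s P"
        using germ_cong[of V "restrict s V" s P] germ_mono[of P V U s] V(1) VU
        unfolding spec_open_def by auto
      then show "spec_section V (restrict s V) P = restrict (spec_section U s) (spec_open V) P"
        using P sV unfolding spec_section_def by auto
    qed
    then show ?thesis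
      unfolding U(2) V(2) pre \<phi>[OF U(1)] \<phi>[OF V(1)]
      unfolding scheme_of_def Spec_def by (simp add: closure_preimage_scheme_open[OF V(1)])
  qed
  have homeo: "homeomorphic_map (space_top (Spec A \<iota>)) (space_top (scheme_of X)) zeros"
    using homeomorphic_zeros unfolding Spec_def scheme_of_def by simp
  show ?thesis
    unfolding isomorphic_over_def Let_def
    by (rule exI[of _ zeros], rule exI[of _ \<phi>]) (use homeo iso res in blast)
qed

end

section \<open>Polynomials and their values\<close>

abbreviation polys_in :: "'v set \<Rightarrow> ('v, 'k::comm_ring_1) mpoly set" where
  "polys_in V \<equiv> carrier (poly_ring V)"

lemma polys_in_iff: "f \<in> polys_in V \<longleftrightarrow> (\<forall>m\<in>Poly_Mapping.keys f. Poly_Mapping.keys m \<subseteq> V)"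
  by (simp add: poly_ring_def)

lemma poly_ring_simps [simp]:
  "f \<otimes>\<^bsub>poly_ring V\<^esub> g = f * g" "f \<oplus>\<^bsub>poly_ring V\<^esub> g = f + g"
  "\<one>\<^bsub>poly_ring V\<^esub> = 1" "\<zero>\<^bsub>poly_ring V\<^esub> = 0"
  by (simp_all add: poly_ring_def)

lemma polys_in_single: "c = 0 \<or> Poly_Mapping.keys m \<subseteq> V \<Longrightarrow> Poly_Mapping.single m c \<in> polys_in V"
  by (auto simp: polys_in_iff)

lemma polys_in_0 [simp]: "0 \<in> polys_in V"
  by (simp add: polys_in_iff)

lemma polys_in_1 [simp]: "1 \<in> polys_in V"
  by (simp add: polys_in_iff)

lemma polys_in_add [simp]: "f \<in> polys_in V \<Longrightarrow> g \<in> polys_in V \<Longrightarrow> f + g \<in> polys_in V"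
  unfolding polys_in_iff using keys_add[of f g] by blast

lemma polys_in_uminus [simp]: "f \<in> polys_in V \<Longrightarrow> - f \<in> polys_in V"
  unfolding polys_in_iff by (simp add: in_keys_iff)

lemma polys_in_diff [simp]: "f \<in> polys_in V \<Longrightarrow> g \<in> polys_in V \<Longrightarrow> f - g \<in> polys_in V"
  using polys_in_add[of f V "- g"] by simp

lemma polys_in_mult [simp]:
  assumes "f \<in> polys_in V" "g \<in> polys_in V"
  shows "f * g \<in> polys_in V"
  unfolding polys_in_iff
proof
  fix m assume "m \<in> Poly_Mapping.keys (f * g)"
  then obtain a b where m: "m = a + b" "a \<in> Poly_Mapping.keys f" "b \<in> Poly_Mapping.keys g"
    using keys_mult[of f g] by blast
  then show "Poly_Mapping.keys m \<subseteq> V"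
    using assms keys_add[of a b] unfolding polys_in_iff by blast
qed

lemma polys_in_sum [simp]: "(\<And>i. i \<in> I \<Longrightarrow> f i \<in> polys_in V) \<Longrightarrow> sum f I \<in> polys_in V"
  by (induction I rule: infinite_finite_induct) auto

lemma polys_in_power [simp]: "f \<in> polys_in V \<Longrightarrow> f ^ n \<in> polys_in V"
  by (induction n) auto

lemma polys_in_prod [simp]: "(\<And>i. i \<in> I \<Longrightarrow> f i \<in> polys_in V) \<Longrightarrow> prod f I \<in> polys_in V"
  by (induction I rule: infinite_finite_induct) auto

lemma polys_in_mvar [simp]: "v \<in> V \<Longrightarrow> mvar v \<in> polys_in V"
  unfolding mvar_def by (rule polys_in_single) auto

lemma polys_in_mconst [simp]: "mconst c \<in> polys_in V"
  unfolding mconst_def by (rule polys_in_single) auto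

lemma cring_poly_ring: "cring (poly_ring V :: ('v, 'k::comm_ring_1) mpoly ring)"
proof (rule cringI)
  show "abelian_group (poly_ring V :: ('v, 'k) mpoly ring)"
  proof (rule abelian_groupI)
    fix f :: "('v, 'k) mpoly" assume "f \<in> polys_in V"
    then show "\<exists>g\<in>polys_in V. g \<oplus>\<^bsub>poly_ring V\<^esub> f = \<zero>\<^bsub>poly_ring V\<^esub>"
      by (intro bexI[of _ "- f"]) auto
  qed (auto simp: ac_simps)
  show "Group.comm_monoid (poly_ring V :: ('v, 'k) mpoly ring)"
    by unfold_locales (auto simp: ac_simps)
qed (auto simp: algebra_simps)

lemma mpoly_expand:
  fixes f :: "('v, 'k::comm_ring_1) mpoly"
  shows "f = (\<Sum>m\<in>Poly_Mapping.keys f. Poly_Mapping.single m (Poly_Mapping.lookup f m))"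
  by (rule poly_mapping_eqI)
     (auto simp: lookup_sum lookup_single when_def in_keys_iff)

lemma mpoly_induct [case_names single zero add]:
  fixes f :: "('v, 'k::comm_ring_1) mpoly"
  assumes single: "\<And>m c. m \<in> Poly_Mapping.keys f \<Longrightarrow> P (Poly_Mapping.single m c)"
    and zero: "P 0"
    and add: "\<And>f g. P f \<Longrightarrow> P g \<Longrightarrow> P (f + g)"
  shows "P f"
proof -
  have "P (\<Sum>m\<in>M. Poly_Mapping.single m (Poly_Mapping.lookup f m))"
    if "finite M" "M \<subseteq> Poly_Mapping.keys f" for M
    using that by (induction M) (auto intro: assms)
  from this[of "Poly_Mapping.keys f"] show ?thesis
    using mpoly_expand[of f] by simp
qed

definition monom_eval :: "('v \<Rightarrow> 'k::comm_ring_1) \<Rightarrow> ('v \<Rightarrow>\<^sub>0 nat) \<Rightarrow> 'k" where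
  "monom_eval a m = (\<Prod>v\<in>Poly_Mapping.keys m. a v ^ Poly_Mapping.lookup m v)"

lemma monom_eval_add: "monom_eval a (m + m') = monom_eval a m * monom_eval a m'"
proof -
  let ?K = "Poly_Mapping.keys m \<union> Poly_Mapping.keys m'"
  have *: "monom_eval a k = (\<Prod>v\<in>?K. a v ^ Poly_Mapping.lookup k v)"
    if "Poly_Mapping.keys k \<subseteq> ?K" for k
    unfolding monom_eval_def using that
    by (intro prod.mono_neutral_left) (auto simp: in_keys_iff)
  show ?thesis
    using keys_add[of m m'] by (simp add: * lookup_add power_add prod.distrib)
qed

lemma mpoly_eval_add [simp]: "mpoly_eval a (f + g) = mpoly_eval a f + mpoly_eval a g"
  unfolding mpoly_eval_def monom_eval_def[symmetric]
  by (rule setsum_keys_plus_distrib[where f = "\<lambda>m c. c * monom_eval a m"])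
     (auto simp: algebra_simps)

lemma mpoly_eval_single: "mpoly_eval a (Poly_Mapping.single m c) = c * monom_eval a m"
  unfolding mpoly_eval_def monom_eval_def by (cases "c = 0") auto

lemma mpoly_eval_0 [simp]: "mpoly_eval a 0 = 0"
  by (simp add: mpoly_eval_def)

lemma mpoly_eval_1 [simp]: "mpoly_eval a 1 = 1"
  by (simp add: mpoly_eval_def)

lemma mpoly_eval_mult [simp]: "mpoly_eval a (f * g) = mpoly_eval a f * mpoly_eval a g"
proof (induction f rule: mpoly_induct)
  case (single m c)
  show ?case
    by (induction g rule: mpoly_induct)
       (simp_all add: mult_single mpoly_eval_single monom_eval_add distrib_left)
qed (simp_all add: distrib_right)

lemma mpoly_eval_mvar [simp]: "mpoly_eval a (mvar v) = a v"
  by (simp add: mvar_def mpoly_eval_single monom_eval_def)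

lemma mpoly_eval_mconst [simp]: "mpoly_eval a (mconst c) = c"
  by (simp add: mconst_def mpoly_eval_single monom_eval_def)

lemma mpoly_eval_uminus [simp]: "mpoly_eval a (- f) = - mpoly_eval a f"
  using mpoly_eval_add[of a f "- f"] by (simp add: eq_neg_iff_add_eq_0 add.commute)

lemma mpoly_eval_diff [simp]: "mpoly_eval a (f - g) = mpoly_eval a f - mpoly_eval a g"
  using mpoly_eval_add[of a f "- g"] by simp

lemma mpoly_eval_power [simp]: "mpoly_eval a (f ^ n) = mpoly_eval a f ^ n"
  by (induction n) auto

lemma mpoly_eval_sum: "mpoly_eval a (sum f I) = (\<Sum>i\<in>I. mpoly_eval a (f i))"
  by (induction I rule: infinite_finite_induct) auto

lemma mpoly_eval_prod: "mpoly_eval a (prod f I) = (\<Prod>i\<in>I. mpoly_eval a (f i))"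
  by (induction I rule: infinite_finite_induct) auto

lemma comm_ring_hom_mpoly_eval: "comm_ring_hom (mpoly_eval a)"
  by unfold_locales auto

lemma mpoly_eval_cong:
  assumes "f \<in> polys_in V" "\<And>v. v \<in> V \<Longrightarrow> a v = b v"
  shows "mpoly_eval a f = mpoly_eval b f"
  unfolding mpoly_eval_def
proof (rule sum.cong[OF refl])
  fix m assume "m \<in> Poly_Mapping.keys f"
  then have "v \<in> V" if "v \<in> Poly_Mapping.keys m" for v
    using assms(1) that unfolding polys_in_iff by blast
  then show "Poly_Mapping.lookup f m * (\<Prod>v\<in>Poly_Mapping.keys m. a v ^ Poly_Mapping.lookup m v) =
      Poly_Mapping.lookup f m * (\<Prod>v\<in>Poly_Mapping.keys m. b v ^ Poly_Mapping.lookup m v)"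
    using assms(2) by simp
qed

lemma mpoly_substitution:
  fixes f :: "('v, 'k::comm_ring_1) mpoly" and \<sigma> :: "'v \<Rightarrow> ('w, 'k) mpoly"
  assumes "f \<in> polys_in V" "\<And>v. v \<in> V \<Longrightarrow> \<sigma> v \<in> polys_in W"
  shows "\<exists>g\<in>polys_in W. \<forall>a. mpoly_eval a g = mpoly_eval (\<lambda>v. mpoly_eval a (\<sigma> v)) f"
proof -
  let ?g = "\<Sum>m\<in>Poly_Mapping.keys f. mconst (Poly_Mapping.lookup f m) *
              (\<Prod>v\<in>Poly_Mapping.keys m. \<sigma> v ^ Poly_Mapping.lookup m v)"
  have "?g \<in> polys_in W"
    using assms unfolding polys_in_iff[of f]
    by (intro polys_in_sum polys_in_mult polys_in_prod polys_in_power) auto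
  moreover have "mpoly_eval a ?g = mpoly_eval (\<lambda>v. mpoly_eval a (\<sigma> v)) f" for a
    by (simp add: mpoly_eval_sum mpoly_eval_prod) (simp add: mpoly_eval_def)
  ultimately show ?thesis by blast
qed

lemma mvar_power: "mvar v ^ j = Poly_Mapping.single (Poly_Mapping.single v j) 1"
  by (induction j) (auto simp: mvar_def mult_single simp flip: single_add single_one)

lemma polys_in_insert:
  fixes f :: "('v, 'k::comm_ring_1) mpoly"
  assumes "f \<in> polys_in (insert v V)"
  shows "\<exists>F. (\<forall>i. coeff F i \<in> polys_in V) \<and> f = poly F (mvar v)"
proof (induction f rule: mpoly_induct)
  case (single m c)
  define k where "k = Poly_Mapping.lookup m v"
  define m' where "m' = m - Poly_Mapping.single v k"
  have lm': "Poly_Mapping.lookup m' u = (if u = v then 0 else Poly_Mapping.lookup m u)" for u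
    by (auto simp: m'_def lookup_minus k_def lookup_single when_def)
  have m: "m = m' + Poly_Mapping.single v k"
    by (rule poly_mapping_eqI) (auto simp: lookup_add lm' k_def lookup_single when_def)
  have "Poly_Mapping.keys m' \<subseteq> Poly_Mapping.keys m - {v}"
    by (auto simp: in_keys_iff lm' split: if_splits)
  moreover have "Poly_Mapping.keys m \<subseteq> insert v V"
    using single assms unfolding polys_in_iff by blast
  ultimately have c: "Poly_Mapping.single m' c \<in> polys_in V"
    by (intro polys_in_single) blast
  have "Poly_Mapping.single m c = poly (Polynomial.monom (Poly_Mapping.single m' c) k) (mvar v)"
    by (simp add: poly_monom mvar_power mult_single flip: m)
  then show ?case
    using c by (intro exI[of _ "Polynomial.monom (Poly_Mapping.single m' c) k"]) auto
next
  case zero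
  show ?case by (rule exI[of _ 0]) auto
next
  case (add f g)
  then obtain F G where "(\<forall>i. coeff F i \<in> polys_in V) \<and> f = poly F (mvar v)"
     "(\<forall>i. coeff G i \<in> polys_in V) \<and> g = poly G (mvar v)" by blast
  then show ?case
    by (intro exI[of _ "F + G"]) auto
qed

lemma poly_mvar_in_polys_in:
  assumes "\<And>i. coeff F i \<in> polys_in V"
  shows "poly F (mvar v) \<in> polys_in (insert v V)"
proof -
  have "coeff F i \<in> polys_in (insert v V)" for i
    using assms[of i] unfolding polys_in_iff by blast
  then show ?thesis
    unfolding poly_altdef by (intro polys_in_sum polys_in_mult) auto
qed

lemma mpoly_eval_poly_mvar:
  assumes "\<And>i. coeff F i \<in> polys_in V" "v \<notin> V"
  shows "mpoly_eval (a(v := \<xi>)) (poly F (mvar v)) = poly (map_poly (mpoly_eval a) F) \<xi>"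
proof -
  have "mpoly_eval (a(v := \<xi>)) (coeff F i) = mpoly_eval a (coeff F i)" for i
    using assms(2) by (intro mpoly_eval_cong[OF assms(1)]) auto
  moreover have "poly (map_poly (mpoly_eval a) F) \<xi> =
      (\<Sum>i\<le>degree F. mpoly_eval a (coeff F i) * \<xi> ^ i)"
  proof -
    have "poly (map_poly (mpoly_eval a) F) \<xi> =
        (\<Sum>i\<le>degree (map_poly (mpoly_eval a) F). mpoly_eval a (coeff F i) * \<xi> ^ i)"
      by (simp add: poly_altdef coeff_map_poly)
    also have "\<dots> = (\<Sum>i\<le>degree F. mpoly_eval a (coeff F i) * \<xi> ^ i)"
    proof (rule sum.mono_neutral_left)
      show "{..degree (map_poly (mpoly_eval a) F)} \<subseteq> {..degree F}"
        using degree_le[of "degree F" "map_poly (mpoly_eval a) F"]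
        by (simp add: coeff_map_poly coeff_eq_0)
      have "mpoly_eval a (coeff F i) = 0" if "i > degree (map_poly (mpoly_eval a) F)" for i
        using coeff_eq_0[OF that] by (simp add: coeff_map_poly)
      then show "\<forall>i\<in>{..degree F} - {..degree (map_poly (mpoly_eval a) F)}.
          mpoly_eval a (coeff F i) * \<xi> ^ i = 0"
        by auto
    qed simp
    finally show ?thesis .
  qed
  ultimately show ?thesis
    by (simp add: poly_altdef mpoly_eval_sum)
qed

section \<open>A prime ideal of a ring generated by one element over a subring\<close>

locale simple_extension_prime =
  fixes S P :: "'a::idom set" and x :: 'a
  assumes S_0: "0 \<in> S" and S_1: "1 \<in> S"
    and S_add: "a \<in> S \<Longrightarrow> b \<in> S \<Longrightarrow> a + b \<in> S"
    and S_uminus: "a \<in> S \<Longrightarrow> - a \<in> S"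
    and S_mult: "a \<in> S \<Longrightarrow> b \<in> S \<Longrightarrow> a * b \<in> S"
    and P_0: "0 \<in> P" and P_1: "1 \<notin> P"
    and P_add: "a \<in> P \<Longrightarrow> b \<in> P \<Longrightarrow> a + b \<in> P"
    and P_mult: "(\<And>i. coeff F i \<in> S) \<Longrightarrow> b \<in> P \<Longrightarrow> poly F x * b \<in> P"
    and P_prime: "(\<And>i. coeff F i \<in> S) \<Longrightarrow> (\<And>i. coeff G i \<in> S) \<Longrightarrow> poly F x * poly G x \<in> P \<Longrightarrow>
      poly F x \<in> P \<or> poly G x \<in> P"
begin

definition C :: "'a poly set" where "C = {F. \<forall>i. coeff F i \<in> S}"

lemma S_diff: "a \<in> S \<Longrightarrow> b \<in> S \<Longrightarrow> a - b \<in> S"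
  using S_add[of a "- b"] S_uminus by simp

lemma S_sum: "(\<And>i. i \<in> I \<Longrightarrow> f i \<in> S) \<Longrightarrow> sum f I \<in> S"
  by (induction I rule: infinite_finite_induct) (auto simp: S_0 S_add)

lemma S_power: "a \<in> S \<Longrightarrow> a ^ n \<in> S"
  by (induction n) (auto simp: S_1 S_mult)

lemma coeff_S: "F \<in> C \<Longrightarrow> coeff F i \<in> S"
  by (simp add: C_def)

lemma C_add: "F \<in> C \<Longrightarrow> G \<in> C \<Longrightarrow> F + G \<in> C"
  by (simp add: C_def S_add)

lemma C_diff: "F \<in> C \<Longrightarrow> G \<in> C \<Longrightarrow> F - G \<in> C"
  by (simp add: C_def S_diff)

lemma C_mult: "F \<in> C \<Longrightarrow> G \<in> C \<Longrightarrow> F * G \<in> C"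
  by (simp add: C_def coeff_mult S_sum S_mult)

lemma C_smult: "c \<in> S \<Longrightarrow> F \<in> C \<Longrightarrow> smult c F \<in> C"
  by (simp add: C_def S_mult)

lemma C_monom: "c \<in> S \<Longrightarrow> Polynomial.monom c n \<in> C"
  by (simp add: C_def S_0)

lemma C_0: "0 \<in> C"
  by (simp add: C_def S_0)

lemma C_const: "c \<in> S \<Longrightarrow> [:c:] \<in> C"
  using C_monom[of c 0] by (simp add: monom_0)

lemma P_mult_C: "F \<in> C \<Longrightarrow> b \<in> P \<Longrightarrow> poly F x * b \<in> P"
  by (rule P_mult) (auto simp: C_def)

lemma P_mult_S: "c \<in> S \<Longrightarrow> b \<in> P \<Longrightarrow> c * b \<in> P"
  using P_mult_C[OF C_const, of c b] by simp

lemma P_diff: "a \<in> P \<Longrightarrow> b \<in> P \<Longrightarrow> a - b \<in> P"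
  using P_add[of a "- b"] P_mult_S[of "-1" b] S_uminus S_1 by simp

lemma P_sum: "(\<And>i. i \<in> I \<Longrightarrow> f i \<in> P) \<Longrightarrow> sum f I \<in> P"
  by (induction I rule: infinite_finite_induct) (auto simp: P_0 P_add)

lemma P_prime_C: "F \<in> C \<Longrightarrow> G \<in> C \<Longrightarrow> poly F x * poly G x \<in> P \<Longrightarrow> poly F x \<in> P \<or> poly G x \<in> P"
  by (rule P_prime) (auto simp: C_def)

lemma P_prime_S: "a \<in> S \<Longrightarrow> b \<in> S \<Longrightarrow> a * b \<in> P \<Longrightarrow> a \<in> P \<or> b \<in> P"
  using P_prime_C[OF C_const C_const, of a b] by simp

lemma P_power: "a \<in> S \<Longrightarrow> a ^ n \<in> P \<Longrightarrow> a \<in> P"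
  by (induction n) (auto simp: P_1 dest: P_prime_S[OF _ S_power])

lemma poly_in_P:
  assumes "\<And>i. coeff F i \<in> P"
  shows "poly F x \<in> P"
  unfolding poly_altdef
proof (rule P_sum)
  fix i
  have "Polynomial.monom 1 i \<in> C"
    using C_monom S_1 by blast
  from P_mult_C[OF this assms[of i]] show "coeff F i * x ^ i \<in> P"
    by (simp add: poly_monom mult.commute)
qed

lemma truncate:
  assumes "F \<in> C"
  shows "(\<forall>i. coeff F i \<in> P) \<or>
    (\<exists>F'\<in>C. lead_coeff F' \<notin> P \<and> degree F' \<le> degree F \<and> (\<forall>i. coeff (F - F') i \<in> P))"
  using assms
proof (induction "degree F" arbitrary: F rule: less_induct)
  case less
  show ?case
  proof (cases "lead_coeff F \<in> P")
    case False
    then show ?thesis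
      using less(2) P_0 by (intro disjI2 bexI[of _ F]) auto
  next
    case lc: True
    define M where "M = Polynomial.monom (lead_coeff F) (degree F)"
    have MP: "coeff M i \<in> P" for i
      using lc P_0 by (auto simp: M_def)
    show ?thesis
    proof (cases "degree F = 0")
      case True
      then show ?thesis
        using lc P_0 by (metis coeff_eq_0 gr0I)
    next
      case False
      have C': "F - M \<in> C"
        unfolding M_def using less(2) by (intro C_diff C_monom coeff_S) auto
      have d: "degree (F - M) < degree F"
      proof (rule degree_lessI)
        show "F - M \<noteq> 0 \<or> degree F > 0" using False by simp
        show "\<forall>k\<ge>degree F. coeff (F - M) k = 0"
          by (auto simp: M_def coeff_eq_0)
      qed
      from less(1)[OF d C'] show ?thesis
      proof
        assume "\<forall>i. coeff (F - M) i \<in> P"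
        then have "coeff F i \<in> P" for i
          using P_add[OF _ MP[of i], of "coeff (F - M) i"] by simp
        then show ?thesis by blast
      next
        assume "\<exists>F'\<in>C. lead_coeff F' \<notin> P \<and> degree F' \<le> degree (F - M) \<and>
          (\<forall>i. coeff (F - M - F') i \<in> P)"
        then obtain F' where F': "F' \<in> C" "lead_coeff F' \<notin> P" "degree F' \<le> degree (F - M)"
          "\<forall>i. coeff (F - M - F') i \<in> P" by blast
        have "coeff (F - F') i \<in> P" for i
          using P_add[OF F'(4)[rule_format, of i] MP[of i]] by (simp add: algebra_simps)
        then show ?thesis
          using F' d by (intro disjI2 bexI[of _ F']) auto
      qed
    qed
  qed
qed

lemma truncate_notin:
  assumes "F \<in> C" "poly F x \<notin> P"
  obtains F' where "F' \<in> C" "lead_coeff F' \<notin> P" "degree F' \<le> degree F" "poly F x - poly F' x \<in> P"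
    "poly F' x \<notin> P"
proof -
  have "\<not> (\<forall>i. coeff F i \<in> P)"
    using assms poly_in_P by blast
  then obtain F' where F': "F' \<in> C" "lead_coeff F' \<notin> P" "degree F' \<le> degree F"
    "\<forall>i. coeff (F - F') i \<in> P"
    using truncate[OF assms(1)] by blast
  have *: "poly F x - poly F' x \<in> P"
    using poly_in_P[of "F - F'"] F'(4) by simp
  then have "poly F' x \<notin> P"
    using assms(2) P_add by fastforce
  with F' * that show thesis by blast
qed

lemma pseudo_division:
  assumes "F \<in> C" "G \<in> C" "degree G > 0"
  shows "\<exists>N. \<exists>Q\<in>C. \<exists>R\<in>C. smult (lead_coeff G ^ N) F = Q * G + R \<and> degree R < degree G"
  using assms(1)
proof (induction "degree F" arbitrary: F rule: less_induct)
  case less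
  let ?c = "lead_coeff G"
  show ?case
  proof (cases "degree F < degree G")
    case True
    then show ?thesis
      using less(2) C_0 by (intro exI[of _ 0] bexI[of _ 0] bexI[of _ F]) auto
  next
    case False
    define M where "M = Polynomial.monom (lead_coeff F) (degree F - degree G)"
    define F' where "F' = smult ?c F - M * G"
    have MC: "M \<in> C"
      unfolding M_def using less(2) by (intro C_monom coeff_S)
    have F'C: "F' \<in> C"
      unfolding F'_def using less(2) assms(2) MC by (intro C_diff C_smult C_mult coeff_S)
    have d: "degree F' < degree F"
    proof (rule degree_lessI)
      show "F' \<noteq> 0 \<or> degree F > 0" using False assms(3) by simp
      have "degree M + degree G \<le> degree F"
        using False degree_monom_le[of "lead_coeff F" "degree F - degree G"] by (simp add: M_def)
      then have dMG: "degree (M * G) \<le> degree F"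
        using degree_mult_le[of M G] by simp
      show "\<forall>k\<ge>degree F. coeff F' k = 0"
      proof (intro allI impI)
        fix k assume "k \<ge> degree F"
        show "coeff F' k = 0"
        proof (cases "k = degree F")
          case True
          have "coeff (M * G) (degree F) = lead_coeff F * ?c"
            using False by (simp add: M_def coeff_monom_mult)
          then show ?thesis
            using True by (simp add: F'_def)
        next
          case False
          then show ?thesis
            using \<open>k \<ge> degree F\<close> dMG by (simp add: F'_def coeff_eq_0)
        qed
      qed
    qed
    obtain N Q R where IH: "Q \<in> C" "R \<in> C" "smult (?c ^ N) F' = Q * G + R" "degree R < degree G"
      using less(1)[OF d F'C] by blast
    have "smult (?c ^ Suc N) F = smult (?c ^ N) F' + smult (?c ^ N) M * G"
      by (simp add: F'_def algebra_simps smult_diff_right)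
    also have "\<dots> = (Q + smult (?c ^ N) M) * G + R"
      by (simp add: IH(3) algebra_simps)
    finally show ?thesis
      using IH MC assms(2) by (meson C_add C_smult S_power coeff_S)
  qed
qed

lemma poly_pseudo_division:
  assumes "smult c F = Q * G + R"
  shows "c * poly F x = poly Q x * poly G x + poly R x"
  using arg_cong[OF assms, of "\<lambda>H. poly H x"] by simp

lemma minimal_relation:
  assumes "F \<in> C" "poly F x \<in> P" "\<not> (\<forall>i. coeff F i \<in> P)"
  obtains f where "f \<in> C" "poly f x \<in> P" "lead_coeff f \<notin> P" "degree f > 0"
    "\<And>G i. G \<in> C \<Longrightarrow> poly G x \<in> P \<Longrightarrow> degree G < degree f \<Longrightarrow> coeff G i \<in> P"
proof -
  define A where "A = {f \<in> C. poly f x \<in> P \<and> lead_coeff f \<notin> P}"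
  have cut: "\<exists>f\<in>A. degree f \<le> degree G"
    if G: "G \<in> C" "poly G x \<in> P" "\<not> (\<forall>i. coeff G i \<in> P)" for G
  proof -
    obtain F' where F': "F' \<in> C" "lead_coeff F' \<notin> P" "degree F' \<le> degree G"
      "\<forall>i. coeff (G - F') i \<in> P"
      using truncate[OF G(1)] G(3) by blast
    have "poly (G - F') x \<in> P"
      by (rule poly_in_P) (use F' in blast)
    then have "poly F' x \<in> P"
      using P_diff[OF G(2), of "poly (G - F') x"] by simp
    with F' show ?thesis unfolding A_def by blast
  qed
  then have "\<exists>f. f \<in> A"
    using assms by blast
  then obtain f where f: "f \<in> A" "\<And>g. g \<in> A \<Longrightarrow> degree f \<le> degree g"
    using ex_has_least_nat[of "\<lambda>f. f \<in> A" _ degree] by blast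
  show thesis
  proof (rule that[of f])
    show "f \<in> C" "poly f x \<in> P" "lead_coeff f \<notin> P"
      using f(1) unfolding A_def by auto
    show "degree f > 0"
    proof (rule ccontr)
      assume "\<not> degree f > 0"
      then obtain c where "f = [:c:]"
        by (metis degree_eq_zeroE gr0I)
      then show False
        using f(1) unfolding A_def by auto
    qed
    show "coeff G i \<in> P" if "G \<in> C" "poly G x \<in> P" "degree G < degree f" for G i
      using cut[OF that(1,2)] f(2) that(3) by (meson leD le_trans)
  qed
qed

text \<open>Over the fraction field of \<open>S / P\<close> the polynomial \<open>f\<close> is a minimal polynomial of \<open>x\<close>, hence
  irreducible. A nonzero multiple of \<open>v\<close> of least degree would divide it, so it is a constant.\<close>

lemma multiple_in_subring:
  assumes f: "f \<in> C" "poly f x \<in> P" "lead_coeff f \<notin> P" "degree f > 0"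
    and min: "\<And>G i. G \<in> C \<Longrightarrow> poly G x \<in> P \<Longrightarrow> degree G < degree f \<Longrightarrow> coeff G i \<in> P"
    and v: "v \<in> C" "poly v x \<notin> P"
  shows "\<exists>u\<in>S. u \<notin> P \<and> (\<exists>s\<in>C. u - poly s x * poly v x \<in> P)"
proof -
  define M where "M = {w \<in> C. lead_coeff w \<notin> P \<and> poly w x \<notin> P \<and>
    (\<exists>s\<in>C. poly w x - poly s x * poly v x \<in> P)}"
  have into_M: "\<exists>w\<in>M. degree w \<le> degree G"
    if G: "G \<in> C" "poly G x \<notin> P" "s \<in> C" "poly G x - poly s x * poly v x \<in> P" for G s
  proof -
    obtain w where w: "w \<in> C" "lead_coeff w \<notin> P" "degree w \<le> degree G"
      "poly G x - poly w x \<in> P" "poly w x \<notin> P"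
      using truncate_notin[OF G(1,2)] by blast
    have "poly w x - poly s x * poly v x \<in> P"
      using P_diff[OF G(4) w(4)] by (simp add: algebra_simps)
    with w G(3) show ?thesis unfolding M_def by blast
  qed
  have "\<exists>w. w \<in> M"
    using into_M[OF v, of "[:1:]"] C_const S_1 P_0 by auto
  then obtain w where w: "w \<in> M" and wmin: "\<And>g. g \<in> M \<Longrightarrow> degree w \<le> degree g"
    using ex_has_least_nat[of "\<lambda>f. f \<in> M" _ degree] by blast
  then obtain s where s: "w \<in> C" "lead_coeff w \<notin> P" "poly w x \<notin> P" "s \<in> C"
      "poly w x - poly s x * poly v x \<in> P"
    unfolding M_def by blast
  have step: "poly R x \<in> P"
    if R: "R \<in> C" "degree R < degree w" "Q \<in> C" "poly R x - poly Q x * poly w x \<in> P" for R Q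
  proof (rule ccontr)
    assume "poly R x \<notin> P"
    moreover have "poly R x - poly (Q * s) x * poly v x \<in> P"
      using P_add[OF R(4) P_mult_C[OF R(3) s(5)]] by (simp add: algebra_simps)
    ultimately show False
      using into_M[OF R(1) _ C_mult[OF R(3) s(4)]] wmin R(2) by (meson leD le_trans)
  qed
  have "degree w = 0"
  proof (rule ccontr)
    assume e: "degree w \<noteq> 0"
    have de: "degree w < degree f"
    proof (rule ccontr)
      assume nd: "\<not> degree w < degree f"
      obtain N Q R where QR: "Q \<in> C" "R \<in> C" "smult (lead_coeff f ^ N) w = Q * f + R"
        "degree R < degree f"
        using pseudo_division[OF s(1) f(1,4)] by blast
      note eq = poly_pseudo_division[OF QR(3)]
      have Qf: "poly Q x * poly f x \<in> P"
        using P_mult_C[OF QR(1) f(2)] .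
      have "poly R x \<in> P"
      proof (rule step[of R "[:lead_coeff f ^ N:]"])
        show "poly R x - poly [:lead_coeff f ^ N:] x * poly w x \<in> P"
          using P_diff[OF P_0 Qf] eq by (simp add: algebra_simps)
      qed (use QR nd f(1) in \<open>auto intro: C_const S_power coeff_S\<close>)
      then have "lead_coeff f ^ N * poly w x \<in> P"
        using P_add[OF Qf] eq by simp
      then show False
        using P_prime_C[OF C_const s(1), of "lead_coeff f ^ N"] s(3) f(1,3)
          P_power[OF coeff_S[OF f(1)]] by (auto intro: S_power coeff_S)
    qed
    obtain N Q R where QR: "Q \<in> C" "R \<in> C" "smult (lead_coeff w ^ N) f = Q * w + R"
      "degree R < degree w"
      using pseudo_division[OF f(1) s(1)] e by blast
    note eq = poly_pseudo_division[OF QR(3)]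
    have fP: "lead_coeff w ^ N * poly f x \<in> P"
      using P_mult_S[OF S_power[OF coeff_S[OF s(1)]] f(2)] .
    have RP: "poly R x \<in> P"
    proof (rule step[of R "- Q"])
      show "- Q \<in> C"
        using C_diff[OF C_0 QR(1)] by simp
      show "poly R x - poly (- Q) x * poly w x \<in> P"
        using fP eq by (simp add: algebra_simps)
    qed (use QR in auto)
    have "poly Q x * poly w x \<in> P"
      using P_diff[OF fP RP] eq by simp
    then have QP: "poly Q x \<in> P"
      using P_prime_C[OF QR(1) s(1)] s(3) by blast
    have w0: "lead_coeff w ^ N \<noteq> 0" "lead_coeff w \<noteq> 0" "w \<noteq> 0"
      using s(2) P_0 by (auto)
    have "degree (Q * w + R) = degree f"
      using w0 by (simp flip: QR(3))
    moreover from this have "degree R < degree (Q * w)"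
      using QR(4) de degree_add_le_max[of "Q * w" R] by linarith
    ultimately have dQw: "degree (Q * w) = degree f"
      using degree_add_eq_left by metis
    then have Q0: "Q \<noteq> 0"
      using f(4) by auto
    have "degree Q < degree f"
      using dQw degree_mult_eq[OF Q0 w0(3)] e by simp
    then have lQ: "lead_coeff Q \<in> P"
      using min[OF QR(1) QP] by blast
    have "coeff (Q * w + R) (degree f) = lead_coeff (Q * w)"
      using QR(4) de dQw by (simp add: coeff_eq_0)
    then have "lead_coeff w ^ N * lead_coeff f = lead_coeff Q * lead_coeff w"
      by (simp add: lead_coeff_mult flip: QR(3))
    then have "lead_coeff w ^ N * lead_coeff f \<in> P"
      using P_mult_S[OF coeff_S[OF s(1)] lQ] by (metis mult.commute)
    then show False
      using P_prime_S[OF S_power coeff_S] f(1,3) s(1,2) P_power coeff_S by blast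
  qed
  then obtain u where u: "w = [:u:]"
    by (metis degree_eq_zeroE)
  then have "u \<in> S" "u \<notin> P" "u - poly s x * poly v x \<in> P"
    using s coeff_S[OF s(1), of 0] by auto
  with s(4) show ?thesis by blast
qed

end

section \<open>The Nullstellensatz\<close>

lemma alg_closed_nonroot:
  fixes p :: "'k::alg_closed_field poly"
  assumes "p \<noteq> 0"
  shows "\<exists>x. poly p x \<noteq> 0"
proof (cases "degree p = 0")
  case True
  then show ?thesis
    using assms
    by (metis degree_eq_zeroE mult_zero_right pCons_0_0 poly_0 poly_pCons add.right_neutral)
next
  case False
  have "degree (p - 1) = degree p"
    using False degree_add_eq_left[of "- 1" p] by simp
  then obtain x where "poly (p - 1) x = 0"
    using False alg_closed_imp_poly_has_root[of "p - 1"] by auto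
  then have "poly p x = 1" by simp
  then show ?thesis by (metis zero_neq_one)
qed

lemma polys_in_empty: "f \<in> polys_in {} \<Longrightarrow> f = mconst (Poly_Mapping.lookup f 0)"
  unfolding polys_in_iff mconst_def
  by (rule poly_mapping_eqI) (auto simp: lookup_single when_def in_keys_iff)

lemma mconst_mult: "mconst a * mconst b = mconst (a * b)"
  by (simp add: mconst_def mult_single)

lemma mconst_1: "mconst 1 = 1"
  by (simp add: mconst_def)

text \<open>Induction on the number of variables. If the last variable is transcendental modulo \<open>P\<close>, a point
  of the smaller space is extended by almost any value; otherwise by a root of a relation of least
  degree. Pseudo-division by that relation shows that the remaining elements of \<open>P\<close> vanish too,
  wherever its leading coefficient does not.\<close>

theorem nullstellensatz_prime:
  fixes P :: "(nat, 'k::alg_closed_field) mpoly set"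
  assumes P: "primeideal P (poly_ring {..<n})"
    and v: "v \<in> polys_in {..<n}" "v \<notin> P"
  shows "\<exists>a. mpoly_eval a v \<noteq> 0 \<and> (\<forall>f\<in>P. mpoly_eval a f = 0)"
proof -
  interpret primeideal P "poly_ring {..<n}" by fact
  have Psub: "P \<subseteq> polys_in {..<n}"
    by (rule a_subset)
  have P_0: "0 \<in> P"
    using additive_subgroup.zero_closed[OF is_additive_subgroup] by simp
  have P_1: "1 \<notin> P"
    using one_imp_carrier I_notcarr by auto
  have P_add: "f + g \<in> P" if "f \<in> P" "g \<in> P" for f g
    using additive_subgroup.a_closed[OF is_additive_subgroup that] by simp
  have P_mult: "f * g \<in> P" if "f \<in> polys_in {..<n}" "g \<in> P" for f g
    using I_l_closed[of g f] that by simp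
  have "\<exists>a. mpoly_eval a v \<noteq> 0 \<and> (\<forall>f\<in>P \<inter> polys_in {..<m}. mpoly_eval a f = 0)"
    if "m \<le> n" "v \<in> polys_in {..<m}" "v \<notin> P" for m v
    using that
  proof (induction m arbitrary: v)
    case 0
    have zero: "f = 0" if "f \<in> P" "f \<in> polys_in {}" for f
    proof (rule ccontr)
      assume "f \<noteq> 0"
      define c where "c = Poly_Mapping.lookup f 0"
      have f: "f = mconst c"
        using polys_in_empty[OF that(2)] c_def by simp
      with \<open>f \<noteq> 0\<close> have "c \<noteq> 0"
        by (auto simp: mconst_def)
      then have "mconst (inverse c) * f = 1"
        by (simp add: f mconst_mult mconst_1)
      then show False
        using P_mult[OF _ that(1), of "mconst (inverse c)"] P_1 by simp
    qed
    have "v = mconst (Poly_Mapping.lookup v 0)" "v \<noteq> 0"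
      using 0 polys_in_empty P_0 by auto
    then have "mpoly_eval (\<lambda>_. 0) v \<noteq> 0"
      by (metis mpoly_eval_mconst mconst_def single_zero)
    moreover have "mpoly_eval (\<lambda>_. 0) f = 0" if "f \<in> P \<inter> polys_in {..<0}" for f
      using zero[of f] that by auto
    ultimately show ?case by blast
  next
    case (Suc m)
    define x :: "(nat, 'k) mpoly" where "x = mvar m"
    have ins: "{..<Suc m} = insert m {..<m}"
      by auto
    have in_n: "poly F x \<in> polys_in {..<n}" if "\<And>i. coeff F i \<in> polys_in {..<m}" for F
      using poly_mvar_in_polys_in[OF that, of m] Suc.prems(1)
      unfolding x_def ins[symmetric] polys_in_iff by fastforce
    interpret E: simple_extension_prime "polys_in {..<m}" P x
    proof
      show "poly F x * b \<in> P" if "\<And>i. coeff F i \<in> polys_in {..<m}" "b \<in> P" for F b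
        using P_mult in_n that by blast
      show "poly F x \<in> P \<or> poly G x \<in> P"
        if "\<And>i. coeff F i \<in> polys_in {..<m}" "\<And>i. coeff G i \<in> polys_in {..<m}"
          "poly F x * poly G x \<in> P" for F G
        using I_prime[of "poly F x" "poly G x"] in_n that by simp
    qed (use P_0 P_1 P_add in auto)
    have as_poly: "\<exists>F\<in>E.C. g = poly F x" if "g \<in> polys_in {..<Suc m}" for g
      using polys_in_insert[of g m "{..<m}"] that unfolding ins x_def E.C_def by auto
    have eval: "mpoly_eval (a(m := \<xi>)) (poly F x) = poly (map_poly (mpoly_eval a) F) \<xi>"
      if "F \<in> E.C" for F a \<xi>
      unfolding x_def using that by (intro mpoly_eval_poly_mvar) (auto simp: E.C_def)
    have vanish: "mpoly_eval (a(m := \<xi>)) (poly F x) = 0"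
      if F: "F \<in> E.C" "\<And>i. coeff F i \<in> P" and a: "\<forall>f\<in>P \<inter> polys_in {..<m}. mpoly_eval a f = 0"
      for F a \<xi>
    proof -
      have "map_poly (mpoly_eval a) F = 0"
        using F a E.coeff_S by (intro poly_eqI) (auto simp: coeff_map_poly)
      then show ?thesis
        using eval[OF F(1)] by simp
    qed
    obtain V where V: "V \<in> E.C" "v = poly V x"
      using as_poly[OF Suc.prems(2)] by blast
    show ?case
    proof (cases "\<forall>F\<in>E.C. poly F x \<in> P \<longrightarrow> (\<forall>i. coeff F i \<in> P)")
      case True
      obtain i where i: "coeff V i \<notin> P"
        using E.poly_in_P[of V] V Suc.prems(3) by blast
      then obtain a where a: "mpoly_eval a (coeff V i) \<noteq> 0"
          "\<forall>f\<in>P \<inter> polys_in {..<m}. mpoly_eval a f = 0"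
        using Suc.IH[of "coeff V i"] Suc.prems(1) E.coeff_S[OF V(1)] by auto
      then have "coeff (map_poly (mpoly_eval a) V) i \<noteq> 0"
        by (simp add: coeff_map_poly)
      then have "map_poly (mpoly_eval a) V \<noteq> 0"
        by auto
      then obtain \<xi> where "poly (map_poly (mpoly_eval a) V) \<xi> \<noteq> 0"
        using alg_closed_nonroot by blast
      then have "mpoly_eval (a(m := \<xi>)) v \<noteq> 0"
        using eval[OF V(1)] V(2) by simp
      moreover have "mpoly_eval (a(m := \<xi>)) g = 0" if "g \<in> P \<inter> polys_in {..<Suc m}" for g
        using as_poly[of g] that True vanish[OF _ _ a(2)] by blast
      ultimately show ?thesis by blast
    next
      case False
      then obtain f where f: "f \<in> E.C" "poly f x \<in> P" "lead_coeff f \<notin> P" "degree f > 0"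
        and min: "\<And>G i. G \<in> E.C \<Longrightarrow> poly G x \<in> P \<Longrightarrow> degree G < degree f \<Longrightarrow> coeff G i \<in> P"
        using E.minimal_relation by (metis (no_types, lifting))
      obtain u s where u: "u \<in> polys_in {..<m}" "u \<notin> P" "s \<in> E.C" "u - poly s x * v \<in> P"
        using E.multiple_in_subring[OF f min V(1)] V(2) Suc.prems(3) by blast
      have "lead_coeff f * u \<notin> P"
        using E.P_prime_S[OF E.coeff_S[OF f(1)] u(1)] f(3) u(2) by blast
      then obtain a where a: "mpoly_eval a (lead_coeff f * u) \<noteq> 0"
          "\<forall>f\<in>P \<inter> polys_in {..<m}. mpoly_eval a f = 0"
        using Suc.IH[of "lead_coeff f * u"] Suc.prems(1) E.coeff_S[OF f(1)] u(1) by auto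
      have "coeff (map_poly (mpoly_eval a) f) (degree f) \<noteq> 0"
        using a(1) by (simp add: coeff_map_poly)
      then have "degree (map_poly (mpoly_eval a) f) > 0"
        using le_degree f(4) by fastforce
      then obtain \<xi> where \<xi>: "poly (map_poly (mpoly_eval a) f) \<xi> = 0"
        using alg_closed_imp_poly_has_root by blast
      let ?b = "a(m := \<xi>)"
      have same: "mpoly_eval ?b g = mpoly_eval a g" if "g \<in> polys_in {..<m}" for g
        using that by (rule mpoly_eval_cong) auto
      have zero: "mpoly_eval ?b g = 0" if g: "g \<in> P \<inter> polys_in {..<Suc m}" for g
      proof -
        obtain G where G: "G \<in> E.C" "g = poly G x"
          using as_poly g by blast
        obtain N Q R where QR: "Q \<in> E.C" "R \<in> E.C" "smult (lead_coeff f ^ N) G = Q * f + R"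
          "degree R < degree f"
          using E.pseudo_division[OF G(1) f(1,4)] by blast
        note eq = E.poly_pseudo_division[OF QR(3), folded G(2)]
        have "lead_coeff f ^ N * g - poly Q x * poly f x \<in> P"
          using g by (intro E.P_diff E.P_mult_C E.P_mult_S E.S_power E.coeff_S f QR) auto
        then have "poly R x \<in> P"
          using eq by simp
        then have "mpoly_eval ?b (poly R x) = 0"
          using vanish[OF QR(2) _ a(2)] min[OF QR(2) _ QR(4)] by blast
        moreover have "mpoly_eval ?b (poly f x) = 0"
          using eval[OF f(1)] \<xi> by simp
        ultimately have "mpoly_eval ?b (lead_coeff f) ^ N * mpoly_eval ?b g = 0"
          using arg_cong[OF eq, of "mpoly_eval ?b"] by simp
        moreover have "mpoly_eval ?b (lead_coeff f) \<noteq> 0"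
          using a(1) same[OF E.coeff_S[OF f(1)]] by auto
        ultimately show ?thesis by simp
      qed
      have "u - poly s x * v \<in> polys_in {..<Suc m}"
      proof -
        have "poly s x \<in> polys_in {..<Suc m}"
          unfolding ins x_def using u(3) by (intro poly_mvar_in_polys_in) (auto simp: E.C_def)
        moreover have "u \<in> polys_in {..<Suc m}"
          using u(1) unfolding polys_in_iff ins by blast
        ultimately show ?thesis
          using Suc.prems(2) by simp
      qed
      then have "mpoly_eval ?b u = mpoly_eval ?b (poly s x) * mpoly_eval ?b v"
        using zero u(4) by force
      then have "mpoly_eval ?b v \<noteq> 0"
        using a(1) same[OF u(1)] by auto
      then show ?thesis
        using zero by blast
    qed
  qed
  from this[OF order_refl v] Psub show ?thesis by blast
qed

lemma (in ring) ideal_Union_chain: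
  assumes "\<C> \<noteq> {}" and id: "\<And>J. J \<in> \<C> \<Longrightarrow> ideal J R"
    and chain: "\<And>J K. J \<in> \<C> \<Longrightarrow> K \<in> \<C> \<Longrightarrow> J \<subseteq> K \<or> K \<subseteq> J"
  shows "ideal (\<Union>\<C>) R"
proof (rule idealI[OF ring_axioms])
  have sg: "subgroup J (add_monoid R)" if "J \<in> \<C>" for J
    using additive_subgroup.a_subgroup[OF ideal.axioms(1)[OF id[OF that]]] .
  show "subgroup (\<Union>\<C>) (add_monoid R)"
  proof (rule subgroup.intro)
    show "\<Union>\<C> \<subseteq> carrier (add_monoid R)"
      using subgroup.subset[OF sg] by blast
    show "\<one>\<^bsub>add_monoid R\<^esub> \<in> \<Union>\<C>"
      using assms(1) subgroup.one_closed[OF sg] by blast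
    show "inv\<^bsub>add_monoid R\<^esub> a \<in> \<Union>\<C>" if "a \<in> \<Union>\<C>" for a
      using that subgroup.m_inv_closed[OF sg] by blast
    fix a b assume "a \<in> \<Union>\<C>" "b \<in> \<Union>\<C>"
    then obtain J where "J \<in> \<C>" "a \<in> J" "b \<in> J"
      using chain by blast
    then show "a \<otimes>\<^bsub>add_monoid R\<^esub> b \<in> \<Union>\<C>"
      using subgroup.m_closed[OF sg] by blast
  qed
qed (use ideal.I_l_closed[OF id] ideal.I_r_closed[OF id] in blast)+

lemma (in cring) exists_primeideal_avoiding:
  assumes I: "ideal I R" and f: "f \<in> carrier R" and pow: "\<And>m::nat. f [^] m \<notin> I"
  shows "\<exists>P. primeideal P R \<and> I \<subseteq> P \<and> f \<notin> P"
proof -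
  define \<A> where "\<A> = {J. ideal J R \<and> I \<subseteq> J \<and> (\<forall>m::nat. f [^] m \<notin> J)}"
  have "\<exists>M\<in>\<A>. \<forall>X\<in>\<A>. M \<subseteq> X \<longrightarrow> X = M"
  proof (rule subset_Zorn_nonempty)
    show "\<A> \<noteq> {}"
      using I pow unfolding \<A>_def by blast
    fix \<C> assume C: "\<C> \<noteq> {}" "subset.chain \<A> \<C>"
    then have sub: "\<C> \<subseteq> \<A>" and chain: "\<And>J K. J \<in> \<C> \<Longrightarrow> K \<in> \<C> \<Longrightarrow> J \<subseteq> K \<or> K \<subseteq> J"
      unfolding subset_chain_def by auto
    have el: "ideal J R" "I \<subseteq> J" "\<And>m::nat. f [^] m \<notin> J" if "J \<in> \<C>" for J
      using that sub unfolding \<A>_def by auto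
    have "ideal (\<Union>\<C>) R"
      using C(1) el(1) chain by (rule ideal_Union_chain)
    moreover obtain J where "J \<in> \<C>"
      using C(1) by blast
    then have "I \<subseteq> \<Union>\<C>"
      using el(2) by (meson Union_upper subset_trans)
    moreover have "f [^] m \<notin> \<Union>\<C>" for m :: nat
      using el(3) by (metis UnionE)
    ultimately show "\<Union>\<C> \<in> \<A>"
      unfolding \<A>_def by simp
  qed
  then obtain M where "M \<in> \<A>" and max: "\<And>X. X \<in> \<A> \<Longrightarrow> M \<subseteq> X \<Longrightarrow> X = M"
    by (metis (no_types))
  then have M: "ideal M R" "I \<subseteq> M" "\<And>m::nat. f [^] m \<notin> M"
    unfolding \<A>_def by simp_all
  interpret M: ideal M R by fact
  have sum_pow: "\<exists>m::nat. \<exists>x\<in>M. \<exists>r\<in>carrier R. f [^] m = x \<oplus> r \<otimes> a"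
    if a: "a \<in> carrier R" "a \<notin> M" for a
  proof -
    have J: "ideal (M <+> PIdl a) R"
      by (rule add_ideals[OF M(1) cgenideal_ideal[OF a(1)]])
    have MJ: "M \<subseteq> M <+> PIdl a"
    proof
      fix x assume "x \<in> M"
      then have "x = x \<oplus> \<zero> \<otimes> a"
        using a M.a_Hcarr by simp
      then show "x \<in> M <+> PIdl a"
        unfolding set_add_def' cgenideal_def using \<open>x \<in> M\<close> by blast
    qed
    have "a \<in> M <+> PIdl a"
    proof -
      have "a = \<zero> \<oplus> \<one> \<otimes> a" "\<zero> \<in> M"
        using a M.zero_closed by simp_all
      then show ?thesis
        unfolding set_add_def' cgenideal_def by blast
    qed
    then have "M <+> PIdl a \<notin> \<A>"
      using max[OF _ MJ] a(2) by blast
    then obtain m :: nat where "f [^] m \<in> M <+> PIdl a"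
      using J MJ M(2) unfolding \<A>_def by blast
    then show ?thesis
      unfolding set_add_def' cgenideal_def by blast
  qed
  have "primeideal M R"
  proof (rule primeidealI[OF M(1)])
    show "cring R" ..
    show "carrier R \<noteq> M"
      using M(3)[of 0] by auto
    fix a b assume ab: "a \<in> carrier R" "b \<in> carrier R" "a \<otimes> b \<in> M"
    show "a \<in> M \<or> b \<in> M"
    proof (rule ccontr)
      assume "\<not> (a \<in> M \<or> b \<in> M)"
      then obtain i j :: nat and x y r s where
        x: "x \<in> M" "r \<in> carrier R" "f [^] i = x \<oplus> r \<otimes> a" and
        y: "y \<in> M" "s \<in> carrier R" "f [^] j = y \<oplus> s \<otimes> b"
        using sum_pow[OF ab(1)] sum_pow[OF ab(2)] by metis
      have car: "x \<in> carrier R" "y \<in> carrier R"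
        using x y M.a_Hcarr by auto
      have "f [^] (i + j) = (x \<oplus> r \<otimes> a) \<otimes> (y \<oplus> s \<otimes> b)"
        using f x(3) y(3) by (simp flip: nat_pow_mult)
      also have "\<dots> = (y \<oplus> s \<otimes> b) \<otimes> x \<oplus> ((r \<otimes> a) \<otimes> y \<oplus> (r \<otimes> s) \<otimes> (a \<otimes> b))"
        using car x(2) y(2) ab by algebra
      also have "\<dots> \<in> M"
        by (rule M.a_closed[OF M.I_l_closed[OF x(1)]
              M.a_closed[OF M.I_l_closed[OF y(1)] M.I_l_closed[OF ab(3)]]])
           (use car x(2) y(2) ab in auto)
      finally show False
        using M(3) by blast
    qed
  qed
  moreover have "f \<notin> M"
    using M(3)[of 1] f by simp
  ultimately show ?thesis
    using M(2) by blast
qed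

lemma poly_ring_nat_pow: "f [^]\<^bsub>poly_ring V\<^esub> (m::nat) = f ^ m"
proof (induction m)
  case (Suc m)
  interpret cring "poly_ring V :: ('a, 'b) mpoly ring" by (rule cring_poly_ring)
  show ?case
    using Suc by (simp add: mult.commute)
qed (simp add: nat_pow_def)

theorem nullstellensatz:
  fixes I :: "(nat, 'k::alg_closed_field) mpoly set"
  assumes I: "ideal I (poly_ring {..<n})" and f: "f \<in> polys_in {..<n}"
    and zero: "\<And>a. \<forall>g\<in>I. mpoly_eval a g = 0 \<Longrightarrow> mpoly_eval a f = 0"
  shows "\<exists>m. f ^ m \<in> I"
proof (rule ccontr)
  assume "\<nexists>m. f ^ m \<in> I"
  then obtain P where P: "primeideal P (poly_ring {..<n})" "I \<subseteq> P" "f \<notin> P"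
    using cring.exists_primeideal_avoiding[OF cring_poly_ring I f] by (auto simp: poly_ring_nat_pow)
  from nullstellensatz_prime[OF P(1) f P(3)] zero P(2) show False
    by blast
qed

section \<open>The ideal of \<open>Q'\<close> is a radical ideal\<close>

text \<open>For the exponent of \<open>x\<^sub>i\<close> as weight this is \<open>x\<^sub>i \<partial>/\<partial>x\<^sub>i\<close>, and for the total degree it is the sum
  of these operators.\<close>

definition weight_deriv ::
    "(('v \<Rightarrow>\<^sub>0 nat) \<Rightarrow> 'k) \<Rightarrow> ('v, 'k::comm_ring_1) mpoly \<Rightarrow> ('v, 'k) mpoly" where
  "weight_deriv w f = Poly_Mapping.mapp (\<lambda>m c. w m * c) f"

lemma lookup_weight_deriv:
  "Poly_Mapping.lookup (weight_deriv w f) m = w m * Poly_Mapping.lookup f m"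
  by (simp add: weight_deriv_def lookup_mapp when_def in_keys_iff)

lemma weight_deriv_add: "weight_deriv w (f + g) = weight_deriv w f + weight_deriv w g"
  by (rule poly_mapping_eqI) (simp add: lookup_weight_deriv lookup_add distrib_left)

lemma weight_deriv_0 [simp]: "weight_deriv w 0 = 0"
  by (rule poly_mapping_eqI) (simp add: lookup_weight_deriv)

lemma weight_deriv_uminus: "weight_deriv w (- f) = - weight_deriv w f"
  by (rule poly_mapping_eqI) (simp add: lookup_weight_deriv)

lemma weight_deriv_diff: "weight_deriv w (f - g) = weight_deriv w f - weight_deriv w g"
  by (rule poly_mapping_eqI) (simp add: lookup_weight_deriv lookup_minus right_diff_distrib)

lemma weight_deriv_sum: "weight_deriv w (sum f I) = (\<Sum>i\<in>I. weight_deriv w (f i))"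
  by (induction I rule: infinite_finite_induct) (auto simp: weight_deriv_add)

lemma weight_deriv_single:
  "weight_deriv w (Poly_Mapping.single m c) = Poly_Mapping.single m (w m * c)"
  by (rule poly_mapping_eqI) (simp add: lookup_weight_deriv lookup_single when_def)

lemma polys_in_weight_deriv [simp]: "f \<in> polys_in V \<Longrightarrow> weight_deriv w f \<in> polys_in V"
  unfolding polys_in_iff by (auto simp: in_keys_iff lookup_weight_deriv)

locale additive_weight =
  fixes w :: "('v \<Rightarrow>\<^sub>0 nat) \<Rightarrow> 'k::comm_ring_1"
  assumes w_add: "w (m + m') = w m + w m'"
begin

lemma w_0: "w 0 = 0"
  using w_add[of 0 0] by simp

lemma weight_deriv_1 [simp]: "weight_deriv w 1 = 0"
  using weight_deriv_single[of w 0 1] by (simp add: w_0)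

lemma weight_deriv_mult: "weight_deriv w (f * g) = weight_deriv w f * g + f * weight_deriv w g"
proof (induction f rule: mpoly_induct)
  case (single m c)
  show ?case
    by (induction g rule: mpoly_induct)
       (simp_all add: mult_single weight_deriv_single w_add weight_deriv_add algebra_simps
         flip: single_add)
qed (simp_all add: weight_deriv_add algebra_simps)

lemma weight_deriv_power: "weight_deriv w (f ^ Suc k) = of_nat (Suc k) * f ^ k * weight_deriv w f"
  by (induction k) (simp_all add: weight_deriv_mult algebra_simps)

lemma weight_deriv_pth_power:
  assumes "of_nat p = (0 :: ('v, 'k) mpoly)" "p > 0"
  shows "weight_deriv w (f ^ p) = 0"
  using assms weight_deriv_power[of f "p - 1"] by simp

lemma weight_deriv_prod:
  assumes "\<And>i. i \<in> I \<Longrightarrow> weight_deriv w (f i) = of_nat (c i) * f i"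
  shows "weight_deriv w (prod f I) = of_nat (sum c I) * prod f I"
  using assms
  by (induction I rule: infinite_finite_induct) (simp_all add: weight_deriv_mult algebra_simps)

end

definition degree_weight :: "nat \<Rightarrow> (nat \<Rightarrow>\<^sub>0 nat) \<Rightarrow> 'k::comm_ring_1" where
  "degree_weight n m = (\<Sum>i<n. of_nat (Poly_Mapping.lookup m i))"

interpretation degree_weight: additive_weight "degree_weight n"
  by unfold_locales (simp add: degree_weight_def lookup_add sum.distrib)

interpretation exponent_weight: additive_weight "\<lambda>m. of_nat (Poly_Mapping.lookup m i)"
  by unfold_locales (simp add: lookup_add)

lemma mpoly_of_nat: "(of_nat k :: ('v, 'k::comm_ring_1) mpoly) = mconst (of_nat k)"
  by (simp add: mconst_def)

lemma mconst_eq_0_iff: "mconst c = 0 \<longleftrightarrow> c = 0"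
  by (metis mconst_def mpoly_eval_0 mpoly_eval_mconst single_zero)

lemma CHAR_mpoly: "CHAR(('v, 'k::comm_ring_1) mpoly) = CHAR('k)"
  by (rule CHAR_eqI) (auto simp: mpoly_of_nat mconst_eq_0_iff of_nat_eq_0_iff_char_dvd)

lemma degree_weight_mvar_power:
  assumes "i < n"
  shows "weight_deriv (degree_weight n) (mvar i ^ j) =
    of_nat j * (mvar i ^ j :: (nat, 'k::comm_ring_1) mpoly)"
proof -
  have "degree_weight n (Poly_Mapping.single i j) = (of_nat j :: 'k)"
    using assms unfolding degree_weight_def lookup_single when_def
    by (simp add: if_distrib[of of_nat] cong: if_cong)
  then show ?thesis
    by (simp only: mvar_power weight_deriv_single mpoly_of_nat mconst_def mult_single add_0)
qed

lemma polys_in_moore_det: "moore_det q n \<in> polys_in {..<n}"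
proof -
  have "signof \<pi> \<in> polys_in {..<n}" for \<pi>
    by (auto simp: sign_def)
  moreover have "\<pi> i < n" if "\<pi> permutes {0..<n}" "i < n" for \<pi> i
    using permutes_in_image[OF that(1), of i] that(2) by simp
  ultimately show ?thesis
    unfolding moore_det_def det_def'[OF mat_carrier]
    by (intro polys_in_sum polys_in_mult polys_in_prod)
       (auto intro!: polys_in_power polys_in_mvar)
qed

lemma degree_weight_moore_det:
  assumes "of_nat q = (0::'k::field)" "n \<ge> 1"
  shows "weight_deriv (degree_weight n) (moore_det q n) = (moore_det q n :: (nat, 'k) mpoly)"
proof -
  let ?D = "weight_deriv (degree_weight n) :: (nat, 'k) mpoly \<Rightarrow> _"
  have q0: "(of_nat q :: (nat, 'k) mpoly) = 0"
    using assms(1) by (simp add: mpoly_of_nat mconst_eq_0_iff)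
  have "?D (signof \<pi> * (\<Prod>i = 0..<n. mat n n (\<lambda>(i, j). mvar i ^ q ^ j) $$ (i, \<pi> i))) =
      signof \<pi> * (\<Prod>i = 0..<n. mat n n (\<lambda>(i, j). mvar i ^ q ^ j) $$ (i, \<pi> i))"
    if \<pi>: "\<pi> permutes {0..<n}" for \<pi>
  proof -
    have lt: "\<pi> i < n" if "i < n" for i
      using permutes_in_image[OF \<pi>, of i] that by simp
    have "?D (\<Prod>i = 0..<n. mat n n (\<lambda>(i, j). mvar i ^ q ^ j) $$ (i, \<pi> i)) =
        of_nat (\<Sum>i = 0..<n. q ^ \<pi> i) * (\<Prod>i = 0..<n. mat n n (\<lambda>(i, j). mvar i ^ q ^ j) $$ (i, \<pi> i))"
      using \<pi> by (intro degree_weight.weight_deriv_prod) (simp add: degree_weight_mvar_power lt)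
    moreover have "(\<Sum>i = 0..<n. q ^ \<pi> i) = (\<Sum>j = 0..<n. q ^ j)"
      using sum.permute[OF \<pi>, of "\<lambda>j. q ^ j"] by (simp add: comp_def)
    moreover have "of_nat (\<Sum>j = 0..<n. q ^ j) = (1 :: (nat, 'k) mpoly)"
      using assms(2) by (simp add: sum.atLeast_Suc_lessThan q0 zero_power)
    ultimately show ?thesis
      by (auto simp: sign_def weight_deriv_uminus)
  qed
  then show ?thesis
    unfolding moore_det_def det_def'[OF mat_carrier] weight_deriv_sum by (intro sum.cong) auto
qed

lemma single_power:
  "Poly_Mapping.single m (c::'k::comm_ring_1) ^ k =
    Poly_Mapping.single (Poly_Mapping.map (\<lambda>j. k * j) m) (c ^ k)"
proof (induction k)
  case 0
  have "Poly_Mapping.map (\<lambda>j. 0 * j) m = 0"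
    by (rule poly_mapping_eqI) (simp add: map.rep_eq when_def)
  then show ?case by simp
next
  case (Suc k)
  have "m + Poly_Mapping.map (\<lambda>j. k * j) m = Poly_Mapping.map (\<lambda>j. Suc k * j) m"
    by (rule poly_mapping_eqI) (simp add: map.rep_eq when_def lookup_add)
  then show ?case
    using Suc by (simp add: mult_single)
qed

lemma mpoly_pth_root:
  fixes g :: "('v, 'k::alg_closed_field) mpoly"
  assumes p: "prime p" "CHAR('k) = p" and g: "g \<in> polys_in V"
    and dvd: "\<And>m i. m \<in> Poly_Mapping.keys g \<Longrightarrow> p dvd Poly_Mapping.lookup m i"
  shows "\<exists>g'\<in>polys_in V. g = g' ^ p"
proof -
  have p0: "p > 0"
    using p(1) prime_gt_0_nat by blast
  define root where "root c = (SOME y::'k. y ^ p = c)" for c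
  have root: "root c ^ p = c" for c
    unfolding root_def using nth_root_exists[OF p0, of c] by (rule someI_ex)
  define g' where "g' = (\<Sum>m\<in>Poly_Mapping.keys g.
      Poly_Mapping.single (Poly_Mapping.map (\<lambda>j. j div p) m) (root (Poly_Mapping.lookup g m)))"
  have "Poly_Mapping.keys (Poly_Mapping.map (\<lambda>j. j div p) m) \<subseteq> Poly_Mapping.keys m"
    for m :: "'v \<Rightarrow>\<^sub>0 nat"
    by (auto simp: in_keys_iff map.rep_eq when_def split: if_splits)
  then have "g' \<in> polys_in V"
    using g unfolding g'_def polys_in_iff[of g]
    by (intro polys_in_sum polys_in_single) blast
  moreover have "g = g' ^ p"
  proof -
    have "Poly_Mapping.map (\<lambda>j. p * j) (Poly_Mapping.map (\<lambda>j. j div p) m) = m"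
      if "m \<in> Poly_Mapping.keys g" for m
      using dvd[OF that]
      by (intro poly_mapping_eqI) (simp add: map.rep_eq when_def dvd_div_eq_0_iff)
    then have "g' ^ p = (\<Sum>m\<in>Poly_Mapping.keys g. Poly_Mapping.single m (Poly_Mapping.lookup g m))"
      unfolding g'_def using p
      by (subst freshmans_dream_sum) (auto simp: CHAR_mpoly single_power root)
    then show ?thesis
      using mpoly_expand[of g] by simp
  qed
  ultimately show ?thesis by blast
qed

locale moore =
  fixes p s q n :: nat and h :: "(nat, 'k::alg_closed_field) mpoly"
  assumes p: "prime p" and s: "s \<ge> 1" and q: "q = p ^ s" and n: "n \<ge> 1" and char: "CHAR('k) = p"
  defines "h \<equiv> moore_det q n ^ (q - 1) - 1"
begin

lemma h_in: "h \<in> polys_in {..<n}"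
  unfolding h_def by (simp add: polys_in_moore_det)

lemma q_ge_2: "q \<ge> 2"
proof -
  have "p \<ge> 2" using p by (rule prime_ge_2_nat)
  also have "p \<le> p ^ s" using s p by (simp add: self_le_power prime_gt_0_nat Suc_le_eq)
  finally show ?thesis using q by simp
qed

lemma of_nat_p: "(of_nat p :: (nat, 'k) mpoly) = 0"
  by (metis CHAR_mpoly char of_nat_CHAR)

lemma of_nat_q: "(of_nat q :: 'k) = 0"
proof -
  have "p dvd q"
    unfolding q using s by (intro dvd_power) simp
  then show ?thesis
    using char of_nat_eq_0_iff_char_dvd by blast
qed

lemma euler_h: "weight_deriv (degree_weight n) h = - (h + 1)"
proof -
  obtain k where k: "q = Suc (Suc k)"
    using q_ge_2 by (metis Suc_le_D numeral_2_eq_2 Suc_le_mono)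
  have "(of_nat (Suc (Suc k)) :: (nat, 'k) mpoly) = 0"
    using of_nat_q unfolding k by (metis mpoly_of_nat mconst_eq_0_iff)
  then have k1: "(of_nat (Suc k) :: (nat, 'k) mpoly) = - 1"
    by (simp add: eq_neg_iff_add_eq_0 add.commute)
  have "weight_deriv (degree_weight n) h =
      of_nat (Suc k) * moore_det q n ^ k * weight_deriv (degree_weight n) (moore_det q n)"
    unfolding h_def
    by (simp add: weight_deriv_diff k degree_weight.weight_deriv_power del: power_Suc of_nat_Suc)
  also have "\<dots> = - (moore_det q n ^ Suc k)"
    unfolding k1 degree_weight_moore_det[OF of_nat_q n] by (simp add: mult.commute)
  finally show ?thesis
    by (simp add: h_def k)
qed

lemma h_nonzero: "h \<noteq> 0"
  using euler_h by auto

lemma pth_power_divisible: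
  assumes f: "f ^ p = h * g" "g \<in> polys_in {..<n}" and j: "1 \<le> j" "j \<le> p"
  shows "\<exists>g\<in>polys_in {..<n}. f ^ p = h ^ j * g"
  using j
proof (induction j rule: dec_induct)
  case base
  then show ?case using f by auto
next
  case (step j)
  let ?E = "weight_deriv (degree_weight n) :: (nat, 'k) mpoly \<Rightarrow> _"
  obtain g where g: "g \<in> polys_in {..<n}" "f ^ p = h ^ j * g"
    using step by auto
  obtain i where i: "j = Suc i"
    using step(1) by (cases j) auto
  have "0 = ?E (h ^ j * g)"
    using degree_weight.weight_deriv_pth_power[OF of_nat_p] p prime_gt_0_nat g(2) by metis
  also have "\<dots> = h ^ i * (h * ?E g - of_nat j * (h + 1) * g)"
    unfolding degree_weight.weight_deriv_mult i degree_weight.weight_deriv_power euler_h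
    by (simp add: algebra_simps)
  finally have "h * ?E g - of_nat j * (h + 1) * g = 0"
    using h_nonzero by simp
  then have jg: "of_nat j * g = h * (?E g - of_nat j * g)"
    by (simp add: algebra_simps)
  have "(of_nat j :: 'k) \<noteq> 0"
    using step char of_nat_eq_0_iff_char_dvd[of j, where 'a = 'k] nat_dvd_not_less[of j p] by auto
  then have "g = mconst (inverse (of_nat j)) * (of_nat j * g)"
    by (simp add: mpoly_of_nat mconst_mult mconst_1 flip: mult.assoc)
  also have "\<dots> = h * (mconst (inverse (of_nat j)) * (?E g - of_nat j * g))"
    using arg_cong[OF jg, of "(*) (mconst (inverse (of_nat j)))"] by (simp only: mult.left_commute)
  finally have "f ^ p = h ^ Suc j * (mconst (inverse (of_nat j)) * (?E g - of_nat j * g))"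
    using g(2) by (simp add: mult.assoc mult.left_commute)
  moreover have "mconst (inverse (of_nat j)) * (?E g - of_nat j * g) \<in> polys_in {..<n}"
    using g(1) by (simp add: mpoly_of_nat)
  ultimately show ?case by blast
qed

lemma pth_power_in_ideal:
  assumes f: "f ^ p = h * g" "g \<in> polys_in {..<n}"
  shows "\<exists>g\<in>polys_in {..<n}. f = h * g"
proof -
  have p0: "p > 0"
    using p prime_gt_0_nat by blast
  obtain g where g: "g \<in> polys_in {..<n}" "f ^ p = h ^ p * g"
    using pth_power_divisible[OF f, of p] p0 by auto
  have "p dvd Poly_Mapping.lookup m i" if m: "m \<in> Poly_Mapping.keys g" for m i
  proof -
    let ?D = "weight_deriv (\<lambda>m. of_nat (Poly_Mapping.lookup m i)) :: (nat, 'k) mpoly \<Rightarrow> _"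
    have "0 = ?D (h ^ p * g)"
      using exponent_weight.weight_deriv_pth_power[OF of_nat_p p0] g(2) by metis
    also have "\<dots> = h ^ p * ?D g"
      unfolding exponent_weight.weight_deriv_mult
        exponent_weight.weight_deriv_pth_power[OF of_nat_p p0]
      by simp
    finally have "?D g = 0"
      using h_nonzero by simp
    then have "of_nat (Poly_Mapping.lookup m i) * Poly_Mapping.lookup g m = 0"
      by (metis lookup_zero lookup_weight_deriv)
    then show ?thesis
      using m char of_nat_eq_0_iff_char_dvd[of "Poly_Mapping.lookup m i", where 'a = 'k]
      by (simp add: in_keys_iff)
  qed
  then obtain g' where g': "g' \<in> polys_in {..<n}" "g = g' ^ p"
    using mpoly_pth_root[OF p char g(1)] by blast
  have "(f - h * g' + h * g') ^ p = (f - h * g') ^ p + (h * g') ^ p"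
    by (rule freshmans_dream) (use p char in \<open>simp_all add: CHAR_mpoly\<close>)
  then have "f ^ p = (f - h * g') ^ p + (h * g') ^ p"
    by (simp only: diff_add_cancel)
  moreover have "f ^ p = (h * g') ^ p"
    unfolding g(2) power_mult_distrib using g'(2) by simp
  ultimately have "(f - h * g') ^ p + (h * g') ^ p = (h * g') ^ p"
    by simp
  then have "(f - h * g') ^ p = 0"
    by (simp only: add_cancel_left_left)
  then have "f = h * g'" by simp
  with g'(1) show ?thesis by blast
qed

theorem radical:
  assumes "f \<in> polys_in {..<n}" "f ^ m = h * g" "g \<in> polys_in {..<n}"
  shows "\<exists>g\<in>polys_in {..<n}. f = h * g"
proof -
  have "\<exists>g\<in>polys_in {..<n}. f = h * g"
    if "\<exists>g\<in>polys_in {..<n}. f ^ (p ^ t) = h * g" for t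
    using that
  proof (induction t)
    case (Suc t)
    then obtain g where "(f ^ (p ^ t)) ^ p = h * g" "g \<in> polys_in {..<n}"
      by (auto simp: mult.commute[of p] simp flip: power_mult)
    then show ?case
      using pth_power_in_ideal Suc.IH by blast
  qed simp
  moreover have "f ^ (p ^ m) = h * (f ^ (p ^ m - m) * g)"
  proof -
    have "m < p ^ m"
      using p prime_ge_2_nat[of p] by (intro power_gt_expt) auto
    then have "f ^ (p ^ m) = f ^ (p ^ m - m) * f ^ m"
      by (simp flip: power_add)
    then show ?thesis
      using assms(2) by simp
  qed
  moreover have "f ^ (p ^ m - m) * g \<in> polys_in {..<n}"
    using assms by simp
  ultimately show ?thesis by blast
qed

lemma vanishing_in_ideal:
  assumes f: "f \<in> polys_in {..<n}" and zero: "\<And>a. mpoly_eval a h = 0 \<Longrightarrow> mpoly_eval a f = 0"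
  shows "f \<in> Q'_ideal q n"
proof -
  have Q: "Q'_ideal q n = {g * h | g. g \<in> polys_in {..<n}}"
    unfolding Q'_ideal_def cgenideal_def h_def by simp
  have id: "ideal (Q'_ideal q n) (poly_ring {..<n} :: (nat, 'k) mpoly ring)"
    unfolding Q'_ideal_def h_def[symmetric]
    by (rule cring.cgenideal_ideal[OF cring_poly_ring h_in])
  have "h \<in> Q'_ideal q n"
    unfolding Q by (intro CollectI exI[of _ 1]) simp
  then obtain m where "f ^ m \<in> Q'_ideal q n"
    using nullstellensatz[OF id f] zero by blast
  then obtain g where "f ^ m = h * g" "g \<in> polys_in {..<n}"
    unfolding Q by (auto simp: mult.commute)
  then show ?thesis
    using radical[OF f] unfolding Q by (auto simp: mult.commute)
qed

end

section \<open>The matrices of the Deligne--Lusztig variety\<close>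

lemma carrier_GL: "carrier (GL n) = {g \<in> carrier_mat n n. det g \<noteq> (0::'k::field)}"
proof -
  have "carrier (GL n) = Units (ring_mat TYPE('k) n ())"
    by (simp add: GL_def units_of_carrier)
  moreover have "Units (ring_mat TYPE('k) n ()) \<subseteq> carrier_mat n n"
    by (auto simp: Units_def ring_mat_simps)
  ultimately show ?thesis
    by (auto dest: unit_imp_det_non_zero intro: det_non_zero_imp_unit)
qed

lemma mult_GL: "x \<otimes>\<^bsub>GL n\<^esub> y = x * y"
  by (simp add: GL_def units_of_mult ring_mat_simps)

lemma one_GL: "\<one>\<^bsub>GL n\<^esub> = 1\<^sub>m n"
  by (simp add: GL_def units_of_one ring_mat_simps)

lemma group_GL: "group (GL n :: 'k::field mat monoid)"
proof -
  interpret ring "ring_mat TYPE('k) n ()" by (rule ring_mat)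
  show ?thesis unfolding GL_def by (rule units_group)
qed

declare index_mult_mat(1) [simp del]

definition cyc :: "nat \<Rightarrow> nat \<Rightarrow> nat" where
  "cyc n j = (if j = n - 1 then 0 else j + 1)"

lemma cyc_less: "j < n \<Longrightarrow> cyc n j < n"
  by (auto simp: cyc_def)

lemma cyc_inj: "i < n \<Longrightarrow> j < n \<Longrightarrow> cyc n i = cyc n j \<longleftrightarrow> i = j"
  by (auto simp: cyc_def split: if_splits)

lemma wdot_carrier [simp]: "wdot n \<in> carrier_mat n n"
  by (simp add: wdot_def)

lemma wdot_dim [simp]: "dim_row (wdot n) = n" "dim_col (wdot n) = n"
  by (simp_all add: wdot_def)

lemma wdot_index: "i < n \<Longrightarrow> j < n \<Longrightarrow> wdot n $$ (i, j) = (if i = cyc n j then 1 else 0)"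
  by (auto simp: wdot_def cyc_def)

lemma mult_index:
  assumes "A \<in> carrier_mat n n" "B \<in> carrier_mat n n" "i < n" "j < n"
  shows "(A * B) $$ (i, j) = (\<Sum>k<n. A $$ (i, k) * B $$ (k, j))"
  using assms by (auto simp: index_mult_mat(1) scalar_prod_def lessThan_atLeast0 intro!: sum.cong)

lemma mult_wdot_index:
  assumes "A \<in> carrier_mat n n" "i < n" "j < n"
  shows "(A * wdot n) $$ (i, j) = A $$ (i, cyc n j)"
proof -
  have "(A * wdot n) $$ (i, j) = (\<Sum>k<n. A $$ (i, k) * wdot n $$ (k, j))"
    using assms by (intro mult_index) auto
  also have "\<dots> = (\<Sum>k<n. if k = cyc n j then A $$ (i, k) else 0)"
    using assms by (intro sum.cong refl) (auto simp: wdot_index)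
  finally show ?thesis
    using cyc_less[OF assms(3)] by simp
qed

lemma wdot_transpose_mult_index:
  assumes "A \<in> carrier_mat n n" "i < n" "j < n"
  shows "(transpose_mat (wdot n) * A) $$ (i, j) = A $$ (cyc n i, j)"
proof -
  have "(transpose_mat (wdot n) * A) $$ (i, j) =
      (\<Sum>k<n. transpose_mat (wdot n) $$ (i, k) * A $$ (k, j))"
    using assms by (intro mult_index) auto
  also have "\<dots> = (\<Sum>k<n. if k = cyc n i then A $$ (k, j) else 0)"
    using assms by (intro sum.cong refl) (auto simp: wdot_index)
  finally show ?thesis
    using cyc_less[OF assms(2)] by simp
qed

lemma wdot_inverse: "transpose_mat (wdot n) * wdot n = (1\<^sub>m n :: 'k::field mat)"
  "wdot n * transpose_mat (wdot n) = (1\<^sub>m n :: 'k::field mat)"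
proof -
  show "transpose_mat (wdot n) * wdot n = (1\<^sub>m n :: 'k mat)"
  proof (rule eq_matI)
    fix i j assume "i < dim_row (1\<^sub>m n :: 'k mat)" "j < dim_col (1\<^sub>m n :: 'k mat)"
    then show "(transpose_mat (wdot n) * wdot n) $$ (i, j) = (1\<^sub>m n :: 'k mat) $$ (i, j)"
      by (auto simp: wdot_transpose_mult_index[OF wdot_carrier] wdot_index cyc_less cyc_inj)
  qed (auto simp: wdot_def)
  from mat_mult_left_right_inverse[OF _ wdot_carrier this]
  show "wdot n * transpose_mat (wdot n) = (1\<^sub>m n :: 'k mat)"
    by simp
qed

lemma det_wdot: "det (wdot n :: 'k::field mat) \<noteq> 0"
proof
  assume "det (wdot n :: 'k mat) = 0"
  then have "det (transpose_mat (wdot n) * wdot n :: 'k mat) = 0"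
    using det_mult[of "transpose_mat (wdot n :: 'k mat)" n "wdot n"] by simp
  then show False
    by (simp add: wdot_inverse)
qed

lemma wdot_cancel:
  assumes "A \<in> carrier_mat n n"
  shows "transpose_mat (wdot n) * (wdot n * A) = (A :: 'k::field mat)"
    and "wdot n * (transpose_mat (wdot n) * A) = A"
proof -
  have t: "transpose_mat (wdot n :: 'k mat) \<in> carrier_mat n n" by simp
  show "transpose_mat (wdot n) * (wdot n * A) = A"
    using assoc_mult_mat[OF t wdot_carrier assms] assms by (simp add: wdot_inverse)
  show "wdot n * (transpose_mat (wdot n) * A) = A"
    using assoc_mult_mat[OF wdot_carrier t assms] assms by (simp add: wdot_inverse)
qed

lemma unipotent_upper_iff:
  "u \<in> unipotent_upper n \<longleftrightarrow> u \<in> carrier_mat n n \<and>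
    (\<forall>i<n. \<forall>j\<le>i. u $$ (i, j) = (if i = j then 1 else 0))"
  unfolding unipotent_upper_def upper_triangular_def by (auto simp: le_less)

lemma det_unipotent_upper: "u \<in> unipotent_upper n \<Longrightarrow> det u = (1 :: 'k::field)"
  unfolding unipotent_upper_def
  by (auto simp: det_upper_triangular prod_list_diag_prod)

lemma unipotent_upper_mult_index:
  assumes "A \<in> carrier_mat n n" "u \<in> unipotent_upper n" "i < n" "j < n"
  shows "(A * u) $$ (i, j) = A $$ (i, j) + (\<Sum>k<j. A $$ (i, k) * u $$ (k, j))"
proof -
  have "(A * u) $$ (i, j) = (\<Sum>k<n. A $$ (i, k) * u $$ (k, j))"
    using assms by (intro mult_index) (auto simp: unipotent_upper_iff)
  also have "\<dots> = (\<Sum>k<Suc j. A $$ (i, k) * u $$ (k, j))"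
    using assms by (intro sum.mono_neutral_right) (auto simp: unipotent_upper_iff)
  finally show ?thesis
    using assms by (simp add: unipotent_upper_iff)
qed

lemma unipotent_upper_mult:
  assumes u: "u \<in> unipotent_upper n" and v: "v \<in> unipotent_upper n"
  shows "u * v \<in> unipotent_upper n"
proof -
  have c: "u \<in> carrier_mat n n" "v \<in> carrier_mat n n"
    using u v by (auto simp: unipotent_upper_iff)
  have "(u * v) $$ (i, j) = (if i = j then 1 else 0)" if "i < n" "j \<le> i" for i j
  proof -
    have "(\<Sum>k<j. u $$ (i, k) * v $$ (k, j)) = 0"
      using u that by (intro sum.neutral) (auto simp: unipotent_upper_iff)
    then show ?thesis
      using u that by (simp add: unipotent_upper_mult_index[OF c(1) v] unipotent_upper_iff)
  qed
  then show ?thesis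
    using c by (auto simp: unipotent_upper_iff)
qed

lemma unipotent_upper_left_inverse:
  assumes u: "u \<in> unipotent_upper n" and w: "w \<in> carrier_mat n n" "w * u = 1\<^sub>m n"
  shows "w \<in> unipotent_upper n"
proof -
  have "w $$ (i, j) = (if i = j then 1 else 0)" if "i < n" "j \<le> i" for i j
    using that
  proof (induction j rule: less_induct)
    case (less j)
    have "(\<Sum>k<j. w $$ (i, k) * u $$ (k, j)) = 0"
      using less by (intro sum.neutral) auto
    then have "(w * u) $$ (i, j) = w $$ (i, j)"
      using less.prems by (simp add: unipotent_upper_mult_index[OF w(1) u])
    then show ?case
      using less.prems w(2) by simp
  qed
  then show ?thesis
    using w(1) by (auto simp: unipotent_upper_iff)
qed

definition stabilizer :: "nat \<Rightarrow> 'k::field mat set" where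
  "stabilizer n = {v \<in> unipotent_upper n. \<forall>j<n. 0 < j \<longrightarrow> v $$ (0, j) = 0}"

lemma unipotent_upper_subset_GL: "unipotent_upper n \<subseteq> carrier (GL n)"
proof
  fix u :: "'k::field mat" assume u: "u \<in> unipotent_upper n"
  then show "u \<in> carrier (GL n)"
    using det_unipotent_upper[OF u] by (simp add: carrier_GL unipotent_upper_iff)
qed

lemma inv_wdot: "inv\<^bsub>GL n\<^esub> (wdot n) = transpose_mat (wdot n :: 'k::field mat)"
proof -
  interpret group "GL n :: 'k mat monoid" by (rule group_GL)
  have "det (transpose_mat (wdot n :: 'k mat)) \<noteq> 0"
    unfolding det_transpose[OF wdot_carrier] by (rule det_wdot)
  show ?thesis
  proof (intro inv_equality)
    show "transpose_mat (wdot n) \<otimes>\<^bsub>GL n\<^esub> wdot n = \<one>\<^bsub>GL n :: 'k mat monoid\<^esub>"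
      unfolding mult_GL one_GL by (rule wdot_inverse(1))
    show "wdot n \<in> carrier (GL n :: 'k mat monoid)"
      unfolding carrier_GL using det_wdot[of n] by simp
    show "transpose_mat (wdot n) \<in> carrier (GL n :: 'k mat monoid)"
      unfolding carrier_GL using \<open>det (transpose_mat (wdot n :: 'k mat)) \<noteq> 0\<close> by simp
  qed
qed

lemma stabilizer_eq:
  "unipotent_upper n \<inter> ad_unipotent_upper n = (stabilizer n :: 'k::field mat set)"
proof (intro equalityI subsetI)
  let ?w = "wdot n :: 'k mat"
  let ?t = "transpose_mat ?w"
  have t: "?t \<in> carrier_mat n n" by simp
  fix v :: "'k mat" assume "v \<in> unipotent_upper n \<inter> ad_unipotent_upper n"
  then obtain u where v: "v \<in> unipotent_upper n" "v = ?w * u * ?t" and u: "u \<in> unipotent_upper n"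
    unfolding ad_unipotent_upper_def by (auto simp: mult_GL inv_wdot)
  have c: "u \<in> carrier_mat n n" "v \<in> carrier_mat n n"
    using u v by (auto simp: unipotent_upper_iff)
  have ut: "u * ?t \<in> carrier_mat n n"
    using c t by simp
  have "v = ?w * (u * ?t)"
    unfolding v(2) by (rule assoc_mult_mat[OF wdot_carrier c(1) t])
  then have "?t * v * ?w = u * ?t * ?w"
    using wdot_cancel(1)[OF ut] by simp
  also have "\<dots> = u"
    using assoc_mult_mat[OF c(1) t wdot_carrier] c(1) by (simp add: wdot_inverse)
  finally have "u $$ (i, j) = v $$ (cyc n i, cyc n j)" if "i < n" "j < n" for i j
    using that c mult_carrier_mat[OF t c(2)] mult_wdot_index[of "?t * v" n i j]
      wdot_transpose_mult_index[of v n i "cyc n j"]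
    by (simp add: cyc_less)
  note ind = this
  have "v $$ (0, j) = 0" if "j < n" "0 < j" for j
  proof -
    have "u $$ (n - 1, j - 1) = 0"
      using u that unfolding unipotent_upper_iff by auto
    moreover have "cyc n (n - 1) = 0" "cyc n (j - 1) = j"
      using that by (auto simp: cyc_def)
    ultimately show ?thesis
      using ind[of "n - 1" "j - 1"] that by simp
  qed
  then show "v \<in> stabilizer n"
    using v(1) unfolding stabilizer_def by blast
next
  let ?w = "wdot n :: 'k mat"
  let ?t = "transpose_mat ?w"
  have t: "?t \<in> carrier_mat n n" by simp
  fix v :: "'k mat" assume v: "v \<in> stabilizer n"
  then have vu: "v \<in> unipotent_upper n" and c: "v \<in> carrier_mat n n"
    by (auto simp: stabilizer_def unipotent_upper_iff)
  define u where "u = ?t * v * ?w"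
  have cu: "u \<in> carrier_mat n n"
    unfolding u_def using c t by (intro mult_carrier_mat[of _ n n _ n]) auto
  have ind: "u $$ (i, j) = v $$ (cyc n i, cyc n j)" if "i < n" "j < n" for i j
    unfolding u_def
    using that c mult_carrier_mat[OF t c] mult_wdot_index[of "?t * v" n i j]
      wdot_transpose_mult_index[of v n i "cyc n j"]
    by (simp add: cyc_less)
  have "u \<in> unipotent_upper n"
    unfolding unipotent_upper_iff
  proof (intro conjI allI impI)
    fix i j assume ij: "i < n" "j \<le> i"
    show "u $$ (i, j) = (if i = j then 1 else 0)"
    proof (cases "i = j")
      case True
      then show ?thesis
        using ij vu cyc_less[OF ij(1)] by (simp add: ind unipotent_upper_iff)
    next
      case False
      then have j: "j < n - 1" "cyc n j = j + 1"
        using ij by (auto simp: cyc_def)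
      have "v $$ (cyc n i, j + 1) = 0"
        using False ij v vu j unfolding cyc_def stabilizer_def
        by (auto simp: unipotent_upper_iff)
      then show ?thesis
        using False ij j by (simp add: ind)
    qed
  qed (rule cu)
  moreover have "v = ?w * u * ?t"
  proof -
    have vw: "v * ?w \<in> carrier_mat n n"
      using c by simp
    have "u = ?t * (v * ?w)"
      unfolding u_def by (rule assoc_mult_mat[OF t c wdot_carrier])
    then have "?w * u * ?t = v * ?w * ?t"
      using wdot_cancel(2)[OF vw] by simp
    also have "\<dots> = v"
      using assoc_mult_mat[OF c wdot_carrier t] c by (simp add: wdot_inverse)
    finally show ?thesis by simp
  qed
  ultimately show "v \<in> unipotent_upper n \<inter> ad_unipotent_upper n"
    using vu unfolding ad_unipotent_upper_def by (auto simp: mult_GL inv_wdot)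
qed

lemma stabilizer_row:
  assumes "v \<in> stabilizer n" "j < n"
  shows "v $$ (0, j) = (if j = 0 then 1 else 0)"
  using assms by (auto simp: stabilizer_def unipotent_upper_iff)

lemma row_mult_index:
  fixes u v :: "'k::field mat"
  assumes "u \<in> carrier_mat n n" "v \<in> carrier_mat n n" "j < n"
    and row: "\<And>k. k < n \<Longrightarrow> u $$ (0, k) = (if k = 0 then 1 else 0)"
  shows "(u * v) $$ (0, j) = v $$ (0, j)"
proof -
  have "(u * v) $$ (0, j) = (\<Sum>k<n. u $$ (0, k) * v $$ (k, j))"
    using assms by (intro mult_index) auto
  also have "\<dots> = (\<Sum>k<n. if k = 0 then v $$ (k, j) else 0)"
    using row by (intro sum.cong refl) auto
  finally show ?thesis
    using assms(3) by simp
qed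

lemma subgroup_stabilizer: "subgroup (stabilizer n) (GL n :: 'k::field mat monoid)"
proof -
  interpret group "GL n :: 'k mat monoid" by (rule group_GL)
  have carrier: "v \<in> carrier_mat n n" "v \<in> unipotent_upper n" "v \<in> carrier (GL n)"
    if "v \<in> stabilizer n" for v :: "'k mat"
    using that unipotent_upper_subset_GL[of n] by (auto simp: stabilizer_def unipotent_upper_iff)
  show ?thesis
  proof (rule subgroupI)
    show "stabilizer n \<subseteq> carrier (GL n :: 'k mat monoid)"
      using carrier by blast
    have "1\<^sub>m n \<in> (stabilizer n :: 'k mat set)"
      by (auto simp: stabilizer_def unipotent_upper_iff)
    then show "stabilizer n \<noteq> ({} :: 'k mat set)" by blast
    fix u v :: "'k mat" assume u: "u \<in> stabilizer n" 
    let ?w = "inv\<^bsub>GL n\<^esub> u"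
    have w: "?w \<in> carrier_mat n n" "?w * u = 1\<^sub>m n" "u * ?w = 1\<^sub>m n"
      using l_inv[OF carrier(3)[OF u]] r_inv[OF carrier(3)[OF u]] inv_closed[OF carrier(3)[OF u]]
      by (auto simp: mult_GL one_GL carrier_GL)
    have "?w $$ (0, j) = 0" if "j < n" "0 < j" for j
      using row_mult_index[OF carrier(1)[OF u] w(1) that(1)] stabilizer_row[OF u] w(3) that by simp
    then show "?w \<in> stabilizer n"
      using unipotent_upper_left_inverse[OF carrier(2)[OF u] w(1,2)]
      unfolding stabilizer_def by blast
    assume v: "v \<in> stabilizer n"
    have "(u * v) $$ (0, j) = 0" if "j < n" "0 < j" for j
      using row_mult_index[OF carrier(1)[OF u] carrier(1)[OF v] that(1)] stabilizer_row[OF u]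
        stabilizer_row[OF v] that by simp
    then show "u \<otimes>\<^bsub>GL n\<^esub> v \<in> stabilizer n"
      unfolding mult_GL using unipotent_upper_mult[OF carrier(2)[OF u] carrier(2)[OF v]]
      unfolding stabilizer_def by blast
  qed
qed

lemma mult_unipotent_first_column:
  assumes "A \<in> carrier_mat n n" "u \<in> unipotent_upper n" "i < n"
  shows "(A * u) $$ (i, 0) = A $$ (i, 0)"
  using assms unipotent_upper_mult_index[OF assms(1,2), of i 0] by simp

context moore
begin

abbreviation frob :: "'k \<Rightarrow> 'k" where "frob \<equiv> \<lambda>a. a ^ q"

lemma frob_add: "(a + b :: 'k) ^ q = a ^ q + b ^ q"
  by (rule freshmans_dream') (use p char q in auto)

lemma frob_hom: "comm_ring_hom frob"
  by unfold_locales (use frob_add q_ge_2 in \<open>auto simp: power_mult_distrib\<close>)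

lemma frob_sum: "(\<Sum>i\<in>I. f i :: 'k) ^ q = (\<Sum>i\<in>I. f i ^ q)"
  by (rule freshmans_dream_sum') (use p char q in auto)

lemma det_Frob: "det (Frob q g) = det (g :: 'k mat) ^ q"
  unfolding Frob_def using comm_ring_hom.hom_det[OF frob_hom] .

lemma Frob_carrier [simp]: "(g :: 'k mat) \<in> carrier_mat n n \<Longrightarrow> Frob q g \<in> carrier_mat n n"
  by (simp add: Frob_def)

lemma Frob_index:
  "(g :: 'k mat) \<in> carrier_mat n n \<Longrightarrow> i < n \<Longrightarrow> j < n \<Longrightarrow> Frob q g $$ (i, j) = g $$ (i, j) ^ q"
  by (simp add: Frob_def)

lemma DL_cover_iff:
  "g \<in> DL_cover q n \<longleftrightarrow> (g :: 'k mat) \<in> carrier_mat n n \<and> det g \<noteq> 0 \<and>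
    (\<exists>u\<in>unipotent_upper n. Frob q g = g * wdot n * u)"
proof -
  interpret group "GL n :: 'k mat monoid" by (rule group_GL)
  have "inv\<^bsub>GL n\<^esub> g \<otimes>\<^bsub>GL n\<^esub> Frob q g = wdot n \<otimes>\<^bsub>GL n\<^esub> u \<longleftrightarrow> Frob q g = g * wdot n * u"
    if g: "g \<in> carrier (GL n)" and u: "u \<in> unipotent_upper n" for u
  proof -
    have car: "Frob q g \<in> carrier (GL n)"
        "wdot n \<in> carrier (GL n :: 'k mat monoid)" "u \<in> carrier (GL n)"
      using g u unipotent_upper_subset_GL[of n] det_wdot by (auto simp: carrier_GL det_Frob)
    have "inv\<^bsub>GL n\<^esub> g \<otimes>\<^bsub>GL n\<^esub> Frob q g = wdot n \<otimes>\<^bsub>GL n\<^esub> u \<longleftrightarrow>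
        Frob q g = g \<otimes>\<^bsub>GL n\<^esub> (wdot n \<otimes>\<^bsub>GL n\<^esub> u)"
      using inv_solve_left'[of "wdot n \<otimes>\<^bsub>GL n\<^esub> u" g "Frob q g"] g car by (metis m_closed)
    then show ?thesis
      using g car by (simp add: m_assoc[symmetric]) (simp add: mult_GL)
  qed
  then show ?thesis
    unfolding DL_cover_def l_coset_def by (auto simp: carrier_GL)
qed

definition moore_mat :: "(nat \<Rightarrow> 'k) \<Rightarrow> 'k mat" where
  "moore_mat x = mat n n (\<lambda>(i, j). x i ^ (q ^ j))"

lemma moore_mat_carrier [simp]: "moore_mat x \<in> carrier_mat n n"
  by (simp add: moore_mat_def)

lemma moore_mat_index: "i < n \<Longrightarrow> j < n \<Longrightarrow> moore_mat x $$ (i, j) = x i ^ (q ^ j)"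
  by (simp add: moore_mat_def)

lemma eval_moore_det: "mpoly_eval x (moore_det q n) = det (moore_mat x)"
proof -
  have "moore_mat x = map_mat (mpoly_eval x) (mat n n (\<lambda>(i, j). mvar i ^ (q ^ j)))"
    by (rule eq_matI) (auto simp: moore_mat_def)
  then show ?thesis
    unfolding moore_det_def using comm_ring_hom.hom_det[OF comm_ring_hom_mpoly_eval] by metis
qed

lemma column_recursion:
  fixes g :: "'k mat"
  assumes g: "g \<in> carrier_mat n n" and u: "u \<in> unipotent_upper n"
    and eq: "Frob q g = g * wdot n * u"
    and r: "r < n" and j: "Suc j < n"
  shows "g $$ (r, Suc j) = g $$ (r, j) ^ q - (\<Sum>i<j. g $$ (r, Suc i) * u $$ (i, j))"
proof -
  have "g $$ (r, j) ^ q = (g * wdot n * u) $$ (r, j)"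
    using Frob_index[OF g r, of j] j eq by simp
  also have "\<dots> = (g * wdot n) $$ (r, j) + (\<Sum>i<j. (g * wdot n) $$ (r, i) * u $$ (i, j))"
    using g r j by (intro unipotent_upper_mult_index[OF _ u]) auto
  also have "\<dots> = g $$ (r, Suc j) + (\<Sum>i<j. g $$ (r, Suc i) * u $$ (i, j))"
    using g r j by (auto simp: mult_wdot_index cyc_def intro!: sum.cong)
  finally show ?thesis by simp
qed

text \<open>By \<open>column_recursion\<close>, column \<open>j\<close> of \<open>g\<close> is \<open>F\<^sup>j(x)\<close> plus a combination of \<open>F(x), \<dots>, F\<^bsup>j-1\<^esup>(x)\<close>,
  where \<open>x\<close> is the first column.\<close>

lemma DL_cover_factor:
  fixes g :: "'k mat"
  assumes g: "g \<in> DL_cover q n"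
  shows "\<exists>v\<in>stabilizer n. g = moore_mat (\<lambda>i. g $$ (i, 0)) * v"
proof -
  define x where "x i = g $$ (i, 0)" for i
  obtain u where gc: "g \<in> carrier_mat n n"
    and u: "u \<in> unipotent_upper n" "Frob q g = g * wdot n * u"
    using g unfolding DL_cover_iff by blast
  define good where "good j c \<longleftrightarrow> c j = 1 \<and> (\<forall>i>j. c i = 0) \<and> (0 < j \<longrightarrow> c 0 = 0) \<and>
      (\<forall>r<n. g $$ (r, j) = (\<Sum>i<n. x r ^ (q ^ i) * c i))" for j and c :: "nat \<Rightarrow> 'k"
  have "\<exists>c. good j c" if "j < n" for j
    using that
  proof (induction j rule: less_induct)
    case (less j)
    show ?case
    proof (cases j)
      case 0
      have "(\<Sum>i<n. x r ^ q ^ i * (if i = 0 then 1 else 0)) = x r" for r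
        using n by (subst sum.remove[of _ 0]) (auto intro!: sum.neutral)
      then have "good 0 (\<lambda>i. if i = 0 then 1 else 0)"
        unfolding good_def by (simp add: x_def)
      with 0 show ?thesis by blast
    next
      case (Suc m)
      have "\<forall>i\<in>{..m}. \<exists>c. good i c"
        using less Suc by auto
      then obtain C where C: "\<And>i. i \<le> m \<Longrightarrow> good i (C i)"
        by (metis atMost_iff)
      define c where "c k = (if k = 0 then 0 else C m (k - 1) ^ q) -
          (\<Sum>i<m. C (Suc i) k * u $$ (i, m))" for k
      obtain N where N: "n = Suc N"
        using n by (cases n) auto
      have CN: "C m N = 0"
        using C[of m] less.prems Suc N unfolding good_def by auto
      have "(\<Sum>i<m. C (Suc i) k * u $$ (i, m)) = 0" if "k > m \<or> k = 0" for k
        using that C unfolding good_def by (intro sum.neutral) (auto simp: Suc_le_eq)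
      then have "c j = 1" "\<forall>i>j. c i = 0" "c 0 = 0"
        using C[of m] q_ge_2 unfolding Suc c_def good_def by auto
      moreover have "g $$ (r, j) = (\<Sum>k<n. x r ^ (q ^ k) * c k)" if r: "r < n" for r
      proof -
        have gC: "g $$ (r, i) = (\<Sum>k<n. x r ^ (q ^ k) * C i k)" if "i \<le> m" for i
          using C[OF that] r unfolding good_def by blast
        have "g $$ (r, m) ^ q = (\<Sum>k<n. (x r ^ (q ^ k) * C m k) ^ q)"
          unfolding gC[OF order_refl] frob_sum ..
        also have "\<dots> = (\<Sum>k<N. x r ^ (q ^ Suc k) * C m k ^ q)"
          unfolding N using CN q_ge_2
          by (simp add: power_mult_distrib mult.commute flip: power_mult)
        also have "\<dots> = (\<Sum>k<n. x r ^ (q ^ k) * (if k = 0 then 0 else C m (k - 1) ^ q))"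
          unfolding N sum.lessThan_Suc_shift by simp
        finally have a: "g $$ (r, m) ^ q = \<dots>" .
        have "(\<Sum>i<m. g $$ (r, Suc i) * u $$ (i, m)) =
            (\<Sum>i<m. \<Sum>k<n. x r ^ (q ^ k) * (C (Suc i) k * u $$ (i, m)))"
          by (intro sum.cong refl) (simp add: gC sum_distrib_right mult.assoc)
        also have "\<dots> = (\<Sum>k<n. x r ^ (q ^ k) * (\<Sum>i<m. C (Suc i) k * u $$ (i, m)))"
          by (subst sum.swap) (simp add: sum_distrib_left)
        finally have b: "(\<Sum>i<m. g $$ (r, Suc i) * u $$ (i, m)) = \<dots>" .
        show ?thesis
          using column_recursion[OF gc u r, of m] less.prems
          unfolding Suc a b c_def by (simp add: right_diff_distrib sum_subtractf)
      qed
      ultimately show ?thesis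
        unfolding good_def by blast
    qed
  qed
  then obtain C where C: "\<And>j. j < n \<Longrightarrow> good j (C j)"
    by metis
  define v where "v = mat n n (\<lambda>(i, j). C j i)"
  have vc: "v \<in> carrier_mat n n"
    by (simp add: v_def)
  have "v \<in> unipotent_upper n"
    using C unfolding unipotent_upper_iff good_def v_def by auto
  then have "v \<in> stabilizer n"
    using C unfolding stabilizer_def good_def v_def by auto
  moreover have "g = moore_mat x * v"
  proof (rule eq_matI)
    fix i j assume "i < dim_row (moore_mat x * v)" "j < dim_col (moore_mat x * v)"
    then have ij: "i < n" "j < n"
      using vc by (auto simp: moore_mat_def)
    then have "(moore_mat x * v) $$ (i, j) = (\<Sum>k<n. x i ^ (q ^ k) * C j k)"
      by (subst mult_index[OF moore_mat_carrier vc])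
         (auto simp: moore_mat_index v_def intro!: sum.cong)
    then show "g $$ (i, j) = (moore_mat x * v) $$ (i, j)"
      using C[OF ij(2)] ij unfolding good_def by simp
  qed (use gc vc in \<open>auto simp: moore_mat_def\<close>)
  ultimately show ?thesis
    unfolding x_def by blast
qed

lemma DL_cover_det:
  fixes g :: "'k mat"
  assumes g: "g \<in> DL_cover q n"
  shows "det (moore_mat (\<lambda>i. g $$ (i, 0))) ^ (q - 1) = det (wdot n)"
proof -
  obtain u where gc: "g \<in> carrier_mat n n" "det g \<noteq> 0"
    and u: "u \<in> unipotent_upper n" "Frob q g = g * wdot n * u"
    using g unfolding DL_cover_iff by blast
  have uc: "u \<in> carrier_mat n n"
    using u by (simp add: unipotent_upper_iff)
  obtain v where v: "v \<in> stabilizer n" "g = moore_mat (\<lambda>i. g $$ (i, 0)) * v"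
    using DL_cover_factor[OF g] by blast
  have "v \<in> unipotent_upper n"
    using v(1) by (simp add: stabilizer_def)
  then have "det g = det (moore_mat (\<lambda>i. g $$ (i, 0)))"
    using arg_cong[OF v(2), of det] det_mult[OF moore_mat_carrier, of v] det_unipotent_upper[of v n]
    by (auto simp: unipotent_upper_iff)
  moreover have "det g ^ q = det g * det (wdot n)"
    using arg_cong[OF u(2), of det] gc uc
    by (simp add: det_Frob det_mult[of _ n] det_unipotent_upper[OF u(1)])
  moreover have "det g ^ q = det g * det g ^ (q - 1)"
    using q_ge_2 by (metis Suc_diff_1 less_le_trans pos2 power_Suc)
  ultimately show ?thesis
    using gc(2) by simp
qed

text \<open>All columns of \<open>u\<close> but the last are columns of the identity matrix, and the condition on \<open>x\<close>
  says that \<open>det u = 1\<close>, which is the last diagonal entry.\<close>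

lemma moore_mat_in_DL_cover:
  assumes det: "det (moore_mat x) ^ (q - 1) = det (wdot n)"
  shows "moore_mat x \<in> DL_cover q n"
proof -
  let ?M = "moore_mat x" and ?w = "wdot n :: 'k mat"
  interpret group "GL n :: 'k mat monoid" by (rule group_GL)
  have d0: "det ?M \<noteq> 0"
    using det det_wdot[of n, where 'k = 'k] q_ge_2 by (auto simp: zero_power)
  let ?N = "?M * ?w"
  have "?N \<in> carrier (GL n)"
    using d0 det_wdot[of n, where 'k = 'k] mult_carrier_mat[OF moore_mat_carrier wdot_carrier]
    by (simp add: carrier_GL det_mult[of _ n])
  then obtain D where D: "D \<in> carrier_mat n n" "D * ?N = 1\<^sub>m n" "?N * D = 1\<^sub>m n"
    using l_inv[of ?N] r_inv[of ?N] inv_closed[of ?N] by (auto simp: mult_GL one_GL carrier_GL)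
  define u where "u = D * Frob q ?M"
  have uc: "u \<in> carrier_mat n n"
    using D(1) by (simp add: u_def)
  have "?N * u = (?N * D) * Frob q ?M"
    unfolding u_def using D(1)
    by (intro assoc_mult_mat[of _ n n _ n _ n, symmetric] mult_carrier_mat[of _ n n _ n]) auto
  then have eq: "Frob q ?M = ?N * u"
    using D(3) left_mult_one_mat[OF Frob_carrier[OF moore_mat_carrier]] by simp
  have col: "u $$ (i, j) = (if i = j then 1 else 0)" if "i < n" "j < n - 1" for i j
  proof -
    have "u $$ (i, j) = (\<Sum>k<n. D $$ (i, k) * Frob q ?M $$ (k, j))"
      unfolding u_def using that D(1) by (intro mult_index) auto
    also have "\<dots> = (\<Sum>k<n. D $$ (i, k) * ?N $$ (k, j))"
    proof (intro sum.cong refl)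
      fix k assume "k \<in> {..<n}"
      then have "Frob q ?M $$ (k, j) = ?N $$ (k, j)"
        using that
        by (simp add: Frob_index moore_mat_index mult_wdot_index cyc_less)
           (simp add: moore_mat_index cyc_def mult.commute flip: power_mult)
      then show "D $$ (i, k) * Frob q ?M $$ (k, j) = D $$ (i, k) * ?N $$ (k, j)" by simp
    qed
    also have "\<dots> = (D * ?N) $$ (i, j)"
      using that D(1) by (intro mult_index[symmetric] mult_carrier_mat[of _ n n _ n]) auto
    finally show ?thesis
      using that by (simp add: D(2))
  qed
  have ut: "upper_triangular u"
    using uc col unfolding upper_triangular_def by auto
  have "det ?M ^ q = det ?M * det ?w * det u"
    using arg_cong[OF eq, of det] det_mult[OF moore_mat_carrier wdot_carrier, of x]
      det_mult[OF mult_carrier_mat[OF moore_mat_carrier wdot_carrier] uc, of x]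
    by (simp add: det_Frob)
  moreover have "det ?M ^ q = det ?M * det ?M ^ (q - 1)"
    using q_ge_2 by (metis Suc_diff_1 less_le_trans pos2 power_Suc)
  ultimately have du: "det u = 1"
    using d0 det det_wdot[of n, where 'k = 'k] by simp
  obtain N where N: "n = Suc N"
    using n by (cases n) auto
  have "det u = (\<Prod>i = 0..<n. u $$ (i, i))"
    using det_upper_triangular[OF ut uc] uc by (simp add: prod_list_diag_prod)
  also have "\<dots> = u $$ (N, N)"
    unfolding N using col by (simp add: N)
  finally have "u $$ (i, i) = 1" if "i < n" for i
    using that col[of i i] du N by (cases "i = N") auto
  then have "u \<in> unipotent_upper n"
    using uc ut by (simp add: unipotent_upper_def)
  with eq d0 show ?thesis
    unfolding DL_cover_iff by auto
qed

lemma det_moore_mat_scale: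
  "det (moore_mat (\<lambda>i. c * x i)) = c ^ (\<Sum>j<n. q ^ j) * det (moore_mat x)"
proof -
  have "(\<Prod>i = 0..<n. moore_mat (\<lambda>i. c * x i) $$ (i, \<pi> i)) =
      c ^ (\<Sum>j<n. q ^ j) * (\<Prod>i = 0..<n. moore_mat x $$ (i, \<pi> i))" if \<pi>: "\<pi> permutes {0..<n}" for \<pi>
  proof -
    have lt: "\<pi> i < n" if "i < n" for i
      using permutes_in_image[OF \<pi>, of i] that by simp
    have "(\<Sum>i = 0..<n. q ^ \<pi> i) = (\<Sum>j<n. q ^ j)"
      using sum.permute[OF \<pi>, of "\<lambda>j. q ^ j"] by (simp add: comp_def lessThan_atLeast0)
    then have "(\<Prod>i = 0..<n. c ^ (q ^ \<pi> i)) = c ^ (\<Sum>j<n. q ^ j)"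
      by (simp add: power_sum[symmetric])
    then show ?thesis
      by (simp add: moore_mat_index lt power_mult_distrib prod.distrib)
  qed
  then show ?thesis
    by (simp add: det_def'[OF moore_mat_carrier] sum_distrib_left mult.left_commute)
qed

end

section \<open>Coordinates on the Deligne--Lusztig variety\<close>

lemma openin_mat_zariski:
  "openin (mat_zariski n X) U \<longleftrightarrow> (\<exists>S\<subseteq>polys_in ({..<n} \<times> {..<n}).
     U = {g \<in> X. \<not> (\<forall>f\<in>S. mpoly_eval (($$) g) f = (0::'k::field))})"
proof -
  define opn where "opn U \<longleftrightarrow> (\<exists>S\<subseteq>polys_in ({..<n} \<times> {..<n}).
     U = {g \<in> X. \<not> (\<forall>f\<in>S. mpoly_eval (($$) g) f = (0::'k))})" for U
  have "opn (U \<inter> W)" if U: "opn U" and W: "opn W" for U W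
  proof -
    obtain S where S: "S \<subseteq> polys_in ({..<n} \<times> {..<n})"
        "U = {g \<in> X. \<not> (\<forall>f\<in>S. mpoly_eval (($$) g) f = 0)}"
      using U unfolding opn_def by auto
    obtain T where T: "T \<subseteq> polys_in ({..<n} \<times> {..<n})"
        "W = {g \<in> X. \<not> (\<forall>f\<in>T. mpoly_eval (($$) g) f = 0)}"
      using W unfolding opn_def by auto
    define R where "R = {f * g | f g. f \<in> S \<and> g \<in> T}"
    have "R \<subseteq> polys_in ({..<n} \<times> {..<n})"
      using S(1) T(1) unfolding R_def by (auto intro!: polys_in_mult)
    moreover have "U \<inter> W = {g \<in> X. \<not> (\<forall>f\<in>R. mpoly_eval (($$) g) f = 0)}"
    proof (rule Set.set_eqI)
      fix g
      have "(\<forall>f\<in>R. mpoly_eval (($$) g) f = 0) \<longleftrightarrow>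
          (\<forall>f\<in>S. mpoly_eval (($$) g) f = 0) \<or> (\<forall>f\<in>T. mpoly_eval (($$) g) f = 0)"
        unfolding R_def by force
      then show "g \<in> U \<inter> W \<longleftrightarrow> g \<in> {g \<in> X. \<not> (\<forall>f\<in>R. mpoly_eval (($$) g) f = 0)}"
        unfolding S(2) T(2) by blast
    qed
    ultimately show ?thesis
      unfolding opn_def by blast
  qed
  moreover have "opn (\<Union>K)" if K: "\<forall>U\<in>K. opn U" for K
  proof -
    have "\<exists>S. \<forall>U\<in>K. S U \<subseteq> polys_in ({..<n} \<times> {..<n}) \<and>
        U = {g \<in> X. \<not> (\<forall>f\<in>S U. mpoly_eval (($$) g) f = 0)}"
      using K unfolding opn_def by (rule bchoice)
    then obtain S where "\<forall>U\<in>K. S U \<subseteq> polys_in ({..<n} \<times> {..<n}) \<and>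
        U = {g \<in> X. \<not> (\<forall>f\<in>S U. mpoly_eval (($$) g) f = 0)}" ..
    note S = bspec[OF this, THEN conjunct1] bspec[OF this, THEN conjunct2]
    have "g \<in> \<Union>K \<longleftrightarrow> g \<in> {g \<in> X. \<not> (\<forall>f\<in>\<Union>(S ` K). mpoly_eval (($$) g) f = 0)}" for g
    proof -
      have "g \<in> U \<longleftrightarrow> g \<in> X \<and> \<not> (\<forall>f\<in>S U. mpoly_eval (($$) g) f = 0)" if "U \<in> K" for U
        using S(2)[OF that] by blast
      then show ?thesis by auto
    qed
    then have "\<Union>K = {g \<in> X. \<not> (\<forall>f\<in>\<Union>(S ` K). mpoly_eval (($$) g) f = 0)}"
      by blast
    moreover have "\<Union>(S ` K) \<subseteq> polys_in ({..<n} \<times> {..<n})"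
      using S(1) by blast
    ultimately show ?thesis
      unfolding opn_def by (intro exI conjI)
  qed
  ultimately have "istopology opn"
    unfolding istopology_def by blast
  then show ?thesis
    unfolding mat_zariski_def opn_def[abs_def] by simp
qed

lemma topspace_mat_zariski: "topspace (mat_zariski n X) = (X :: 'k::field mat set)"
proof (rule antisym)
  show "topspace (mat_zariski n X) \<subseteq> X"
    using openin_topspace[of "mat_zariski n X"] unfolding openin_mat_zariski by blast
  have "openin (mat_zariski n X) X"
    unfolding openin_mat_zariski by (rule exI[of _ "{1}"]) simp
  then show "X \<subseteq> topspace (mat_zariski n X)"
    by (rule openin_subset)
qed

context moore
begin

abbreviation X :: "'k mat set" where "X \<equiv> DL_cover q n"

definition orbit :: "'k mat \<Rightarrow> 'k mat set" where
  "orbit g = g <#\<^bsub>GL n\<^esub> (unipotent_upper n \<inter> ad_unipotent_upper n)"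

definition points :: "'k mat set set" where "points = orbit ` X"

lemma orbit_iff: "g' \<in> orbit g \<longleftrightarrow> (\<exists>v\<in>stabilizer n. g' = g * v)"
  unfolding orbit_def l_coset_def by (auto simp: mult_GL stabilizer_eq)

text \<open>The determinant of \<open>wdot n\<close> is \<open>(-1)\<^bsup>n-1\<^esup>\<close>, so first columns of elements of \<open>X\<close> satisfy
  \<open>e\<^sub>n\<^bsup>q-1\<^esup> = (-1)\<^bsup>n-1\<^esup>\<close>. Scaling them by \<open>\<mu>\<close> gives the equation \<open>e\<^sub>n\<^bsup>q-1\<^esup> = 1\<close>.\<close>

definition \<mu> :: 'k where
  "\<mu> = (SOME m. m ^ ((\<Sum>j<n. q ^ j) * (q - 1)) = inverse (det (wdot n)))"

lemma \<mu>_power: "\<mu> ^ ((\<Sum>j<n. q ^ j) * (q - 1)) * det (wdot n) = 1"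
proof -
  have "q ^ 0 \<le> (\<Sum>j<n. q ^ j)"
    using n by (intro member_le_sum) auto
  then have "(\<Sum>j<n. q ^ j) * (q - 1) > 0"
    using q_ge_2 by simp
  then have "\<mu> ^ ((\<Sum>j<n. q ^ j) * (q - 1)) = inverse (det (wdot n))"
    unfolding \<mu>_def by (intro someI_ex[OF nth_root_exists])
  then show ?thesis
    using det_wdot[of n, where 'k = 'k] by simp
qed

lemma \<mu>_nonzero: "\<mu> \<noteq> 0"
proof
  assume "\<mu> = 0"
  moreover have "q ^ 0 \<le> (\<Sum>j<n. q ^ j)"
    using n by (intro member_le_sum) auto
  ultimately show False
    using \<mu>_power q_ge_2 by (simp add: zero_power)
qed

lemma det_moore_mat_iff:
  "det (moore_mat x) ^ (q - 1) = det (wdot n) \<longleftrightarrow> mpoly_eval (\<lambda>i. \<mu> * x i) h = 0"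
proof -
  let ?c = "\<mu> ^ ((\<Sum>j<n. q ^ j) * (q - 1))"
  have "mpoly_eval (\<lambda>i. \<mu> * x i) h = ?c * det (moore_mat x) ^ (q - 1) - 1"
    unfolding h_def
    by (simp add: eval_moore_det det_moore_mat_scale power_mult_distrib power_mult)
  also have "\<dots> = ?c * (det (moore_mat x) ^ (q - 1) - det (wdot n))"
    using \<mu>_power by (simp add: right_diff_distrib)
  finally show ?thesis
    using \<mu>_nonzero by simp
qed

definition coord :: "'k mat set \<Rightarrow> nat \<Rightarrow> 'k" where
  "coord y i = \<mu> * (SOME g. g \<in> y) $$ (i, 0)"

definition section_mat :: "(nat \<Rightarrow> 'k) \<Rightarrow> 'k mat" where
  "section_mat x = moore_mat (\<lambda>i. inverse \<mu> * x i)"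

lemma coord_orbit:
  assumes g: "g \<in> X" and i: "i < n"
  shows "coord (orbit g) i = \<mu> * g $$ (i, 0)"
proof -
  have gc: "g \<in> carrier_mat n n"
    using g by (simp add: DL_cover_iff)
  have "1\<^sub>m n \<in> (stabilizer n :: 'k mat set)"
    by (auto simp: stabilizer_def unipotent_upper_iff)
  then have "g \<in> orbit g"
    using gc unfolding orbit_iff by (metis right_mult_one_mat)
  then have "(SOME h. h \<in> orbit g) \<in> orbit g"
    by (rule someI)
  then obtain v where "v \<in> stabilizer n" "(SOME h. h \<in> orbit g) = g * v"
    unfolding orbit_iff by blast
  then show ?thesis
    using mult_unipotent_first_column[OF gc _ i, of v] by (simp add: coord_def stabilizer_def)
qed

lemma coord_zero: "y \<in> points \<Longrightarrow> mpoly_eval (coord y) h = 0"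
proof -
  assume "y \<in> points"
  then obtain g where g: "g \<in> X" "y = orbit g"
    unfolding points_def by blast
  have "mpoly_eval (coord y) h = mpoly_eval (\<lambda>i. \<mu> * g $$ (i, 0)) h"
    by (rule mpoly_eval_cong[OF h_in]) (simp add: g coord_orbit)
  then show ?thesis
    using DL_cover_det[OF g(1)] det_moore_mat_iff by simp
qed

lemma section_mat_in: "mpoly_eval x h = 0 \<Longrightarrow> section_mat x \<in> X"
  unfolding section_mat_def
  using det_moore_mat_iff[of "\<lambda>i. inverse \<mu> * x i"] \<mu>_nonzero
  by (intro moore_mat_in_DL_cover) (simp flip: mult.assoc)

lemma coord_section_mat:
  assumes "mpoly_eval x h = 0" "i < n"
  shows "coord (orbit (section_mat x)) i = x i"
  using coord_orbit[OF section_mat_in[OF assms(1)] assms(2)] assms(2) n \<mu>_nonzero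
  by (simp add: section_mat_def moore_mat_index flip: mult.assoc)

lemma orbit_section_mat:
  assumes "y \<in> points"
  shows "section_mat (coord y) \<in> X" "orbit (section_mat (coord y)) = y"
proof -
  interpret group "GL n :: 'k mat monoid" by (rule group_GL)
  show in_X: "section_mat (coord y) \<in> X"
    using section_mat_in coord_zero assms by blast
  obtain g where g: "g \<in> X" "y = orbit g"
    using assms unfolding points_def by blast
  obtain v where v: "v \<in> stabilizer n" "g = moore_mat (\<lambda>i. g $$ (i, 0)) * v"
    using DL_cover_factor[OF g(1)] by blast
  have "section_mat (coord y) = moore_mat (\<lambda>i. g $$ (i, 0))"
    unfolding section_mat_def
    by (rule eq_matI) (auto simp: moore_mat_def g coord_orbit \<mu>_nonzero simp flip: mult.assoc)
  then have "g \<in> section_mat (coord y) <#\<^bsub>GL n\<^esub> stabilizer n"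
    using v unfolding l_coset_def by (auto simp: mult_GL)
  moreover have "section_mat (coord y) \<in> carrier (GL n)"
    using in_X by (auto simp: carrier_GL DL_cover_iff)
  ultimately show "orbit (section_mat (coord y)) = y"
    using l_repr_independence[OF _ _ subgroup_stabilizer] g(2)
    unfolding orbit_def stabilizer_eq by metis
qed

lemma pullback:
  assumes "f \<in> polys_in {..<n}"
  shows "\<exists>f'\<in>polys_in ({..<n} \<times> {..<n}).
    \<forall>g\<in>X. mpoly_eval (($$) g) f' = mpoly_eval (coord (orbit g)) f"
proof -
  obtain f' where f': "f' \<in> polys_in ({..<n} \<times> {..<n})"
    "\<And>a. mpoly_eval a f' = mpoly_eval (\<lambda>i. mpoly_eval a (mconst \<mu> * mvar (i, 0))) f"
    using mpoly_substitution[OF assms, of "\<lambda>i. mconst \<mu> * mvar (i, 0)" "{..<n} \<times> {..<n}"] n by auto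
  have "mpoly_eval (($$) g) f' = mpoly_eval (coord (orbit g)) f" if "g \<in> X" for g
    unfolding f'(2) by (rule mpoly_eval_cong[OF assms]) (simp add: coord_orbit[OF that])
  with f'(1) show ?thesis by blast
qed

lemma pushforward:
  assumes "f \<in> polys_in ({..<n} \<times> {..<n})"
  shows "\<exists>f'\<in>polys_in {..<n}. \<forall>x. mpoly_eval x f' = mpoly_eval (($$) (section_mat x)) f"
proof -
  let ?\<sigma> = "\<lambda>(i, j). (mconst (inverse \<mu>) * mvar i) ^ (q ^ j) :: (nat, 'k) mpoly"
  obtain f' where f': "f' \<in> polys_in {..<n}"
    "\<And>a. mpoly_eval a f' = mpoly_eval (\<lambda>v. mpoly_eval a (?\<sigma> v)) f"
    using mpoly_substitution[OF assms, of ?\<sigma> "{..<n}"] by auto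
  have "mpoly_eval x f' = mpoly_eval (($$) (section_mat x)) f" for x
    unfolding f'(2) by (rule mpoly_eval_cong[OF assms]) (auto simp: section_mat_def moore_mat_index)
  with f'(1) show ?thesis by blast
qed

abbreviation DL :: "('k mat set, 'k) function_space" where "DL \<equiv> DL_variety q n"

lemma DL_eq: "DL = fs_quotient (mat_variety n X) orbit"
  unfolding DL_variety_def orbit_def ..

lemma fs_top_mat_variety: "fs_top (mat_variety n X) = mat_zariski n X"
  by (simp add: mat_variety_def)

lemma openin_DL_iff:
  "openin (fs_top DL) U \<longleftrightarrow> U \<subseteq> points \<and> openin (mat_zariski n X) {g \<in> X. orbit g \<in> U}"
  by (simp add: DL_eq fs_quotient_def openin_fs_quotient_top fs_top_mat_variety
      topspace_mat_zariski points_def)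

lemma openin_DL:
  "openin (fs_top DL) U \<longleftrightarrow>
    (\<exists>S\<subseteq>polys_in {..<n}. U = {y \<in> points. \<not> (\<forall>f\<in>S. mpoly_eval (coord y) f = 0)})"
proof
  assume "openin (fs_top DL) U"
  then obtain S where U: "U \<subseteq> points" and S: "S \<subseteq> polys_in ({..<n} \<times> {..<n})"
    "{g \<in> X. orbit g \<in> U} = {g \<in> X. \<not> (\<forall>f\<in>S. mpoly_eval (($$) g) f = 0)}"
    unfolding openin_DL_iff openin_mat_zariski by blast
  have "\<forall>f\<in>S. \<exists>f'\<in>polys_in {..<n}. \<forall>x. mpoly_eval x f' = mpoly_eval (($$) (section_mat x)) f"
    using S(1) pushforward by blast
  then obtain push where push: "\<And>f. f \<in> S \<Longrightarrow> push f \<in> polys_in {..<n}"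
    "\<And>f x. f \<in> S \<Longrightarrow> mpoly_eval x (push f) = mpoly_eval (($$) (section_mat x)) f"
    by metis
  have "y \<in> U \<longleftrightarrow> \<not> (\<forall>f\<in>push ` S. mpoly_eval (coord y) f = 0)" if "y \<in> points" for y
  proof -
    have "y \<in> U \<longleftrightarrow> section_mat (coord y) \<in> {g \<in> X. orbit g \<in> U}"
      using orbit_section_mat[OF that] by simp
    also have "\<dots> \<longleftrightarrow> \<not> (\<forall>f\<in>push ` S. mpoly_eval (coord y) f = 0)"
      unfolding S(2) using orbit_section_mat(1)[OF that] push(2) by simp
    finally show ?thesis .
  qed
  then have "U = {y \<in> points. \<not> (\<forall>f\<in>push ` S. mpoly_eval (coord y) f = 0)}"
    using U by blast
  moreover have "push ` S \<subseteq> polys_in {..<n}"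
    using push(1) by blast
  ultimately show "\<exists>S\<subseteq>polys_in {..<n}. U = {y \<in> points. \<not> (\<forall>f\<in>S. mpoly_eval (coord y) f = 0)}"
    by (intro exI conjI)
next
  assume "\<exists>S\<subseteq>polys_in {..<n}. U = {y \<in> points. \<not> (\<forall>f\<in>S. mpoly_eval (coord y) f = 0)}"
  then obtain S where S: "S \<subseteq> polys_in {..<n}"
    "U = {y \<in> points. \<not> (\<forall>f\<in>S. mpoly_eval (coord y) f = 0)}" by blast
  have "\<forall>f\<in>S. \<exists>f'\<in>polys_in ({..<n} \<times> {..<n}).
      \<forall>g\<in>X. mpoly_eval (($$) g) f' = mpoly_eval (coord (orbit g)) f"
    using S(1) pullback by blast
  then obtain pull where pull: "\<And>f. f \<in> S \<Longrightarrow> pull f \<in> polys_in ({..<n} \<times> {..<n})"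
    "\<And>f g. f \<in> S \<Longrightarrow> g \<in> X \<Longrightarrow> mpoly_eval (($$) g) (pull f) = mpoly_eval (coord (orbit g)) f"
    by metis
  have "{g \<in> X. orbit g \<in> U} = {g \<in> X. \<not> (\<forall>f\<in>pull ` S. mpoly_eval (($$) g) f = 0)}"
    unfolding S(2) using pull(2) by (auto simp: points_def)
  moreover have "pull ` S \<subseteq> polys_in ({..<n} \<times> {..<n})"
    using pull(1) by blast
  ultimately have "openin (mat_zariski n X) {g \<in> X. orbit g \<in> U}"
    unfolding openin_mat_zariski by (intro exI conjI)
  then show "openin (fs_top DL) U"
    unfolding openin_DL_iff using S(2) by auto
qed

lemma regular_DL_iff:
  assumes U: "U \<subseteq> points"
  shows "r \<in> regular DL U \<longleftrightarrow> r \<in> extensional U \<and>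
    (\<forall>g\<in>{g \<in> X. orbit g \<in> U}. \<exists>W a f. openin (mat_zariski n X) W \<and> g \<in> W \<and>
      W \<subseteq> {g \<in> X. orbit g \<in> U} \<and>
      a \<in> polys_in ({..<n} \<times> {..<n}) \<and> f \<in> polys_in ({..<n} \<times> {..<n}) \<and>
      (\<forall>h\<in>W. mpoly_eval (($$) h) f \<noteq> 0 \<and>
        r (orbit h) = mpoly_eval (($$) h) a / mpoly_eval (($$) h) f))"
proof -
  let ?U = "{g \<in> X. orbit g \<in> U}"
  have "(\<forall>h\<in>W. mpoly_eval (($$) h) f \<noteq> 0 \<and>
        (\<lambda>g\<in>?U. r (orbit g)) h = mpoly_eval (($$) h) a / mpoly_eval (($$) h) f) \<longleftrightarrow>
      (\<forall>h\<in>W. mpoly_eval (($$) h) f \<noteq> 0 \<and>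
        r (orbit h) = mpoly_eval (($$) h) a / mpoly_eval (($$) h) f)"
    if "W \<subseteq> ?U" for W and a f :: "(nat \<times> nat, 'k) mpoly"
    using that by (intro ball_cong refl) auto
  then show ?thesis
    unfolding DL_eq fs_quotient_def
    by (simp add: mat_variety_def topspace_mat_zariski cong: conj_cong)
qed

lemma regular_DL:
  assumes "openin (fs_top DL) U"
  shows "r \<in> regular DL U \<longleftrightarrow> r \<in> extensional U \<and>
    (\<forall>y\<in>U. \<exists>W a f. openin (fs_top DL) W \<and> y \<in> W \<and> W \<subseteq> U \<and>
      a \<in> polys_in {..<n} \<and> f \<in> polys_in {..<n} \<and>
      (\<forall>z\<in>W. mpoly_eval (coord z) f \<noteq> 0 \<and>
        r z = mpoly_eval (coord z) a / mpoly_eval (coord z) f))"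
    (is "_ \<longleftrightarrow> _ \<and> ?local")
proof -
  have U: "U \<subseteq> points"
    using assms unfolding openin_DL_iff by simp
  show ?thesis
    unfolding regular_DL_iff[OF U]
  proof (intro conj_cong refl iffI ballI)
    assume loc: "\<forall>g\<in>{g \<in> X. orbit g \<in> U}. \<exists>W a f. openin (mat_zariski n X) W \<and> g \<in> W \<and>
      W \<subseteq> {g \<in> X. orbit g \<in> U} \<and>
      a \<in> polys_in ({..<n} \<times> {..<n}) \<and> f \<in> polys_in ({..<n} \<times> {..<n}) \<and>
      (\<forall>h\<in>W. mpoly_eval (($$) h) f \<noteq> 0 \<and>
        r (orbit h) = mpoly_eval (($$) h) a / mpoly_eval (($$) h) f)"
    fix y assume y: "y \<in> U"
    then have "section_mat (coord y) \<in> {g \<in> X. orbit g \<in> U}"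
      using orbit_section_mat U by auto
    then obtain W a f where W: "openin (mat_zariski n X) W" "section_mat (coord y) \<in> W"
        "W \<subseteq> {g \<in> X. orbit g \<in> U}"
      and af: "a \<in> polys_in ({..<n} \<times> {..<n})" "f \<in> polys_in ({..<n} \<times> {..<n})"
      and eq: "\<forall>h\<in>W. mpoly_eval (($$) h) f \<noteq> 0 \<and>
        r (orbit h) = mpoly_eval (($$) h) a / mpoly_eval (($$) h) f"
      by (rule bspec[OF loc, elim_format]) blast
    obtain a' where a': "a' \<in> polys_in {..<n}"
      "\<And>x. mpoly_eval x a' = mpoly_eval (($$) (section_mat x)) a"
      using pushforward[OF af(1)] by blast
    obtain f' where f': "f' \<in> polys_in {..<n}"
      "\<And>x. mpoly_eval x f' = mpoly_eval (($$) (section_mat x)) f"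
      using pushforward[OF af(2)] by blast
    obtain S where S: "S \<subseteq> polys_in ({..<n} \<times> {..<n})"
      "W = {g \<in> X. \<not> (\<forall>f\<in>S. mpoly_eval (($$) g) f = 0)}"
      using W(1) unfolding openin_mat_zariski by blast
    have "\<forall>f\<in>S. \<exists>f'\<in>polys_in {..<n}. \<forall>x. mpoly_eval x f' = mpoly_eval (($$) (section_mat x)) f"
      using S(1) pushforward by blast
    then obtain push where push: "\<And>f. f \<in> S \<Longrightarrow> push f \<in> polys_in {..<n}"
      "\<And>f x. f \<in> S \<Longrightarrow> mpoly_eval x (push f) = mpoly_eval (($$) (section_mat x)) f"
      by metis
    define W' where "W' = {y \<in> points. section_mat (coord y) \<in> W}"
    have "W' = {y \<in> points. \<not> (\<forall>f\<in>push ` S. mpoly_eval (coord y) f = 0)}"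
      unfolding W'_def S(2) using push(2) orbit_section_mat(1) by auto
    moreover have "push ` S \<subseteq> polys_in {..<n}"
      using push(1) by blast
    ultimately have "openin (fs_top DL) W'"
      unfolding openin_DL by (intro exI conjI)
    moreover have "y \<in> W'"
      using y U W(2) unfolding W'_def by auto
    moreover have "W' \<subseteq> U"
      using W(3) orbit_section_mat unfolding W'_def by auto
    moreover have "mpoly_eval (coord z) f' \<noteq> 0 \<and>
        r z = mpoly_eval (coord z) a' / mpoly_eval (coord z) f'" if "z \<in> W'" for z
      using bspec[OF eq, of "section_mat (coord z)"] that orbit_section_mat(2)[of z]
      unfolding W'_def by (simp add: a'(2) f'(2))
    ultimately show "\<exists>W a f. openin (fs_top DL) W \<and> y \<in> W \<and> W \<subseteq> U \<and>
        a \<in> polys_in {..<n} \<and> f \<in> polys_in {..<n} \<and>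
        (\<forall>z\<in>W. mpoly_eval (coord z) f \<noteq> 0 \<and>
          r z = mpoly_eval (coord z) a / mpoly_eval (coord z) f)"
      using a'(1) f'(1) by blast
  next
    assume loc: ?local
    fix g assume g: "g \<in> {g \<in> X. orbit g \<in> U}"
    then obtain W a f where W: "openin (fs_top DL) W" "orbit g \<in> W" "W \<subseteq> U"
      and af: "a \<in> polys_in {..<n}" "f \<in> polys_in {..<n}"
      and eq: "\<forall>z\<in>W. mpoly_eval (coord z) f \<noteq> 0 \<and>
        r z = mpoly_eval (coord z) a / mpoly_eval (coord z) f"
      using bspec[OF loc, of "orbit g"] by auto
    obtain a' where a': "a' \<in> polys_in ({..<n} \<times> {..<n})"
      "\<And>g. g \<in> X \<Longrightarrow> mpoly_eval (($$) g) a' = mpoly_eval (coord (orbit g)) a"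
      using pullback[OF af(1)] by blast
    obtain f' where f': "f' \<in> polys_in ({..<n} \<times> {..<n})"
      "\<And>g. g \<in> X \<Longrightarrow> mpoly_eval (($$) g) f' = mpoly_eval (coord (orbit g)) f"
      using pullback[OF af(2)] by blast
    define W' where "W' = {g \<in> X. orbit g \<in> W}"
    have "openin (mat_zariski n X) W'"
      using W(1) unfolding openin_DL_iff W'_def by simp
    moreover have "g \<in> W'" "W' \<subseteq> {g \<in> X. orbit g \<in> U}"
      using g W unfolding W'_def by auto
    moreover have "mpoly_eval (($$) h) f' \<noteq> 0 \<and>
        r (orbit h) = mpoly_eval (($$) h) a' / mpoly_eval (($$) h) f'" if "h \<in> W'" for h
      using bspec[OF eq, of "orbit h"] that unfolding W'_def by (simp add: a'(2) f'(2))
    ultimately show "\<exists>W a f. openin (mat_zariski n X) W \<and> g \<in> W \<and> W \<subseteq> {g \<in> X. orbit g \<in> U} \<and>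
      a \<in> polys_in ({..<n} \<times> {..<n}) \<and> f \<in> polys_in ({..<n} \<times> {..<n}) \<and>
      (\<forall>h\<in>W. mpoly_eval (($$) h) f \<noteq> 0 \<and>
        r (orbit h) = mpoly_eval (($$) h) a / mpoly_eval (($$) h) f)"
      using a'(1) f'(1) by blast
  qed
qed

section \<open>The coordinate ring of the Deligne--Lusztig variety\<close>

abbreviation R :: "(nat, 'k) mpoly ring" where "R \<equiv> poly_ring {..<n}"

abbreviation I :: "(nat, 'k) mpoly set" where "I \<equiv> Q'_ideal q n"

abbreviation cls :: "(nat, 'k) mpoly \<Rightarrow> (nat, 'k) mpoly set" where "cls f \<equiv> I +>\<^bsub>R\<^esub> f"

definition cls_eval :: "(nat, 'k) mpoly set \<Rightarrow> 'k mat set \<Rightarrow> 'k" where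
  "cls_eval c y = mpoly_eval (coord y) (SOME f. f \<in> c)"

lemma ideal_I: "ideal I R"
  unfolding Q'_ideal_def h_def[symmetric]
  by (rule cring.cgenideal_ideal[OF cring_poly_ring h_in])

lemma I_eq: "I = {g * h | g. g \<in> polys_in {..<n}}"
  unfolding Q'_ideal_def cgenideal_def h_def by simp

lemma cls_iff: "g \<in> cls f \<longleftrightarrow> (\<exists>i\<in>I. g = i + f)"
  unfolding a_r_coset_def r_coset_def by (simp)

lemma carrier_Quot: "carrier (R Quot I) = cls ` polys_in {..<n}"
  unfolding FactRing_def A_RCOSETS_def' by auto

lemma cls_eval_cls:
  assumes y: "y \<in> points"
  shows "cls_eval (cls f) y = mpoly_eval (coord y) f"
proof -
  have "0 \<in> I"
    unfolding I_eq by (intro CollectI exI[of _ 0]) simp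
  then have "\<exists>g. g \<in> cls f"
    unfolding cls_iff by blast
  then obtain i where "i \<in> I" "(SOME g. g \<in> cls f) = i + f"
    using someI_ex[of "\<lambda>g. g \<in> cls f"] unfolding cls_iff by auto
  then show ?thesis
    unfolding cls_eval_def I_eq using coord_zero[OF y] by auto
qed

lemma cls_eq:
  assumes "f \<in> polys_in {..<n}" "g \<in> polys_in {..<n}"
    and eq: "\<And>y. y \<in> points \<Longrightarrow> mpoly_eval (coord y) f = mpoly_eval (coord y) g"
  shows "cls f = cls g"
proof -
  interpret ideal I R by (rule ideal_I)
  have "mpoly_eval a (f - g) = 0" if a: "mpoly_eval a h = 0" for a
  proof -
    let ?y = "orbit (section_mat a)"
    have "?y \<in> points"
      using section_mat_in[OF a] unfolding points_def by blast
    moreover have "mpoly_eval (coord ?y) t = mpoly_eval a t" if "t \<in> polys_in {..<n}" for t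
      using that by (rule mpoly_eval_cong) (simp add: coord_section_mat[OF a])
    ultimately show ?thesis
      using eq[of ?y] assms(1,2) by simp
  qed
  then have "f - g \<in> I"
    using assms(1,2) by (intro vanishing_in_ideal) auto
  then have "f \<in> cls g"
    unfolding cls_iff by force
  then show ?thesis
    using a_repr_independence[OF _ assms(2) a_subgroup] by blast
qed

sublocale coordinate_ring "R Quot I" DL points cls_eval "\<lambda>c. cls (mconst c)"
proof -
  interpret id: ideal I R by (rule ideal_I)
  interpret Q: cring "R Quot I"
    by (rule id.quotient_is_cring[OF cring_poly_ring])
  have hom: "cls \<in> Ring.ring_hom R (R Quot I)"
    by (rule id.rcos_ring_hom)
  have mult: "cls f \<otimes>\<^bsub>R Quot I\<^esub> cls g = cls (f * g)"
    and add: "cls f \<oplus>\<^bsub>R Quot I\<^esub> cls g = cls (f + g)"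
    if "f \<in> polys_in {..<n}" "g \<in> polys_in {..<n}" for f g
    using ring_hom_mult[OF hom that] ring_hom_add[OF hom that] by simp_all
  have zero: "cls f = \<zero>\<^bsub>R Quot I\<^esub>" if "f \<in> I" for f
    using id.a_rcos_const[OF that] by (simp add: FactRing_def)
  show "coordinate_ring (R Quot I) DL points cls_eval (\<lambda>c. cls (mconst c))"
  proof
    fix y a b assume y: "y \<in> points" and ab: "a \<in> carrier (R Quot I)" "b \<in> carrier (R Quot I)"
    obtain f g where fg: "f \<in> polys_in {..<n}" "g \<in> polys_in {..<n}" "a = cls f" "b = cls g"
      using ab unfolding carrier_Quot by blast
    show "cls_eval (a \<otimes>\<^bsub>R Quot I\<^esub> b) y = cls_eval a y * cls_eval b y"
      using fg mult y by (simp add: cls_eval_cls)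
    show "cls_eval (a \<oplus>\<^bsub>R Quot I\<^esub> b) y = cls_eval a y + cls_eval b y"
      using fg add y by (simp add: cls_eval_cls)
  next
    show "cls (mconst c) \<in> carrier (R Quot I)" for c
      unfolding carrier_Quot by simp
    show "cls_eval (cls (mconst c)) y = c" if "y \<in> points" for c y
      using that by (simp add: cls_eval_cls)
  next
    fix a b assume ab: "a \<in> carrier (R Quot I)" "b \<in> carrier (R Quot I)"
      and eq: "\<And>y. y \<in> points \<Longrightarrow> cls_eval a y = cls_eval b y"
    obtain f g where fg: "f \<in> polys_in {..<n}" "g \<in> polys_in {..<n}" "a = cls f" "b = cls g"
      using ab unfolding carrier_Quot by blast
    have "mpoly_eval (coord y) f = mpoly_eval (coord y) g" if "y \<in> points" for y
      using eq[OF that] fg(3,4) by (simp add: cls_eval_cls that)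
    then show "a = b"
      unfolding fg(3,4) by (rule cls_eq[OF fg(1,2)])
  next
    fix P a assume P: "primeideal P (R Quot I)" and a: "a \<in> carrier (R Quot I)" "a \<notin> P"
    interpret P: primeideal P "R Quot I" by fact
    obtain f where f: "f \<in> polys_in {..<n}" "a = cls f"
      using a(1) unfolding carrier_Quot by blast
    define P' where "P' = {f \<in> polys_in {..<n}. cls f \<in> P}"
    interpret hom: ring_hom_ring R "R Quot I" cls
      by (rule id.rcos_ring_hom_ring)
    have "primeideal P' R"
      unfolding P'_def by (rule hom.primeideal_vimage[OF cring_poly_ring P])
    then obtain x where x: "mpoly_eval x f \<noteq> 0" "\<And>g. g \<in> P' \<Longrightarrow> mpoly_eval x g = 0"
      using nullstellensatz_prime[of P' n f] f a(2) unfolding P'_def by auto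
    have "h \<in> I"
      unfolding I_eq by (intro CollectI exI[of _ 1]) simp
    then have "h \<in> P'"
      unfolding P'_def using h_in zero P.zero_closed by simp
    then have hx: "mpoly_eval x h = 0"
      by (rule x(2))
    let ?y = "orbit (section_mat x)"
    have y: "?y \<in> points"
      using section_mat_in[OF hx] unfolding points_def by blast
    have ev: "cls_eval (cls t) ?y = mpoly_eval x t" if "t \<in> polys_in {..<n}" for t
      unfolding cls_eval_cls[OF y]
      using that by (rule mpoly_eval_cong) (simp add: coord_section_mat[OF hx])
    have "cls_eval c ?y = 0" if "c \<in> P" for c
    proof -
      obtain t where "t \<in> polys_in {..<n}" "c = cls t"
        using \<open>c \<in> P\<close> P.a_subset unfolding carrier_Quot by blast
      then show ?thesis
        using ev x(2) that unfolding P'_def by simp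
    qed
    moreover have "cls_eval a ?y \<noteq> 0"
      using ev f x(1) by simp
    ultimately show "\<exists>y\<in>points. (\<forall>p\<in>P. cls_eval p y = 0) \<and> cls_eval a y \<noteq> 0"
      using y by blast
  next
    fix U
    have eq: "{y \<in> points. \<not> (\<forall>f\<in>cls ` S. cls_eval f y = 0)} =
        {y \<in> points. \<not> (\<forall>f\<in>S. mpoly_eval (coord y) f = 0)}" for S
      by (auto simp: cls_eval_cls)
    show "openin (fs_top DL) U \<longleftrightarrow>
        (\<exists>S\<subseteq>carrier (R Quot I). U = {y \<in> points. \<not> (\<forall>f\<in>S. cls_eval f y = 0)})"
      unfolding openin_DL carrier_Quot
    proof
      assume "\<exists>S\<subseteq>polys_in {..<n}. U = {y \<in> points. \<not> (\<forall>f\<in>S. mpoly_eval (coord y) f = 0)}"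
      then obtain S where "S \<subseteq> polys_in {..<n}" "U = {y \<in> points. \<not> (\<forall>f\<in>cls ` S. cls_eval f y = 0)}"
        unfolding eq by blast
      then show "\<exists>S\<subseteq>cls ` polys_in {..<n}. U = {y \<in> points. \<not> (\<forall>f\<in>S. cls_eval f y = 0)}"
        by (intro exI[of _ "cls ` S"] conjI image_mono)
    next
      assume "\<exists>S\<subseteq>cls ` polys_in {..<n}. U = {y \<in> points. \<not> (\<forall>f\<in>S. cls_eval f y = 0)}"
      then obtain S where "S \<subseteq> polys_in {..<n}" "U = {y \<in> points. \<not> (\<forall>f\<in>cls ` S. cls_eval f y = 0)}"
        unfolding subset_image_iff by (elim exE conjE) (rule that, simp_all only:)
      then show "\<exists>S\<subseteq>polys_in {..<n}. U = {y \<in> points. \<not> (\<forall>f\<in>S. mpoly_eval (coord y) f = 0)}"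
        unfolding eq by (intro exI[of _ S] conjI)
    qed
  next
    fix U r assume U: "openin (fs_top DL) U"
    have eq: "(\<exists>a f. a \<in> carrier (R Quot I) \<and> f \<in> carrier (R Quot I) \<and>
          (\<forall>z\<in>W. cls_eval f z \<noteq> 0 \<and> r z = cls_eval a z / cls_eval f z)) \<longleftrightarrow>
        (\<exists>a f. a \<in> polys_in {..<n} \<and> f \<in> polys_in {..<n} \<and>
          (\<forall>z\<in>W. mpoly_eval (coord z) f \<noteq> 0 \<and>
            r z = mpoly_eval (coord z) a / mpoly_eval (coord z) f))"
      if W: "openin (fs_top DL) W" for W
    proof -
      have "z \<in> points" if "z \<in> W" for z
        using that W unfolding openin_DL_iff by blast
      then show ?thesis
        unfolding carrier_Quot
        by (auto simp: cls_eval_cls cong: ball_cong; fastforce simp: cls_eval_cls)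
    qed
    show "r \<in> regular DL U \<longleftrightarrow> r \<in> extensional U \<and>
        (\<forall>y\<in>U. \<exists>W a f. openin (fs_top DL) W \<and> y \<in> W \<and> W \<subseteq> U \<and> a \<in> carrier (R Quot I) \<and>
          f \<in> carrier (R Quot I) \<and> (\<forall>z\<in>W. cls_eval f z \<noteq> 0 \<and> r z = cls_eval a z / cls_eval f z))"
      unfolding regular_DL[OF U]
    proof (intro conj_cong refl ball_cong ex_cong1)
      fix y W
      show "(\<exists>a f. openin (fs_top DL) W \<and> y \<in> W \<and> W \<subseteq> U \<and> a \<in> polys_in {..<n} \<and>
            f \<in> polys_in {..<n} \<and> (\<forall>z\<in>W. mpoly_eval (coord z) f \<noteq> 0 \<and>
              r z = mpoly_eval (coord z) a / mpoly_eval (coord z) f)) \<longleftrightarrow>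
          (\<exists>a f. openin (fs_top DL) W \<and> y \<in> W \<and> W \<subseteq> U \<and> a \<in> carrier (R Quot I) \<and>
            f \<in> carrier (R Quot I) \<and> (\<forall>z\<in>W. cls_eval f z \<noteq> 0 \<and> r z = cls_eval a z / cls_eval f z))"
        using eq[of W] by (cases "openin (fs_top DL) W") (simp_all only: ex_simps(2) simp_thms)
    qed
  qed
qed

end

theorem theorem6p1:
  fixes p s q n :: nat
  assumes "prime p"
    and "s \<ge> 1"
    and "q = p ^ s"
    and "n \<ge> 1"
    and "alg_closure_of_prime_field TYPE('k::alg_closed_field) p"
  shows "isomorphic_over (Q' q n) (scheme_of (DL_variety q n :: ('k mat set, 'k) function_space))"
proof -
  interpret moore p s q n "moore_det q n ^ (q - 1) - 1 :: (nat, 'k) mpoly"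
    using assms by unfold_locales (auto simp: alg_closure_of_prime_field_def)
  show ?thesis
    unfolding Q'_def by (rule Spec_isomorphic)
qed

end
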